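(* Every finite simple planar graph of girth at least $8$ is proper conflict-free $(\mathrm{degree}+2)$-choosable.
   Context: All graphs are finite, simple and undirected. For a vertex $v$ of $G$, $N_G(v)$ is the set of its neighbors and $d_G(v)=|N_G(v)|$. A vertex coloring $\varphi$ is proper if $\varphi(u)\neq\varphi(v)$ for every edge $uv$. A proper conflict-free (PCF) coloring is a proper coloring such that for every non-isolated vertex $v$ some color appears exactly once in $N_G(v)$ (i.e. on exactly one vertex of $N_G(v)$). A list assignment $L$ assigns to each vertex $v$ a set $L(v)$ of colors; an $L$-coloring is a coloring $\varphi$ with $\varphi(v)\in L(v)$ for all $v$. $G$ is proper conflict-free $(\mathrm{degree}+2)$-choosable if for every list assignment $L$ with $|L(v)|\ge d_G(v)+2$ for all $v\in V(G)$ there is a PCF $L$-coloring of $G$. The girth is the length of a shortest cycle, and is $\infty$ for a forest. *)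

theory Defs
  imports
    "HOL-Analysis.Analysis"
    "HOL-Library.Extended_Nat"
    "Graph_Theory.Pair_Digraph"
begin

text \<open>
  A finite simple undirected graph is a \<^locale>\<open>pair_graph\<close>: a finite vertex set with a symmetric
  loop-free arc relation on it. The undirected edge \<open>uv\<close> is present as both arcs \<open>(u, v)\<close> and \<open>(v, u)\<close>.
\<close>

definition neighbors :: "'a pair_pre_digraph \<Rightarrow> 'a \<Rightarrow> 'a set" where
  "neighbors G v = {u. (v, u) \<in> parcs G}"

definition degree :: "'a pair_pre_digraph \<Rightarrow> 'a \<Rightarrow> nat" where
  "degree G v = card (neighbors G v)"

text \<open>
  In a symmetric digraph \<^const>\<open>pre_digraph.cycle\<close> also accepts \<open>[(u, v), (v, u)]\<close>, which traverses a
  single edge back and forth; the cycles of the undirected graph are those of length at least 3.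
  The infimum of the empty set is \<open>\<infinity>\<close>, the girth of a forest.
\<close>

definition girth :: "'a pair_pre_digraph \<Rightarrow> enat" where
  "girth G = (INF p \<in> {p. pre_digraph.cycle (with_proj G) p \<and> 3 \<le> length p}. enat (length p))"

text \<open>
  A drawing in the plane without crossings: \<open>f\<close> places the vertices, and \<open>\<gamma>\<close> maps the undirected edge
  \<open>{u, v}\<close> to an arc (an injective path, traversed in either direction) joining \<open>f u\<close> and \<open>f v\<close>. An arc
  meets no vertex other than its ends, and two different arcs meet only in common end vertices.
\<close>

definition plane_drawing ::
    "'a pair_pre_digraph \<Rightarrow> ('a \<Rightarrow> complex) \<Rightarrow> ('a set \<Rightarrow> real \<Rightarrow> complex) \<Rightarrow> bool" where
  "plane_drawing G f \<gamma> \<longleftrightarrow>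
     inj_on f (pverts G) \<and>
     (\<forall>(u, v) \<in> parcs G.
        arc (\<gamma> {u, v}) \<and>
        {pathstart (\<gamma> {u, v}), pathfinish (\<gamma> {u, v})} = {f u, f v} \<and>
        path_image (\<gamma> {u, v}) \<inter> f ` pverts G = {f u, f v}) \<and>
     (\<forall>(u, v) \<in> parcs G. \<forall>(x, y) \<in> parcs G. {u, v} \<noteq> {x, y} \<longrightarrow>
        path_image (\<gamma> {u, v}) \<inter> path_image (\<gamma> {x, y}) \<subseteq> f ` ({u, v} \<inter> {x, y}))"

definition planar :: "'a pair_pre_digraph \<Rightarrow> bool" where
  "planar G \<longleftrightarrow> (\<exists>f \<gamma>. plane_drawing G f \<gamma>)"

definition proper_coloring :: "'a pair_pre_digraph \<Rightarrow> ('a \<Rightarrow> 'c) \<Rightarrow> bool" where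
  "proper_coloring G \<phi> \<longleftrightarrow> (\<forall>(u, v) \<in> parcs G. \<phi> u \<noteq> \<phi> v)"

definition pcf_coloring :: "'a pair_pre_digraph \<Rightarrow> ('a \<Rightarrow> 'c) \<Rightarrow> bool" where
  "pcf_coloring G \<phi> \<longleftrightarrow>
     proper_coloring G \<phi> \<and>
     (\<forall>v \<in> pverts G. neighbors G v \<noteq> {} \<longrightarrow> (\<exists>c. \<exists>!u. u \<in> neighbors G v \<and> \<phi> u = c))"

definition list_coloring ::
    "'a pair_pre_digraph \<Rightarrow> ('a \<Rightarrow> 'c set) \<Rightarrow> ('a \<Rightarrow> 'c) \<Rightarrow> bool" where
  "list_coloring G L \<phi> \<longleftrightarrow> (\<forall>v \<in> pverts G. \<phi> v \<in> L v)"

text \<open>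
  Proper conflict-free (degree + \<open>k\<close>)-choosability for lists of colors of type \<open>'c\<close>. Infinite lists
  are treated separately because \<^const>\<open>card\<close> is 0 on them.
\<close>

definition pcf_degree_choosable :: "'c itself \<Rightarrow> nat \<Rightarrow> 'a pair_pre_digraph \<Rightarrow> bool" where
  "pcf_degree_choosable TYPE('c) k G \<longleftrightarrow>
     (\<forall>L :: 'a \<Rightarrow> 'c set.
        (\<forall>v \<in> pverts G. infinite (L v) \<or> card (L v) \<ge> degree G v + k) \<longrightarrow>
        (\<exists>\<phi>. list_coloring G L \<phi> \<and> pcf_coloring G \<phi>))"

end

theory Submission
  imports Defs
begin

text \<open>
  A minimal counterexample would have two contradictory properties. By \<open>planar_degree_sum\<close> the average
  degree of a nonempty planar graph of girth at least 8 is less than \<open>8/3\<close>; by \<open>degree_sum_ge\<close>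
  the average degree of a minimal counterexample is at least \<open>8/3\<close>.
  
  The first property is the edge bound \<open>(g - 2) * card E \<le> g * (card V - 1)\<close> for plane graphs of girth \<open>g\<close>
  (\<open>plane_edge_bound\<close>), a weak form of the consequence of Euler's formula. Its proof counts no faces. In a smallest
  graph violating the bound, every cycle with an edge inside has a chord path inside
  (\<open>chord_path_exists\<close>), for otherwise the graph falls apart into two smaller graphs with at most one common
  vertex, whose bounds add up. By the theorem on theta curves, a chord path cuts the inside of the cycle into the
  insides of two cycles (\<open>chord_split\<close>), and induction gives Euler's inequality for the inside of every cycle
  (\<open>inside_count\<close>). It remains to have a cycle that encloses everything: take one with no edge inside, and
  apply the inversion about a point inside it.
  
  The second property comes from reducible configurations and discharging. If a set \<open>S\<close> is deleted from a
  minimal counterexample, then the rest can be colored, and a kept vertex with a single deleted neighbor forbids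
  there its own color and one color that is unique around it, so at most two colors, and only one if its degree
  is 3 (\<open>guarded_coloring\<close>). A vertex of degree 2 has a list of four colors. Hence there are no four
  consecutive vertices of degree 2, and the vertices of degree 3 have few neighbors of degree 2. The main
  configuration is a vertex \<open>v\<close> of degree at least 4 with too many neighbors of degree 2
  (\<open>star_bound\<close>): delete \<open>v\<close> and the vertices of degree 2 on the threads that start at \<open>v\<close>. On each
  thread all but at most two colors of \<open>v\<close> leave at least two colors for the neighbor of \<open>v\<close>. An averaging
  argument yields a color of \<open>v\<close> such that at most three neighbors of \<open>v\<close> are left without a choice, and
  then some color can be made unique around \<open>v\<close>. Girth 8 ensures that the threads do not interfere with each other:
  two short walks from \<open>v\<close> that do not backtrack have different ends (\<open>nb_walk_unique\<close>). The
  weights in \<open>star_bound\<close> are those that the discharging argument for the average degree \<open>8/3\<close> requires.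
\<close>

section \<open>Short cycles and non-backtracking walks\<close>

definition cyclic_list :: "('a \<Rightarrow> 'a \<Rightarrow> bool) \<Rightarrow> 'a list \<Rightarrow> bool" where
  "cyclic_list adj xs \<longleftrightarrow>
     distinct xs \<and> 3 \<le> length xs \<and> successively adj xs \<and> adj (last xs) (hd xs)"

definition girth_ge :: "nat \<Rightarrow> ('a \<Rightarrow> 'a \<Rightarrow> bool) \<Rightarrow> bool" where
  "girth_ge g adj \<longleftrightarrow> (\<forall>xs. cyclic_list adj xs \<longrightarrow> g \<le> length xs)"

fun nb_walk :: "('a \<Rightarrow> 'a \<Rightarrow> bool) \<Rightarrow> 'a list \<Rightarrow> bool" where
  "nb_walk adj [] \<longleftrightarrow> True"
| "nb_walk adj [x] \<longleftrightarrow> True"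
| "nb_walk adj [x, y] \<longleftrightarrow> adj x y"
| "nb_walk adj (x # y # z # zs) \<longleftrightarrow> adj x y \<and> x \<noteq> z \<and> nb_walk adj (y # z # zs)"

lemma nb_walk_tl: "nb_walk adj (x # xs) \<Longrightarrow> nb_walk adj xs"
  by (cases "(adj, x # xs)" rule: nb_walk.cases) auto

lemma nb_walk_successively: "nb_walk adj xs \<Longrightarrow> successively adj xs"
  by (induction adj xs rule: nb_walk.induct) auto

lemma nb_walk_join:
  assumes "nb_walk adj (xs @ [m])" "nb_walk adj (m # ys)"
    and "xs \<noteq> [] \<Longrightarrow> ys \<noteq> [] \<Longrightarrow> last xs \<noteq> hd ys"
  shows "nb_walk adj (xs @ m # ys)"
  using assms
proof (induction xs)
  case (Cons x xs)
  then have IH: "nb_walk adj (xs @ m # ys)"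
    by (metis append_Cons last_ConsR list.distinct(1) nb_walk_tl)
  show ?case
  proof (cases xs)
    case Nil
    then show ?thesis using Cons.prems by (cases ys) auto
  next
    case (Cons x' xs')
    then show ?thesis using IH Cons.prems by (cases xs') auto
  qed
qed simp

lemma nb_walk_rev:
  assumes sym: "\<And>x y. adj x y \<Longrightarrow> adj y x"
  shows "nb_walk adj xs \<Longrightarrow> nb_walk adj (rev xs)"
proof (induction xs)
  case (Cons x xs)
  show ?case
  proof (cases xs)
    case (Cons y ys)
    have "nb_walk adj (rev ys @ y # [x])"
    proof (rule nb_walk_join)
      show "nb_walk adj (rev ys @ [y])"
        using Cons.IH Cons.prems Cons by (auto dest: nb_walk_tl)
      show "nb_walk adj (y # [x])" 
        using Cons.prems Cons sym by (cases ys) auto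
      show "last (rev ys) \<noteq> hd [x]" if "rev ys \<noteq> []"
        using Cons.prems Cons that by (cases ys) auto
    qed
    then show ?thesis using Cons by simp
  qed simp
qed simp

text \<open>
  If the first vertex of a non-backtracking walk came back, then the part between its first two
  visits would be a cycle: it is too long to be an edge run back and forth.
\<close>

lemma nb_walk_distinct:
  assumes girth: "girth_ge g adj" and irrefl: "\<And>x. \<not> adj x x"
  shows "nb_walk adj xs \<Longrightarrow> length xs \<le> g \<Longrightarrow> distinct xs"
proof (induction xs)
  case (Cons x xs)
  then have d: "distinct xs" by (auto dest: nb_walk_tl)
  have "x \<notin> set xs"
  proof
    assume "x \<in> set xs"
    then obtain us vs where xs: "xs = us @ x # vs" by (auto simp: in_set_conv_decomp)
    have s: "successively adj (x # us @ x # vs)"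
      using nb_walk_successively[OF Cons.prems(1)] by (simp add: xs)
    have "us \<noteq> []" using s irrefl by auto
    moreover have "us \<noteq> [y]" for y using Cons.prems(1) by (auto simp: xs)
    ultimately have "2 \<le> length us" by (cases us; cases "tl us") auto
    moreover have "successively adj (x # us)" "adj (last us) x"
      using s \<open>us \<noteq> []\<close> by (auto simp: successively_append_iff successively_Cons)
    ultimately have "cyclic_list adj (x # us)"
      using d by (auto simp: cyclic_list_def xs)
    then show False
      using girth Cons.prems(2) by (auto simp: girth_ge_def xs)
  qed
  with d show ?case by simp
qed simp

text \<open>
  This is the form in which the girth is used. After their common beginning, one walk reversed and followed by
  the other is again a non-backtracking walk, and it would be closed.
\<close>

lemma nb_walk_unique:
  assumes girth: "girth_ge g adj" and irrefl: "\<And>x. \<not> adj x x"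
    and sym: "\<And>x y. adj x y \<Longrightarrow> adj y x"
  shows "nb_walk adj (m # p) \<Longrightarrow> nb_walk adj (m # q) \<Longrightarrow> last (m # p) = last (m # q) \<Longrightarrow>
    length p + length q < g \<Longrightarrow> p = q"
proof (induction p arbitrary: m q)
  case Nil
  then have "distinct (m # q)" by (intro nb_walk_distinct[OF girth irrefl]) auto
  with Nil show ?case by (cases q rule: rev_cases) auto
next
  case (Cons x p)
  show ?case
  proof (cases q)
    case Nil
    have "distinct (m # x # p)"
      using Cons.prems Nil by (intro nb_walk_distinct[OF girth irrefl]) auto
    with Cons.prems Nil show ?thesis by (cases p rule: rev_cases) auto
  next
    case q: (Cons y q')
    show ?thesis
    proof (cases "x = y")
      case True
      have "p = q'"
        using Cons.prems unfolding q True 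
        by (intro Cons.IH[of y]) (auto dest: nb_walk_tl)
      then show ?thesis using q True by simp
    next
      case False
      have "nb_walk adj (rev (x # p) @ m # q)"
      proof (rule nb_walk_join)
        show "nb_walk adj (rev (x # p) @ [m])"
          using nb_walk_rev[OF sym Cons.prems(1)] by simp
      qed (use Cons.prems q False in auto)
      then have "distinct (rev (x # p) @ m # q)"
        using Cons.prems by (intro nb_walk_distinct[OF girth irrefl]) auto
      moreover have "last (x # p) \<in> set (x # p)" "last q \<in> set q"
        using q last_in_set by blast+
      moreover have "last (x # p) = last q"
        using Cons.prems(3) q by simp
      ultimately show ?thesis by (metis IntI distinct_append empty_iff list.set_intros(2) set_rev)
    qed
  qed
qed

section \<open>Edge sets of vertex lists\<close>

fun path_edges :: "'a list \<Rightarrow> 'a set set" where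
  "path_edges [] = {}"
| "path_edges [x] = {}"
| "path_edges (x # y # zs) = insert {x, y} (path_edges (y # zs))"

definition cycle_edges :: "'a list \<Rightarrow> 'a set set" where
  "cycle_edges xs = path_edges (xs @ [hd xs])"

lemma path_edges_append:
  "path_edges (xs @ y # ys) = path_edges (xs @ [y]) \<union> path_edges (y # ys)"
  by (induction xs rule: path_edges.induct) (cases ys; auto)+

lemma path_edges_rev: "path_edges (rev xs) = path_edges xs"
proof (induction xs rule: path_edges.induct)
  case (3 x y zs)
  then show ?case using path_edges_append[of "rev zs" y "[x]"] by (auto simp: insert_commute)
qed auto

lemma path_edges_subset: "e \<in> path_edges xs \<Longrightarrow> e \<subseteq> set xs"
  by (induction xs rule: path_edges.induct) auto

lemma finite_path_edges [simp]: "finite (path_edges xs)"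
  by (induction xs rule: path_edges.induct) auto

lemma card_path_edges: "card (path_edges xs) \<le> length xs - 1"
  by (induction xs rule: path_edges.induct) (auto intro: order_trans[OF card_insert_le_m1])

lemma in_Union_path_edges: "2 \<le> length xs \<Longrightarrow> v \<in> set xs \<Longrightarrow> v \<in> \<Union> (path_edges xs)"
proof (induction xs rule: path_edges.induct)
  case (3 x y zs)
  then show ?case by (cases zs) auto
qed auto

lemma successively_path_edges:
  "successively (\<lambda>u v. {u, v} \<in> E) xs \<longleftrightarrow> path_edges xs \<subseteq> E"
  by (induction xs rule: path_edges.induct) auto

lemma path_edges_ends:
  assumes "distinct (a # us @ [b])" "{a, b} \<in> path_edges (a # us @ [b])"
  shows "us = []"
proof (cases us)
  case (Cons u us')
  have "{a, b} \<notin> path_edges (us @ [b])"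
    using assms(1) path_edges_subset by fastforce
  then show ?thesis using assms Cons by (auto simp: doubleton_eq_iff)
qed simp

text \<open>
  A common edge has both its ends among the common vertices \<open>a\<close> and \<open>b\<close>, so it joins them, and then each path
  consists of this edge alone.
\<close>

lemma path_edges_disjoint:
  assumes "distinct (a # us @ [b])" "distinct (a # vs @ [b])" "set us \<inter> set vs = {}"
    and "us \<noteq> [] \<or> vs \<noteq> []" and two: "\<And>e. e \<in> path_edges (a # us @ [b]) \<Longrightarrow> card e = 2"
  shows "path_edges (a # us @ [b]) \<inter> path_edges (a # vs @ [b]) = {}"
proof -
  have False if e: "e \<in> path_edges (a # us @ [b])" "e \<in> path_edges (a # vs @ [b])" for e
  proof -
    have "e \<subseteq> {a, b}"
      using e[THEN path_edges_subset] assms(3) by auto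
    moreover have "card e = 2" using e two by simp
    ultimately have "e = {a, b}"
      using assms(1) by (intro card_subset_eq) auto
    then show False using path_edges_ends assms e by metis
  qed
  then show ?thesis by blast
qed

lemma cyclic_list_iff:
  "cyclic_list (\<lambda>u v. {u, v} \<in> E) xs \<longleftrightarrow>
     distinct xs \<and> 3 \<le> length xs \<and> cycle_edges xs \<subseteq> E"
proof (cases xs rule: rev_cases)
  case (snoc ys y)
  then show ?thesis
    unfolding cyclic_list_def cycle_edges_def 
    using path_edges_append[of ys y "[hd xs]"] by (auto simp: successively_path_edges)
qed (auto simp: cyclic_list_def)

lemma cycle_edges_two_paths:
  "cycle_edges (a # us @ b # vs) = path_edges (a # us @ [b]) \<union> path_edges (a # rev vs @ [b])"
  using path_edges_append[of "a # us" b "vs @ [a]"] path_edges_rev[of "b # vs @ [a]"]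
  by (simp add: cycle_edges_def)

lemma cycle_edges_rotate: "cycle_edges (xs @ ys) = cycle_edges (ys @ xs)"
proof (cases xs; cases ys)
  fix a us b vs assume "xs = a # us" "ys = b # vs"
  then show ?thesis
    using path_edges_append[of "a # us" b "vs @ [a]"] path_edges_append[of "b # vs" a "us @ [b]"]
    by (auto simp: cycle_edges_def)
qed auto

lemma cycle_through_two:
  assumes "a \<in> set xs" "b \<in> set xs" "a \<noteq> b" "distinct xs"
  obtains us vs where "distinct (a # us @ b # vs)" "cycle_edges (a # us @ b # vs) = cycle_edges xs"
    "set (a # us @ b # vs) = set xs" "length (a # us @ b # vs) = length xs"
proof -
  obtain p q where xs: "xs = p @ a # q" using assms(1) by (auto simp: in_set_conv_decomp)
  then have "b \<in> set (q @ p)" using assms by auto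
  then obtain us vs where qp: "q @ p = us @ b # vs" by (meson split_list)
  have eq: "a # us @ b # vs = a # q @ p" using qp by simp
  show thesis
    using assms(4) cycle_edges_rotate[of "a # q" p] by (intro that[of us vs]; unfold eq xs) auto
qed

section \<open>Plane drawings\<close>

lemma connected_inside_dichotomy:
  assumes "connected T" "T \<inter> S = {}"
  shows "T \<subseteq> inside S \<or> T \<inter> inside S = {}"
proof -
  have "y \<in> inside S" if "x \<in> T" "x \<in> inside S" "y \<in> T" for x y
    using inside_same_component[of S x y] that assms
    by (meson connected_component_of_subset connected_component_def disjoint_eq_subset_Compl)
  then show ?thesis by blast
qed

text \<open>
  The inversion about a point \<open>p\<close> inside \<open>K\<close> turns the outside in. If the image of an outside point were
  outside the image of \<open>K\<close>, then pulling that unbounded connected region back would join the point,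
  without meeting \<open>K\<close>, to points arbitrarily close to \<open>p\<close>.
\<close>

lemma inversion_outside_in:
  fixes K :: "complex set"
  assumes K: "compact K" and p: "p \<in> inside K" and z: "z \<in> outside K"
  shows "inverse (z - p) \<in> inside ((\<lambda>w. inverse (w - p)) ` K)"
proof (rule ccontr)
  let ?J = "\<lambda>w. inverse (w - p)" and ?I = "\<lambda>w. p + inverse w"
  assume not_in: "?J z \<notin> inside (?J ` K)"
  have IJ: "?I (?J w) = w" for w by simp
  have "p \<notin> K" using p inside_no_overlap by blast
  then have cK: "compact (?J ` K)"
    using K by (intro compact_continuous_image continuous_intros) auto
  have "z \<notin> K" using z outside_no_overlap by blast
  then have "?J z \<notin> ?J ` K" by auto
  with not_in have zO: "?J z \<in> outside (?J ` K)"
    by (simp add: outside_inside)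
  have "z \<noteq> p" using p z inside_Int_outside by blast
  define T where "T = ?I ` (outside (?J ` K) - {0})"
  have "open (outside (?J ` K))" "connected (outside (?J ` K))"
    using cK by (auto intro!: open_outside connected_outside dest: compact_imp_closed compact_imp_bounded)
  then have "connected (outside (?J ` K) - {0})" by (intro connected_open_delete) auto
  then have T: "connected T"
    unfolding T_def by (intro connected_continuous_image continuous_intros) auto
  have zT: "z \<in> T"
    unfolding T_def using zO IJ[of z] \<open>z \<noteq> p\<close> by (intro image_eqI[of _ _ "?J z"]) auto
  have TK: "T \<inter> K = {}"
  proof -
    have "?I w \<notin> K" if "w \<in> outside (?J ` K)" for w
    proof
      assume "?I w \<in> K"
      then have "?J (?I w) \<in> ?J ` K" by blast
      moreover have "?J (?I w) = w" by simp
      ultimately have "w \<in> ?J ` K" by simp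
      then show False using that outside_no_overlap[of "?J ` K"] by blast
    qed
    then show ?thesis by (auto simp: T_def)
  qed
  obtain e where e: "e > 0" "ball p e \<subseteq> inside K"
    using open_inside[OF compact_imp_closed[OF K]] p by (auto simp: open_contains_ball)
  have "\<not> bounded (outside (?J ` K))"
    using cK compact_imp_bounded unbounded_outside by blast
  then obtain w where w: "w \<in> outside (?J ` K)" "norm w > inverse e"
    by (meson boundedI not_le_imp_less)
  have "w \<noteq> 0" using w(2) e(1) by auto
  moreover have "norm (inverse w) < e"
    using w(2) e(1) by (metis inverse_inverse_eq inverse_less_imp_less inverse_positive_iff_positive less_trans norm_inverse)
  ultimately have "?I w \<in> T" "?I w \<in> inside K"
    using w e by (auto simp: T_def dist_norm)
  then have "T \<subseteq> inside K"
    using connected_inside_dichotomy[OF T TK] by blast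
  then show False using zT z inside_Int_outside by blast
qed

locale plane_graph =
  fixes V :: "'a set" and E :: "'a set set" and f :: "'a \<Rightarrow> complex"
    and \<gamma> :: "'a set \<Rightarrow> real \<Rightarrow> complex"
  assumes finite_V: "finite V"
    and edge_ends: "\<And>e. e \<in> E \<Longrightarrow> \<exists>u v. e = {u, v} \<and> u \<noteq> v \<and> u \<in> V \<and> v \<in> V"
    and inj_f: "inj_on f V"
    and arc_edge: "\<And>e. e \<in> E \<Longrightarrow> arc (\<gamma> e)"
    and ends_edge: "\<And>e. e \<in> E \<Longrightarrow> {pathstart (\<gamma> e), pathfinish (\<gamma> e)} = f ` e"
    and edge_vertices: "\<And>e. e \<in> E \<Longrightarrow> path_image (\<gamma> e) \<inter> f ` V = f ` e"
    and edges_cross: "\<And>e e'. e \<in> E \<Longrightarrow> e' \<in> E \<Longrightarrow> e \<noteq> e' \<Longrightarrow>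
      path_image (\<gamma> e) \<inter> path_image (\<gamma> e') \<subseteq> f ` (e \<inter> e')"
begin

lemma edge_subset: "e \<in> E \<Longrightarrow> e \<subseteq> V"
  using edge_ends by blast

lemma finite_E: "finite E"
  using edge_subset finite_V by (meson Pow_iff finite_Pow_iff finite_subset subsetI)

lemma card_edge: "e \<in> E \<Longrightarrow> card e = 2"
  using edge_ends by fastforce

lemma edge_other_end: "e \<in> E \<Longrightarrow> v \<in> e \<Longrightarrow> \<exists>w. e = {v, w} \<and> v \<noteq> w"
  using edge_ends by fastforce

definition drawn :: "'a set set \<Rightarrow> complex set" where
  "drawn F = (\<Union>e\<in>F. path_image (\<gamma> e))"

definition open_edge :: "'a set \<Rightarrow> complex set" where
  "open_edge e = path_image (\<gamma> e) - f ` e"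

lemma drawn_Un: "drawn (F \<union> F') = drawn F \<union> drawn F'"
  by (auto simp: drawn_def)

lemma compact_drawn: "F \<subseteq> E \<Longrightarrow> compact (drawn F)"
  unfolding drawn_def using finite_subset[OF _ finite_E] arc_edge
  by (intro compact_UN) (auto intro!: compact_arc_image)

lemma drawn_vertex: "F \<subseteq> E \<Longrightarrow> v \<in> V \<Longrightarrow> f v \<in> drawn F \<Longrightarrow> v \<in> \<Union> F"
proof -
  assume F: "F \<subseteq> E" and v: "v \<in> V" and "f v \<in> drawn F"
  then obtain e where e: "e \<in> F" "f v \<in> path_image (\<gamma> e)" by (auto simp: drawn_def)
  then have "f v \<in> f ` e" using edge_vertices[of e] F v by blast
  then have "v \<in> e" using inj_f v edge_subset[of e] e F by (auto dest: inj_onD)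
  then show "v \<in> \<Union> F" using e by blast
qed

lemma vertex_drawn: "F \<subseteq> E \<Longrightarrow> v \<in> \<Union> F \<Longrightarrow> f v \<in> drawn F"
  using edge_vertices by (fastforce simp: drawn_def)

lemma drawn_Int:
  assumes "F \<subseteq> E" "F' \<subseteq> E" "F \<inter> F' = {}"
  shows "drawn F \<inter> drawn F' \<subseteq> f ` (\<Union> F \<inter> \<Union> F')"
proof
  fix z assume "z \<in> drawn F \<inter> drawn F'"
  then obtain e e' where "e \<in> F" "e' \<in> F'" "z \<in> path_image (\<gamma> e) \<inter> path_image (\<gamma> e')"
    by (auto simp: drawn_def)
  moreover from this have "z \<in> f ` (e \<inter> e')"
    using edges_cross[of e e'] assms by blast
  ultimately show "z \<in> f ` (\<Union> F \<inter> \<Union> F')" by blast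
qed

lemma open_edge_eq: "e \<in> E \<Longrightarrow> open_edge e = \<gamma> e ` {0<..<1}"
  using simple_path_endless[OF arc_imp_simple_path[OF arc_edge]] ends_edge
  by (simp add: open_edge_def)

lemma open_edge_nonempty: "e \<in> E \<Longrightarrow> open_edge e \<noteq> {}"
  by (simp add: open_edge_eq)

lemma connected_open_edge: "e \<in> E \<Longrightarrow> connected (open_edge e)"
  using connected_simple_path_endless[OF arc_imp_simple_path[OF arc_edge]] ends_edge
  by (simp add: open_edge_def)

lemma connected_half_open_edge:
  assumes "e \<in> E" "v \<in> e"
  shows "connected (insert (f v) (open_edge e))"
proof -
  have c: "continuous_on {0..1} (\<gamma> e)"
    using arc_edge[OF assms(1)] by (auto simp: arc_def path_def)
  have "f v = \<gamma> e 0 \<or> f v = \<gamma> e 1"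
    using ends_edge[OF assms(1)] assms(2) by (auto simp: pathstart_def pathfinish_def)
  moreover have "connected (\<gamma> e ` {0..<1})" "connected (\<gamma> e ` {0<..1})"
    by (intro connected_continuous_image continuous_on_subset[OF c]; force)+
  moreover have "{0..<1} = insert (0::real) {0<..<1}" "{0<..1} = insert (1::real) {0<..<1}"
    by auto
  ultimately show ?thesis
    using open_edge_eq[OF assms(1)] by auto
qed

lemma open_edge_drawn:
  assumes "F \<subseteq> E" "e \<in> E" "e \<notin> F"
  shows "open_edge e \<inter> drawn F = {}"
  using edges_cross[of e] assms by (fastforce simp: open_edge_def drawn_def)

text \<open>
  The first edge meets the later ones only in the second vertex, since these do not contain the first vertex. So
  the arcs of the edges can be joined one after another.
\<close>

lemma path_arc:
  assumes "distinct xs" "2 \<le> length xs" "path_edges xs \<subseteq> E"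
  shows "\<exists>g. arc g \<and> pathstart g = f (hd xs) \<and> pathfinish g = f (last xs) \<and>
    path_image g = drawn (path_edges xs)"
  using assms
proof (induction xs rule: path_edges.induct)
  case (3 x y zs)
  have e: "{x, y} \<in> E" using 3 by simp
  have "\<exists>g. arc g \<and> pathstart g = f x \<and> pathfinish g = f y \<and> path_image g = path_image (\<gamma> {x, y})"
  proof (cases "pathstart (\<gamma> {x, y}) = f x")
    case True
    then have "pathfinish (\<gamma> {x, y}) = f y"
      using ends_edge[OF e] arc_distinct_ends[OF arc_edge[OF e]] by auto
    with True show ?thesis using arc_edge[OF e] by blast
  next
    case False
    then have "pathstart (\<gamma> {x, y}) = f y" "pathfinish (\<gamma> {x, y}) = f x"
      using ends_edge[OF e] by (auto simp: doubleton_eq_iff)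
    then show ?thesis using arc_edge[OF e]
      by (intro exI[of _ "reversepath (\<gamma> {x, y})"]) (simp add: arc_reversepath)
  qed
  then obtain g1 where g1: "arc g1" "pathstart g1 = f x" "pathfinish g1 = f y"
    "path_image g1 = path_image (\<gamma> {x, y})" by blast
  show ?case
  proof (cases zs)
    case Nil
    with g1 show ?thesis by (auto simp: drawn_def)
  next
    case (Cons z zs')
    then obtain g2 where g2: "arc g2" "pathstart g2 = f y" "pathfinish g2 = f (last (y # zs))"
      "path_image g2 = drawn (path_edges (y # zs))"
      using 3 by auto
    have x: "x \<notin> \<Union> (path_edges (y # zs))"
      using 3 path_edges_subset by fastforce
    then have "{{x, y}} \<inter> path_edges (y # zs) = {}" by blast
    then have "drawn {{x, y}} \<inter> drawn (path_edges (y # zs)) \<subseteq>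
        f ` (\<Union> {{x, y}} \<inter> \<Union> (path_edges (y # zs)))"
      using e 3(4) by (intro drawn_Int) auto
    also have "\<dots> \<subseteq> {f y}" using x by auto
    finally have "path_image g1 \<inter> path_image g2 \<subseteq> {pathstart g2}"
      using g1 g2 by (simp add: drawn_def)
    then have "arc (g1 +++ g2)" using g1 g2 by (intro arc_join) auto
    then show ?thesis
      using g1 g2 Cons
      by (intro exI[of _ "g1 +++ g2"]) (auto simp: path_image_join drawn_def)
  qed
qed auto

definition edges_inside :: "'a list \<Rightarrow> 'a set set" where
  "edges_inside xs = {e \<in> E. open_edge e \<subseteq> inside (drawn (cycle_edges xs))}"

definition vertices_inside :: "'a list \<Rightarrow> 'a set" where
  "vertices_inside xs = {v \<in> V. f v \<in> inside (drawn (cycle_edges xs))}"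

lemma finite_edges_inside [simp]: "finite (edges_inside xs)"
  using finite_E by (simp add: edges_inside_def)

lemma finite_vertices_inside [simp]: "finite (vertices_inside xs)"
  using finite_V by (simp add: vertices_inside_def)

lemma edges_inside_not_cycle:
  assumes "e \<in> edges_inside xs" shows "e \<notin> cycle_edges xs"
proof
  assume "e \<in> cycle_edges xs"
  then have "open_edge e \<subseteq> drawn (cycle_edges xs)" by (auto simp: open_edge_def drawn_def)
  with assms show False
    using open_edge_nonempty inside_no_overlap unfolding edges_inside_def by blast
qed

lemma cycle_vertex:
  assumes "distinct xs" "3 \<le> length xs" "v \<in> set xs"
  shows "v \<in> \<Union> (cycle_edges xs)"
  unfolding cycle_edges_def using assms by (intro in_Union_path_edges) auto

lemma vertices_inside_not_cycle:
  assumes "distinct xs" "3 \<le> length xs" "cycle_edges xs \<subseteq> E" "v \<in> vertices_inside xs"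
  shows "v \<notin> set xs"
  using vertex_drawn[OF assms(3) cycle_vertex[OF assms(1,2)]] assms(4) inside_no_overlap
  unfolding vertices_inside_def by blast

lemma Union_cycle_edges: "\<Union> (cycle_edges xs) \<subseteq> set xs"
proof (cases xs)
  case (Cons a ys)
  then show ?thesis using path_edges_subset[of _ "xs @ [hd xs]"] by (fastforce simp: cycle_edges_def)
qed (simp add: cycle_edges_def)

text \<open>
  The open edge together with its end \<open>v\<close> is connected and misses the cycle, so it lies on one side of it.
\<close>

lemma edge_inside_iff_end_inside:
  assumes "cycle_edges xs \<subseteq> E" "e \<in> E" "v \<in> e" "v \<notin> set xs"
  shows "e \<in> edges_inside xs \<longleftrightarrow> v \<in> vertices_inside xs"
proof -
  have "e \<notin> cycle_edges xs" "f v \<notin> drawn (cycle_edges xs)"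
    using assms Union_cycle_edges[of xs] drawn_vertex[of "cycle_edges xs" v] edge_subset by blast+
  then have "insert (f v) (open_edge e) \<inter> drawn (cycle_edges xs) = {}"
    using open_edge_drawn[OF assms(1,2)] by auto
  from connected_inside_dichotomy[OF connected_half_open_edge[OF assms(2,3)] this]
  show ?thesis
    using open_edge_nonempty[OF assms(2)] edge_subset[OF assms(2)] assms(2,3)
    unfolding edges_inside_def vertices_inside_def by blast
qed

lemma inside_nonempty:
  assumes "distinct xs" "3 \<le> length xs" "cycle_edges xs \<subseteq> E"
  shows "inside (drawn (cycle_edges xs)) \<noteq> {}"
proof -
  obtain a ys where "xs = a # ys" using assms(2) by (cases xs) auto
  then obtain us b where xs: "xs = a # us @ [b]" using assms(2) by (cases ys rule: rev_cases) auto
  have ce: "cycle_edges xs = path_edges xs \<union> path_edges [a, b]"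
    using cycle_edges_two_paths[of a us b "[]"] xs by simp
  obtain g1 where g1: "arc g1" "pathstart g1 = f a" "pathfinish g1 = f b"
    "path_image g1 = drawn (path_edges xs)"
    using path_arc[of xs] assms ce xs by auto
  obtain g2 where g2: "arc g2" "pathstart g2 = f a" "pathfinish g2 = f b"
    "path_image g2 = drawn (path_edges [a, b])"
    using path_arc[of "[a, b]"] assms ce xs by auto
  have "path_edges (a # us @ [b]) \<inter> path_edges (a # [] @ [b]) = {}"
    using assms xs ce card_edge by (intro path_edges_disjoint) auto
  then have "path_image g1 \<inter> path_image g2 \<subseteq> {f a, f b}"
    using drawn_Int[of "path_edges xs" "path_edges [a, b]"] assms(3) g1 g2 xs unfolding ce by auto
  then have "simple_path (g1 +++ reversepath g2)"
    using g1 g2 by (intro simple_path_join_loop) (auto simp: arc_reversepath)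
  then have "inside (path_image (g1 +++ reversepath g2)) \<noteq> {}"
    using Jordan_inside_outside[of "g1 +++ reversepath g2"] g1 g2 by simp
  also have "path_image (g1 +++ reversepath g2) = drawn (cycle_edges xs)"
    unfolding ce drawn_Un using g1 g2 by (simp add: path_image_join)
  finally show ?thesis .
qed

definition chord_path :: "'a list \<Rightarrow> 'a \<Rightarrow> 'a list \<Rightarrow> 'a \<Rightarrow> bool" where
  "chord_path xs a ms b \<longleftrightarrow> a \<in> set xs \<and> b \<in> set xs \<and> a \<noteq> b \<and> distinct ms \<and>
     set ms \<inter> set xs = {} \<and> path_edges (a # ms @ [b]) \<subseteq> edges_inside xs"

text \<open>
  The new cycles \<open>ys\<close> and \<open>zs\<close> consist of the chord path and one of the two parts into which its ends divide
  \<open>xs\<close>. Together they form a theta curve, and the insides of \<open>ys\<close> and \<open>zs\<close> are the two halves of the inside of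
  \<open>xs\<close>. An edge inside \<open>xs\<close> that is not on the chord path is connected, so it lies in one of the halves.
\<close>

lemma chord_split:
  assumes cyc: "distinct xs" "3 \<le> length xs" "cycle_edges xs \<subseteq> E"
    and path: "chord_path xs a ms b"
  obtains ys zs where
    "distinct ys" "3 \<le> length ys" "cycle_edges ys \<subseteq> E"
    "distinct zs" "3 \<le> length zs" "cycle_edges zs \<subseteq> E"
    "length ys + length zs = length xs + 2 * Suc (length ms)"
    "edges_inside ys \<subset> edges_inside xs" "edges_inside zs \<subset> edges_inside xs"
    "edges_inside xs \<subseteq> edges_inside ys \<union> edges_inside zs \<union> path_edges (a # ms @ [b])"
    "vertices_inside ys \<union> vertices_inside zs \<union> set ms \<subseteq> vertices_inside xs"
    "vertices_inside ys \<inter> vertices_inside zs = {}"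
    "(vertices_inside ys \<union> vertices_inside zs) \<inter> set ms = {}"
proof -
  have ab: "a \<in> set xs" "b \<in> set xs" "a \<noteq> b"
    and ms: "distinct ms" "set ms \<inter> set xs = {}"
    and chord: "path_edges (a # ms @ [b]) \<subseteq> edges_inside xs"
    using path by (simp_all add: chord_path_def)
  obtain us vs where rot: "distinct (a # us @ b # vs)"
    "cycle_edges (a # us @ b # vs) = cycle_edges xs"
    "set (a # us @ b # vs) = set xs" "length (a # us @ b # vs) = length xs"
    by (rule cycle_through_two[OF ab cyc(1)])
  define P1 P2 Q where "P1 = path_edges (a # us @ [b])" and "P2 = path_edges (a # rev vs @ [b])"
    and "Q = path_edges (a # ms @ [b])"
  define ys zs where "ys = a # us @ b # rev ms" and "zs = a # ms @ b # vs"
  have cx: "cycle_edges xs = P1 \<union> P2"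
    using cycle_edges_two_paths[of a us b vs] rot by (simp add: P1_def P2_def)
  have cy: "cycle_edges ys = P1 \<union> Q"
    using cycle_edges_two_paths[of a us b "rev ms"] by (simp add: ys_def P1_def Q_def)
  have cz: "cycle_edges zs = P2 \<union> Q"
    using cycle_edges_two_paths[of a ms b vs] by (auto simp add: zs_def P2_def Q_def)
  have QE: "Q \<subseteq> E" and Qin: "Q \<subseteq> edges_inside xs" using chord by (auto simp: Q_def edges_inside_def)
  have PE: "P1 \<subseteq> E" "P2 \<subseteq> E" using cyc cx by auto
  have Qx: "Q \<inter> (P1 \<union> P2) = {}" using Qin edges_inside_not_cycle cx by blast
  have ms': "set ms \<inter> set us = {}" "set ms \<inter> set vs = {}" "a \<notin> set ms" "b \<notin> set ms"
    using ms rot(3) by auto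
  have "P1 \<inter> P2 = {}"
    unfolding P1_def P2_def using rot cyc(2) PE card_edge
    by (intro path_edges_disjoint) (auto simp: P1_def)
  have d: "distinct (a # us @ [b])" "distinct (a # rev vs @ [b])" "distinct (a # ms @ [b])"
    using rot ms ms' by auto
  have un: "\<Union> P1 \<subseteq> set (a # us @ [b])" "\<Union> P2 \<subseteq> set (a # rev vs @ [b])" "\<Union> Q \<subseteq> set (a # ms @ [b])"
    unfolding P1_def P2_def Q_def using path_edges_subset by blast+
  obtain c1 where c1: "arc c1" "pathstart c1 = f a" "pathfinish c1 = f b" "path_image c1 = drawn P1"
    using path_arc[OF d(1)] PE by (auto simp: P1_def)
  obtain c2 where c2: "arc c2" "pathstart c2 = f a" "pathfinish c2 = f b" "path_image c2 = drawn P2"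
    using path_arc[OF d(2)] PE by (auto simp: P2_def)
  obtain c where c: "arc c" "pathstart c = f a" "pathfinish c = f b" "path_image c = drawn Q"
    using path_arc[OF d(3)] QE by (auto simp: Q_def)
  have aV: "a \<in> V" "b \<in> V"
    using cycle_vertex[OF cyc(1,2)] ab cyc(3) edge_subset by blast+
  have ends: "f a \<in> drawn P1" "f b \<in> drawn P1" "f a \<in> drawn P2" "f b \<in> drawn P2"
    "f a \<in> drawn Q" "f b \<in> drawn Q"
    using c1 c2 c by (metis pathstart_in_path_image pathfinish_in_path_image)+
  have i12: "drawn P1 \<inter> drawn P2 = {f a, f b}"
  proof -
    have "set (a # us @ [b]) \<inter> set (a # rev vs @ [b]) \<subseteq> {a, b}" using rot(1) by auto
    then have "\<Union> P1 \<inter> \<Union> P2 \<subseteq> {a, b}" using un(1,2) by blast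
    then have "drawn P1 \<inter> drawn P2 \<subseteq> f ` {a, b}"
      by (rule order_trans[OF drawn_Int[OF PE \<open>P1 \<inter> P2 = {}\<close>] image_mono])
    then show ?thesis using ends by (intro subset_antisym) simp_all
  qed
  have i1: "drawn P1 \<inter> drawn Q = {f a, f b}"
  proof -
    have "set (a # us @ [b]) \<inter> set (a # ms @ [b]) \<subseteq> {a, b}" using ms' by auto
    then have "\<Union> P1 \<inter> \<Union> Q \<subseteq> {a, b}" using un(1,3) by blast
    moreover have "P1 \<inter> Q = {}" using Qx by blast
    ultimately have "drawn P1 \<inter> drawn Q \<subseteq> f ` {a, b}"
      by (intro order_trans[OF drawn_Int[OF PE(1) QE] image_mono])
    then show ?thesis using ends by (intro subset_antisym) simp_all
  qed
  have i2: "drawn P2 \<inter> drawn Q = {f a, f b}"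
  proof -
    have "set (a # rev vs @ [b]) \<inter> set (a # ms @ [b]) \<subseteq> {a, b}" using ms' by auto
    then have "\<Union> P2 \<inter> \<Union> Q \<subseteq> {a, b}" using un(2,3) by blast
    moreover have "P2 \<inter> Q = {}" using Qx by blast
    ultimately have "drawn P2 \<inter> drawn Q \<subseteq> f ` {a, b}"
      by (intro order_trans[OF drawn_Int[OF PE(2) QE] image_mono])
    then show ?thesis using ends by (intro subset_antisym) simp_all
  qed
  have "Q \<noteq> {}" by (cases ms) (auto simp: Q_def)
  then obtain q where q: "q \<in> Q" by blast
  then have qin: "open_edge q \<subseteq> inside (drawn P1 \<union> drawn P2)" "open_edge q \<noteq> {}"
    "open_edge q \<subseteq> drawn Q"
    using Qin open_edge_nonempty by (auto simp: edges_inside_def cx drawn_Un open_edge_def drawn_def)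
  let ?S1 = "drawn P1 \<union> drawn Q" and ?S2 = "drawn P2 \<union> drawn Q" and ?S = "drawn P1 \<union> drawn P2"
  have fab: "f a \<noteq> f b" using aV ab inj_f by (auto dest: inj_onD)
  have "inside ?S1 \<inter> inside ?S2 = {} \<and> inside ?S1 \<union> inside ?S2 \<union> (drawn Q - {f a, f b}) = inside ?S"
    by (rule split_inside_simple_closed_curve[of c1 "f a" "f b" c2 c])
      (use c1 c2 c i12 i1 i2 fab qin in \<open>auto simp: arc_imp_simple_path\<close>)
  then have disj: "inside ?S1 \<inter> inside ?S2 = {}"
    and un: "inside ?S1 \<union> inside ?S2 \<union> (drawn Q - {f a, f b}) = inside ?S" by auto
  have no1: "inside ?S1 \<inter> drawn Q = {}" and no2: "inside ?S2 \<inter> drawn Q = {}"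
    using inside_no_overlap[of ?S1] inside_no_overlap[of ?S2] by blast+
  have in1: "inside (drawn (cycle_edges ys)) = inside ?S1"
    and in2: "inside (drawn (cycle_edges zs)) = inside ?S2"
    and inx: "inside (drawn (cycle_edges xs)) = inside ?S"
    by (simp_all add: cx cy cz drawn_Un)
  have pq: "us \<noteq> [] \<or> ms \<noteq> []" "vs \<noteq> [] \<or> ms \<noteq> []"
    using Qx by (auto simp: P1_def P2_def Q_def)
  have dist: "distinct ys" "distinct zs" using rot ms ms' by (auto simp: ys_def zs_def)
  have len: "3 \<le> length ys" "3 \<le> length zs"
    using pq by (auto simp: ys_def zs_def Suc_le_eq numeral_3_eq_3)
  have sub: "edges_inside ys \<subseteq> edges_inside xs" "edges_inside zs \<subseteq> edges_inside xs"
    using un by (auto simp: edges_inside_def in1 in2 inx)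
  have "q \<in> edges_inside xs" "q \<notin> edges_inside ys" "q \<notin> edges_inside zs"
    using q Qin edges_inside_not_cycle cy cz by blast+
  with sub have psub: "edges_inside ys \<subset> edges_inside xs" "edges_inside zs \<subset> edges_inside xs" by auto
  have cov: "edges_inside xs \<subseteq> edges_inside ys \<union> edges_inside zs \<union> Q"
  proof
    fix e assume e: "e \<in> edges_inside xs"
    show "e \<in> edges_inside ys \<union> edges_inside zs \<union> Q"
    proof (cases "e \<in> Q")
      case False
      have eE: "e \<in> E" using e by (simp add: edges_inside_def)
      have "e \<notin> P1 \<union> P2" using edges_inside_not_cycle[OF e] cx by simp
      then have ds: "open_edge e \<inter> ?S1 = {}" "open_edge e \<inter> ?S2 = {}"
        using open_edge_drawn[of "P1 \<union> Q" e] open_edge_drawn[of "P2 \<union> Q" e] False PE QE eE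
        by (auto simp: drawn_Un)
      have "open_edge e \<subseteq> inside ?S1 \<union> inside ?S2"
        using e un ds by (auto simp: edges_inside_def inx)
      then have "open_edge e \<subseteq> inside ?S1 \<or> open_edge e \<subseteq> inside ?S2"
        using connected_inside_dichotomy[OF connected_open_edge[OF eE] ds(1)]
          connected_inside_dichotomy[OF connected_open_edge[OF eE] ds(2)]
        by blast
      then show ?thesis using eE by (auto simp: edges_inside_def in1 in2)
    qed simp
  qed
  have pin: "f v \<in> drawn Q - {f a, f b}" "v \<in> V" if "v \<in> set ms" for v
  proof -
    have "v \<in> \<Union> Q" unfolding Q_def using that by (intro in_Union_path_edges) auto
    then show vV: "v \<in> V" using QE edge_subset by blast
    have "f v \<in> drawn Q" using vertex_drawn[OF QE] \<open>v \<in> \<Union> Q\<close> by blast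
    moreover have "v \<noteq> a" "v \<noteq> b" using that ms' by auto
    then have "f v \<noteq> f a" "f v \<noteq> f b" using inj_f vV aV by (meson inj_onD)+
    ultimately show "f v \<in> drawn Q - {f a, f b}" by blast
  qed
  have vsub: "vertices_inside ys \<union> vertices_inside zs \<union> set ms \<subseteq> vertices_inside xs"
    unfolding vertices_inside_def in1 in2 inx un[symmetric] using pin by blast
  have vdisj: "vertices_inside ys \<inter> vertices_inside zs = {}"
    unfolding vertices_inside_def in1 in2 using disj by blast
  have vpi: "(vertices_inside ys \<union> vertices_inside zs) \<inter> set ms = {}"
    unfolding vertices_inside_def in1 in2 using pin no1 no2 by blast
  have lens: "length ys + length zs = length xs + 2 * Suc (length ms)"
    using rot(4) by (simp add: ys_def zs_def)
  have sE: "cycle_edges ys \<subseteq> E" "cycle_edges zs \<subseteq> E"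
    using PE QE cy cz by auto
  show thesis
    by (rule that[OF dist(1) len(1) sE(1) dist(2) len(2) sE(2) lens psub cov[unfolded Q_def] vsub vdisj vpi])
qed

text \<open>
  This is Euler's formula for the part of the drawing inside a cycle, combined with the bound \<open>k + 2\<close> on the
  lengths of faces; for a cycle with no edge inside it is the bound on the length of the cycle. A chord path with
  \<open>m\<close> inner vertices has \<open>m + 1\<close> edges, which count twice in the lengths of the two new cycles, and the two
  inequalities add up.
\<close>

lemma inside_count:
  assumes chord: "\<And>xs e. distinct xs \<Longrightarrow> 3 \<le> length xs \<Longrightarrow> cycle_edges xs \<subseteq> E \<Longrightarrow>
      e \<in> edges_inside xs \<Longrightarrow> \<exists>a ms b. chord_path xs a ms b"
    and girth: "\<And>xs. distinct xs \<Longrightarrow> 3 \<le> length xs \<Longrightarrow> cycle_edges xs \<subseteq> E \<Longrightarrow> k + 2 \<le> length xs"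
  shows "distinct xs \<Longrightarrow> 3 \<le> length xs \<Longrightarrow> cycle_edges xs \<subseteq> E \<Longrightarrow>
    k * card (edges_inside xs) + (k + 2) \<le> (k + 2) * card (vertices_inside xs) + length xs"
proof (induction "card (edges_inside xs)" arbitrary: xs rule: less_induct)
  case less
  show ?case
  proof (cases "edges_inside xs = {}")
    case True
    then show ?thesis using girth[OF less.prems] by simp
  next
    case False
    then obtain e where "e \<in> edges_inside xs" by blast
    from chord[OF less.prems this] obtain a ms b where p: "chord_path xs a ms b" by blast
    obtain ys zs where s:
      "distinct ys" "3 \<le> length ys" "cycle_edges ys \<subseteq> E"
      "distinct zs" "3 \<le> length zs" "cycle_edges zs \<subseteq> E"
      "length ys + length zs = length xs + 2 * Suc (length ms)"
      "edges_inside ys \<subset> edges_inside xs" "edges_inside zs \<subset> edges_inside xs"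
      "edges_inside xs \<subseteq> edges_inside ys \<union> edges_inside zs \<union> path_edges (a # ms @ [b])"
      "vertices_inside ys \<union> vertices_inside zs \<union> set ms \<subseteq> vertices_inside xs"
      "vertices_inside ys \<inter> vertices_inside zs = {}"
      "(vertices_inside ys \<union> vertices_inside zs) \<inter> set ms = {}"
      by (rule chord_split[OF less.prems p])
    have IHy: "k * card (edges_inside ys) + (k + 2) \<le> (k + 2) * card (vertices_inside ys) + length ys"
      using s by (intro less.hyps psubset_card_mono) auto
    have IHz: "k * card (edges_inside zs) + (k + 2) \<le> (k + 2) * card (vertices_inside zs) + length zs"
      using s by (intro less.hyps psubset_card_mono) auto
    have "card (edges_inside xs) \<le> card (edges_inside ys \<union> edges_inside zs \<union> path_edges (a # ms @ [b]))"
      using s(10) by (intro card_mono) auto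
    also have "\<dots> \<le> card (edges_inside ys) + card (edges_inside zs) + card (path_edges (a # ms @ [b]))"
      by (meson add_le_mono card_Un_le le_refl order_trans)
    also have "\<dots> \<le> card (edges_inside ys) + card (edges_inside zs) + Suc (length ms)"
      using card_path_edges[of "a # ms @ [b]"] by simp
    finally have ce: "k * card (edges_inside xs) \<le>
        k * card (edges_inside ys) + k * card (edges_inside zs) + k * Suc (length ms)"
      by (metis add_mult_distrib2 mult_le_mono2)
    have "card (vertices_inside ys) + card (vertices_inside zs) + length ms =
        card (vertices_inside ys \<union> vertices_inside zs \<union> set ms)"
      using s(12,13) p by (simp add: card_Un_disjoint distinct_card chord_path_def)
    also have "\<dots> \<le> card (vertices_inside xs)" using s(11) by (intro card_mono) auto
    finally have "(k + 2) * card (vertices_inside ys) + (k + 2) * card (vertices_inside zs)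
        + (k + 2) * length ms \<le> (k + 2) * card (vertices_inside xs)"
      by (metis add_mult_distrib2 mult_le_mono2)
    with ce IHy IHz s(7) show ?thesis by (simp add: algebra_simps)
  qed
qed

text \<open>
  A chord path lies inside the old cycle but on the new ones, so they have fewer edges inside.
\<close>

lemma empty_face:
  assumes chord: "\<And>xs e. distinct xs \<Longrightarrow> 3 \<le> length xs \<Longrightarrow> cycle_edges xs \<subseteq> E \<Longrightarrow>
      e \<in> edges_inside xs \<Longrightarrow> \<exists>a ms b. chord_path xs a ms b"
  shows "distinct xs \<Longrightarrow> 3 \<le> length xs \<Longrightarrow> cycle_edges xs \<subseteq> E \<Longrightarrow>
    \<exists>ys. distinct ys \<and> 3 \<le> length ys \<and> cycle_edges ys \<subseteq> E \<and> edges_inside ys = {}"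
proof (induction "card (edges_inside xs)" arbitrary: xs rule: less_induct)
  case less
  show ?case
  proof (cases "edges_inside xs = {}")
    case False
    then obtain e where "e \<in> edges_inside xs" by blast
    from chord[OF less.prems this] obtain a ms b where p: "chord_path xs a ms b" by blast
    obtain ys where "distinct ys" "3 \<le> length ys" "cycle_edges ys \<subseteq> E"
      "edges_inside ys \<subset> edges_inside xs"
      by (rule chord_split[OF less.prems p])
    then show ?thesis by (intro less.hyps[of ys] psubset_card_mono) auto
  qed (use less.prems in blast)
qed

end

section \<open>Chord paths and the edge bound\<close>

text \<open>
  Among the walks between different vertices of \<open>X\<close>, a shortest one has no inner vertex in \<open>X\<close> and
  no repeated vertex, since otherwise it could be cut short.
\<close>

lemma shortest_path_between:
  assumes "(c, c') \<in> r\<^sup>*" "c \<in> X" "c' \<in> X" "c \<noteq> c'"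
  obtains a ms b where "a \<in> X" "b \<in> X" "a \<noteq> b" "distinct ms" "set ms \<inter> X = {}"
    "successively (\<lambda>u v. (u, v) \<in> r) (a # ms @ [b])"
proof -
  define W where "W = (\<lambda>(a, ms, b). a \<in> X \<and> b \<in> X \<and> a \<noteq> b \<and>
    successively (\<lambda>u v. (u, v) \<in> r) (a # ms @ [b]))"
  have walk: "\<exists>w. w \<noteq> [] \<and> hd w = c \<and> last w = c' \<and> successively (\<lambda>u v. (u, v) \<in> r) w"
    using assms(1)
  proof (induction rule: rtrancl_induct)
    case base
    show ?case by (rule exI[of _ "[c]"]) simp
  next
    case (step y z)
    then obtain w where "w \<noteq> []" "hd w = c" "last w = y" "successively (\<lambda>u v. (u, v) \<in> r) w"
      by blast
    then show ?case
      using step(2) by (intro exI[of _ "w @ [z]"]) (auto simp: successively_append_iff)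
  qed
  then obtain w where w: "w \<noteq> []" "hd w = c" "last w = c'" "successively (\<lambda>u v. (u, v) \<in> r) w"
    by blast
  obtain w' where w': "w = c # w'" using w by (cases w) auto
  then have "w' \<noteq> []" using w assms by auto
  then obtain ms0 where "w = c # ms0 @ [c']"
    using w w' by (metis append_butlast_last_id last_ConsR)
  then have "W (c, ms0, c')" using w assms by (simp add: W_def)
  then obtain p where p: "W p" and least: "\<And>q. W q \<Longrightarrow> length (fst (snd p)) \<le> length (fst (snd q))"
    using ex_has_least_nat[of W _ "\<lambda>q. length (fst (snd q))"] by blast
  obtain a ms b where abm: "p = (a, ms, b)" by (cases p)
  have least: "length ms \<le> length ns" if "W (x, ns, y)" for x ns y
    using least[OF that] by (simp add: abm)
  have 1: "a \<in> X" "b \<in> X" "a \<noteq> b" and s: "successively (\<lambda>u v. (u, v) \<in> r) (a # ms @ [b])"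
    using p by (auto simp: abm W_def)
  have "set ms \<inter> X = {}"
  proof (rule ccontr)
    assume "set ms \<inter> X \<noteq> {}"
    then obtain z where z: "z \<in> set ms" "z \<in> X" by blast
    then obtain p q where ms: "ms = p @ z # q" by (meson split_list)
    have "a # ms @ [b] = (a # p @ [z]) @ (q @ [b])" "a # ms @ [b] = (a # p) @ (z # q @ [b])"
      by (simp_all add: ms)
    then have sp: "successively (\<lambda>u v. (u, v) \<in> r) (a # p @ [z])"
      and sq: "successively (\<lambda>u v. (u, v) \<in> r) (z # q @ [b])"
      using s by (metis successively_append_iff)+
    have "W (a, p, z)" if "z \<noteq> a" using that 1 z sp by (simp add: W_def)
    moreover have "W (z, q, b)" if "z = a"
      using that 1 z sq by (simp add: W_def)
    ultimately show False using least[of a p z] least[of z q b] by (auto simp: ms)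
  qed
  moreover have "distinct ms"
  proof (rule ccontr)
    assume "\<not> distinct ms"
    then obtain p q t z where ms: "ms = p @ [z] @ q @ [z] @ t" using not_distinct_decomp by blast
    have "a # ms @ [b] = (a # p @ [z]) @ (q @ [z] @ t @ [b])"
      "a # ms @ [b] = (a # p @ [z] @ q) @ ([z] @ t @ [b])"
      by (simp_all add: ms)
    then have "successively (\<lambda>u v. (u, v) \<in> r) (a # p @ [z])"
      "successively (\<lambda>u v. (u, v) \<in> r) ([z] @ t @ [b])"
      using s by (metis successively_append_iff)+
    then have "successively (\<lambda>u v. (u, v) \<in> r) ((a # p @ [z]) @ (t @ [b]))"
      unfolding successively_append_iff[of _ "a # p @ [z]"] by (simp add: successively_Cons)
    then have "W (a, p @ [z] @ t, b)" using 1 by (simp add: W_def)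
    from least[OF this] show False by (simp add: ms)
  qed
  ultimately show thesis using that 1 s by blast
qed

text \<open>
  Let \<open>K\<close> be the component of \<open>e\<close> in the graph formed by the edges inside the cycle. If \<open>K\<close> has two vertices on the cycle,
  a shortest path between such vertices in \<open>K\<close> is a chord path. Otherwise \<open>K\<close> and the rest of the graph have
  at most one vertex in common, because all edges at a vertex inside the cycle are themselves inside, and the
  bounds for these two smaller graphs add up to the bound that is assumed to fail.
\<close>

lemma (in plane_graph) chord_path_exists:
  assumes bound: "\<And>V' E'. V' \<subseteq> V \<Longrightarrow> E' \<subset> E \<Longrightarrow> \<Union> E' \<subseteq> V' \<Longrightarrow> V' \<noteq> {} \<Longrightarrow>
      k * card E' + g \<le> g * card V'"
    and fails: "\<not> k * card E + g \<le> g * card V"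
    and cyc: "distinct xs" "3 \<le> length xs" "cycle_edges xs \<subseteq> E"
    and e: "e \<in> edges_inside xs"
  shows "\<exists>a ms b. chord_path xs a ms b"
proof -
  define r where "r = {(u, v). {u, v} \<in> edges_inside xs}"
  have "e \<in> E" using e by (simp add: edges_inside_def)
  then obtain u0 u1 where u: "e = {u0, u1}" using edge_ends by blast
  define K where "K = {v. (u0, v) \<in> r\<^sup>*}"
  define EK where "EK = {e' \<in> edges_inside xs. e' \<subseteq> K}"
  have inE: "edges_inside xs \<subseteq> E" by (auto simp: edges_inside_def)
  have "sym r" by (auto simp: r_def sym_def insert_commute)
  have Kedge: "\<exists>e'\<in>edges_inside xs. v \<in> e'" if "v \<in> K" for v
    using that unfolding K_def mem_Collect_eq
    by (cases rule: rtranclE) (use e u in \<open>auto simp: r_def\<close>)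
  have KV: "K \<subseteq> V" using Kedge inE edge_subset by blast
  have "u0 \<in> K" by (simp add: K_def)
  have absorb: "e' \<in> EK" if e': "e' \<in> edges_inside xs" "v \<in> e'" "v \<in> K" for e' v
  proof -
    have "e' \<in> E" using e'(1) inE by blast
    from edge_other_end[OF this e'(2)] obtain w where w: "e' = {v, w}" by blast
    then have "(v, w) \<in> r" using e' by (simp add: r_def)
    then have "w \<in> K" using e'(3) unfolding K_def by (auto intro: rtrancl_into_rtrancl)
    then show ?thesis using e' w by (simp add: EK_def)
  qed
  have xsV: "set xs \<subseteq> V"
  proof
    fix v assume "v \<in> set xs"
    from cycle_vertex[OF cyc(1,2) this] show "v \<in> V" using cyc(3) edge_subset by blast
  qed
  show ?thesis
  proof (cases "card (K \<inter> set xs) \<le> 1")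
    case True
    define R where "R = V - (K - set xs)"
    have eEK: "e \<in> EK" using absorb[OF e, of u0] u \<open>u0 \<in> K\<close> by simp
    have RU: "\<Union> (E - EK) \<subseteq> R"
    proof
      fix v assume "v \<in> \<Union> (E - EK)"
      then obtain e' where e': "e' \<in> E" "e' \<notin> EK" "v \<in> e'" by blast
      have False if v: "v \<in> K" "v \<notin> set xs"
      proof -
        from Kedge[OF v(1)] obtain e'' where e'': "e'' \<in> edges_inside xs" "v \<in> e''" by blast
        then have "e'' \<in> E" using inE by blast
        from edge_inside_iff_end_inside[OF cyc(3) this e''(2) v(2)] e''(1)
        have "v \<in> vertices_inside xs" by simp
        with edge_inside_iff_end_inside[OF cyc(3) e'(1) e'(3) v(2)]
        have "e' \<in> edges_inside xs" by simp
        from absorb[OF this e'(3) v(1)] e'(2) show False by simp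
      qed
      then show "v \<in> R" using e' edge_subset by (auto simp: R_def)
    qed
    have "xs \<noteq> []" using cyc(2) by auto
    then obtain c where c: "c \<in> cycle_edges xs" using cycle_vertex[OF cyc(1,2), of "hd xs"] by auto
    then have "c \<notin> EK" using edges_inside_not_cycle[of c xs] unfolding EK_def by blast
    moreover have "EK \<subseteq> E" using inE unfolding EK_def by blast
    ultimately have "EK \<subset> E" using c cyc(3) by blast
    moreover have "\<Union> EK \<subseteq> K" "K \<noteq> {}" using \<open>u0 \<in> K\<close> by (auto simp: EK_def)
    ultimately have bK: "k * card EK + g \<le> g * card K"
      using bound[OF KV] by simp
    have "hd xs \<in> R" using xsV \<open>xs \<noteq> []\<close> unfolding R_def by auto
    moreover have "R \<subseteq> V" by (auto simp: R_def)
    moreover have "E - EK \<subset> E" using eEK \<open>e \<in> E\<close> by blast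
    ultimately have bR: "k * card (E - EK) + g \<le> g * card R"
      using bound[of R "E - EK"] RU by blast
    have cE: "card E = card EK + card (E - EK)"
      using finite_E \<open>EK \<subset> E\<close> by (metis card_Diff_subset card_mono finite_subset le_add_diff_inverse psubset_imp_subset)
    have fK: "finite K" using KV finite_V finite_subset by blast
    have "card R + card (K - set xs) = card V"
      unfolding R_def using KV finite_V fK
      by (metis Diff_subset card_Diff_subset card_mono finite_Diff le_add_diff_inverse2 order_trans)
    moreover have "card K = card (K - set xs) + card (K \<inter> set xs)"
      using fK by (metis card_Diff_subset_Int card_mono finite_Int inf_le1 le_add_diff_inverse2)
    ultimately have "card K + card R \<le> card V + 1" using True by simp
    then have "g * card K + g * card R \<le> g * card V + g"
      by (metis add_mult_distrib2 mult.right_neutral mult_le_mono2)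
    then have "k * card E + g \<le> g * card V"
      using bK bR cE by (simp add: algebra_simps)
    with fails show ?thesis by simp
  next
    case False
    then obtain c c' where c: "c \<in> K" "c' \<in> K" "c \<in> set xs" "c' \<in> set xs" "c \<noteq> c'"
      by (metis IntD1 IntD2 card_le_Suc0_iff_eq One_nat_def finite_Int finite_set)
    have "(c, c') \<in> r\<^sup>*"
      using c \<open>sym r\<close> unfolding K_def by (auto dest: sym_rtrancl[THEN symD] intro: rtrancl_trans)
    then obtain a ms b where "a \<in> set xs" "b \<in> set xs" "a \<noteq> b" "distinct ms" "set ms \<inter> set xs = {}"
      "successively (\<lambda>u v. (u, v) \<in> r) (a # ms @ [b])"
      using c by (elim shortest_path_between[where X = "set xs"]) auto
    moreover from this(6) have "path_edges (a # ms @ [b]) \<subseteq> edges_inside xs"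
      by (simp add: r_def successively_path_edges)
    ultimately show ?thesis by (auto simp: chord_path_def)
  qed
qed

text \<open>
  The neighbors of the first vertex of a longest path are all on the path.
\<close>

lemma (in plane_graph) cycle_exists:
  assumes deg: "\<And>v. v \<in> V \<Longrightarrow> \<exists>e1 e2. e1 \<in> E \<and> e2 \<in> E \<and> e1 \<noteq> e2 \<and> v \<in> e1 \<and> v \<in> e2"
    and "V \<noteq> {}"
  obtains xs where "distinct xs" "3 \<le> length xs" "cycle_edges xs \<subseteq> E"
proof -
  define P where "P = (\<lambda>w. w \<noteq> [] \<and> distinct w \<and> set w \<subseteq> V \<and> path_edges w \<subseteq> E)"
  obtain v0 where "v0 \<in> V" using assms by blast
  then have "P [v0]" by (simp add: P_def)
  moreover have "\<forall>w. P w \<longrightarrow> length w < Suc (card V)"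
    using finite_V by (metis P_def card_mono distinct_card le_imp_less_Suc)
  ultimately have "\<exists>w. P w \<and> (\<forall>w'. P w' \<longrightarrow> length w' \<le> length w)"
    by (rule ex_has_greatest_nat)
  then obtain w where w: "P w" and longest: "\<And>w'. P w' \<Longrightarrow> length w' \<le> length w"
    by blast
  obtain a ys where aw: "w = a # ys" using w by (cases w) (auto simp: P_def)
  obtain e1 e2 where e12: "e1 \<in> E" "e2 \<in> E" "e1 \<noteq> e2" "a \<in> e1" "a \<in> e2"
    using deg[of a] w aw by (auto simp: P_def)
  then obtain n1 n2 where n12: "e1 = {a, n1}" "e2 = {a, n2}" "a \<noteq> n1" "a \<noteq> n2"
    using edge_other_end by metis
  have nb: "n \<in> set ys" if "{a, n} \<in> E" "a \<noteq> n" for n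
  proof (rule ccontr)
    assume "n \<notin> set ys"
    then have "P (n # w)"
      using w that edge_subset[OF that(1)] by (auto simp: P_def aw insert_commute)
    then show False using longest by fastforce
  qed
  obtain n where n: "{a, n} \<in> E" "a \<noteq> n" "n \<noteq> hd ys"
    using e12 n12 by metis
  obtain p q where ys: "ys = p @ n # q" using nb n by (meson split_list)
  have "p \<noteq> []" using n ys by auto
  moreover have "path_edges (a # p @ [n]) \<subseteq> E"
    using w path_edges_append[of "a # p" n q] by (auto simp: P_def aw ys)
  moreover have "cycle_edges (a # p @ [n]) = path_edges (a # p @ [n]) \<union> {{a, n}}"
    using cycle_edges_two_paths[of a p n "[]"] by simp
  moreover have "distinct (a # p @ [n])" using w by (auto simp: P_def aw ys)
  ultimately show thesis using that[of "a # p @ [n]"] n by (cases p) auto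
qed

lemma plane_graph_mono:
  assumes "plane_graph V E f \<gamma>" "V' \<subseteq> V" "E' \<subseteq> E" "\<Union> E' \<subseteq> V'"
  shows "plane_graph V' E' f \<gamma>"
proof -
  interpret plane_graph V E f \<gamma> by fact
  have sub: "e \<in> E" if "e \<in> E'" for e using that assms(3) by blast
  show ?thesis
  proof
    show "finite V'" using assms(2) finite_V finite_subset by blast
    show "inj_on f V'" using inj_f assms(2) inj_on_subset by blast
    fix e assume e: "e \<in> E'"
    show "\<exists>u v. e = {u, v} \<and> u \<noteq> v \<and> u \<in> V' \<and> v \<in> V'"
      using edge_ends[OF sub[OF e]] e assms(4) by blast
    show "path_image (\<gamma> e) \<inter> f ` V' = f ` e"
      using edge_vertices[OF sub[OF e]] e assms(2,4) by blast
  qed (use sub arc_edge ends_edge edges_cross in blast)+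
qed

lemma (in plane_graph) inverted:
  assumes "\<And>e. e \<in> E \<Longrightarrow> p \<notin> path_image (\<gamma> e)"
  shows "plane_graph V E (\<lambda>v. inverse (f v - p)) (\<lambda>e. (\<lambda>z. inverse (z - p)) \<circ> \<gamma> e)"
proof -
  let ?J = "\<lambda>z::complex. inverse (z - p)"
  have inj: "inj ?J" by (auto intro: injI)
  have im: "(\<lambda>v. ?J (f v)) ` A = ?J ` f ` A" for A by auto
  show ?thesis
  proof
    show "inj_on (\<lambda>v. ?J (f v)) V" using inj_f inj by (auto simp: inj_on_def)
    fix e assume e: "e \<in> E"
    have "path (?J \<circ> \<gamma> e)"
      using arc_edge[OF e] assms[OF e]
      by (intro path_continuous_image arc_imp_path continuous_intros) auto
    moreover have "inj_on (?J \<circ> \<gamma> e) {0..1}"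
      using arc_edge[OF e] inj by (auto simp: arc_def intro!: comp_inj_on elim: inj_on_subset)
    ultimately show "arc (?J \<circ> \<gamma> e)" by (simp add: arc_def)
    have "{pathstart (?J \<circ> \<gamma> e), pathfinish (?J \<circ> \<gamma> e)} = ?J ` {pathstart (\<gamma> e), pathfinish (\<gamma> e)}"
      by (simp add: pathstart_def pathfinish_def)
    then show "{pathstart (?J \<circ> \<gamma> e), pathfinish (?J \<circ> \<gamma> e)} = (\<lambda>v. ?J (f v)) ` e"
      using ends_edge[OF e] im by simp
    show "path_image (?J \<circ> \<gamma> e) \<inter> (\<lambda>v. ?J (f v)) ` V = (\<lambda>v. ?J (f v)) ` e"
      unfolding im path_image_compose using edge_vertices[OF e] inj by (metis image_Int)
  next
    fix e e' assume "e \<in> E" "e' \<in> E" "e \<noteq> e'"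
    then show "path_image (?J \<circ> \<gamma> e) \<inter> path_image (?J \<circ> \<gamma> e') \<subseteq> (\<lambda>v. ?J (f v)) ` (e \<inter> e')"
      unfolding im path_image_compose using edges_cross inj by (metis image_Int image_mono)
  qed (use finite_V edge_ends in auto)
qed

text \<open>
  The girth is at least \<open>k + 2\<close>. A smallest counterexample has no vertex on fewer than two edges, since removing
  such a vertex reduces the left side by at most \<open>k\<close> and the right side by \<open>k + 2\<close>. So it has a cycle, hence
  a cycle \<open>xs\<close> with no edge inside, and after the inversion about a point inside \<open>xs\<close> all edges that are not
  on \<open>xs\<close> are inside.
\<close>

lemma plane_edge_bound:
  assumes "plane_graph V E f \<gamma>" "girth_ge (k + 2) (\<lambda>u v. {u, v} \<in> E)" "V \<noteq> {}"
  shows "k * card E + (k + 2) \<le> (k + 2) * card V"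
  using assms
proof (induction "card V + card E" arbitrary: V E rule: less_induct)
  case less
  interpret plane_graph V E f \<gamma> by fact
  have girth: "k + 2 \<le> length xs" if "distinct xs" "3 \<le> length xs" "cycle_edges xs \<subseteq> E" for xs
    using less.prems(2) that unfolding girth_ge_def cyclic_list_iff by blast
  have IH: "k * card E' + (k + 2) \<le> (k + 2) * card V'"
    if "V' \<subseteq> V" "E' \<subseteq> E" "\<Union> E' \<subseteq> V'" "V' \<noteq> {}" "V' \<noteq> V \<or> E' \<noteq> E" for V' E'
  proof (rule less.hyps)
    have "card V' \<le> card V" "card E' \<le> card E"
      using that finite_V finite_E by (auto intro: card_mono)
    moreover have "card V' < card V \<or> card E' < card E"
      using that finite_V finite_E by (meson psubsetI psubset_card_mono)
    ultimately show "card V' + card E' < card V + card E" by linarith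
    show "plane_graph V' E' f \<gamma>" using plane_graph_mono[OF less.prems(1)] that by blast
    show "girth_ge (k + 2) (\<lambda>u v. {u, v} \<in> E')"
      using girth that(2) unfolding girth_ge_def cyclic_list_iff by blast
  qed fact
  show ?case
  proof (rule ccontr)
    assume fails: "\<not> ?case"
    have deg: "\<exists>e1 e2. e1 \<in> E \<and> e2 \<in> E \<and> e1 \<noteq> e2 \<and> v \<in> e1 \<and> v \<in> e2" if v: "v \<in> V" for v
    proof (rule ccontr)
      assume no: "\<not> ?thesis"
      define E' where "E' = {e \<in> E. v \<notin> e}"
      have "finite (E - E')" using finite_E by blast
      then have "card (E - E') \<le> 1"
        using no by (auto simp: card_le_Suc0_iff_eq E'_def)
      moreover have "card E = card E' + card (E - E')"
        using finite_E by (metis (no_types, lifting) E'_def card_Diff_subset card_mono finite_subset le_add_diff_inverse mem_Collect_eq subsetI)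
      ultimately have cE: "card E \<le> card E' + 1" by simp
      have cV: "card V = card (V - {v}) + 1"
        using v finite_V by (metis Suc_eq_plus1 card_Suc_Diff1)
      show False
      proof (cases "V - {v} = {}")
        case True
        then have "E = {}" using edge_ends by blast
        then show False using fails cV by simp
      next
        case False
        then have "k * card E' + (k + 2) \<le> (k + 2) * card (V - {v})"
          using v edge_subset by (intro IH) (auto simp: E'_def)
        moreover have "k * card E \<le> k * card E' + k"
          using mult_le_mono2[OF cE, of k] by simp
        ultimately show False using fails cV by (simp add: algebra_simps)
      qed
    qed
    obtain xs0 where xs0: "distinct xs0" "3 \<le> length xs0" "cycle_edges xs0 \<subseteq> E"
      using cycle_exists[OF deg less.prems(3)] by blast
    have sub: "k * card E' + (k + 2) \<le> (k + 2) * card V'"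
      if "V' \<subseteq> V" "E' \<subset> E" "\<Union> E' \<subseteq> V'" "V' \<noteq> {}" for V' E'
      using IH that by blast
    have chord: "\<exists>a ms b. chord_path xs a ms b"
      if "distinct xs" "3 \<le> length xs" "cycle_edges xs \<subseteq> E" "e \<in> edges_inside xs" for xs e
      by (rule chord_path_exists[OF sub fails that])
    obtain xs where xs: "distinct xs" "3 \<le> length xs" "cycle_edges xs \<subseteq> E" "edges_inside xs = {}"
      using empty_face[OF _ xs0] chord by metis
    let ?C = "drawn (cycle_edges xs)"
    have "open (inside ?C)" using compact_drawn[OF xs(3)] by (intro open_inside compact_imp_closed)
    then have "infinite (inside ?C)"
      using inside_nonempty[OF xs(1-3)] finite_imp_not_open by blast
    then obtain p where p: "p \<in> inside ?C" "p \<notin> f ` V"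
      using finite_V by (metis finite_imageI finite_subset subsetI)
    have out: "open_edge e \<inter> inside ?C = {}" if "e \<in> E" "e \<notin> cycle_edges xs" for e
      using connected_inside_dichotomy[OF connected_open_edge[OF that(1)] open_edge_drawn[OF xs(3) that]]
        xs(4) that by (auto simp: edges_inside_def)
    have avoid: "p \<notin> path_image (\<gamma> e)" if "e \<in> E" for e
    proof
      assume pe: "p \<in> path_image (\<gamma> e)"
      then have "p \<in> open_edge e" using p(2) edge_subset[OF that] by (auto simp: open_edge_def)
      moreover have "p \<in> ?C" if "e \<in> cycle_edges xs" using pe that by (auto simp: drawn_def)
      ultimately show False using out that p(1) inside_no_overlap by blast
    qed
    \<comment> \<open>the drawing of the same graph in which \<open>xs\<close> encloses all other edges\<close>
    let ?J = "\<lambda>z. inverse (z - p)"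
    interpret inv: plane_graph V E "\<lambda>v. ?J (f v)" "\<lambda>e. ?J \<circ> \<gamma> e"
      by (rule inverted[OF avoid])
    have drawn_inv: "inv.drawn F = ?J ` drawn F" for F
      by (auto simp: drawn_def inv.drawn_def path_image_compose)
    have "e \<in> inv.edges_inside xs" if e: "e \<in> E" "e \<notin> cycle_edges xs" for e
    proof -
      have "inv.open_edge e \<subseteq> ?J ` open_edge e"
        by (auto simp: inv.open_edge_def open_edge_def path_image_compose)
      moreover have "z \<in> outside ?C" if "z \<in> open_edge e" for z
        using that out[OF e] open_edge_drawn[OF xs(3) e] by (auto simp: outside_inside)
      ultimately have "inv.open_edge e \<subseteq> inside (?J ` ?C)"
        using inversion_outside_in[OF compact_drawn[OF xs(3)] p(1)] by blast
      then show ?thesis using e by (simp add: inv.edges_inside_def drawn_inv)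
    qed
    then have "card E \<le> card (inv.edges_inside xs \<union> cycle_edges xs)"
      by (intro card_mono) (auto simp: cycle_edges_def)
    also have "\<dots> \<le> card (inv.edges_inside xs) + length xs"
      using card_path_edges[of "xs @ [hd xs]"] card_Un_le[of "inv.edges_inside xs" "cycle_edges xs"]
      unfolding cycle_edges_def by simp
    finally have cE: "k * card E \<le> k * card (inv.edges_inside xs) + k * length xs"
      by (metis add_mult_distrib2 mult_le_mono2)
    have "set xs \<subseteq> V" using cycle_vertex[OF xs(1,2)] xs(3) edge_subset by blast
    then have "card (inv.vertices_inside xs \<union> set xs) \<le> card V"
      by (intro card_mono finite_V) (auto simp: inv.vertices_inside_def)
    moreover have "inv.vertices_inside xs \<inter> set xs = {}"
      using inv.vertices_inside_not_cycle[OF xs(1-3)] by blast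
    ultimately have "card (inv.vertices_inside xs) + length xs \<le> card V"
      using xs(1) by (simp add: card_Un_disjoint distinct_card)
    then have "(k + 2) * card (inv.vertices_inside xs) + (k + 2) * length xs \<le> (k + 2) * card V"
      by (metis add_mult_distrib2 mult_le_mono2)
    moreover have "\<exists>a ms b. inv.chord_path xs a ms b"
      if "distinct xs" "3 \<le> length xs" "cycle_edges xs \<subseteq> E" "e \<in> inv.edges_inside xs" for xs e
      by (rule inv.chord_path_exists[OF sub fails that])
    then have "k * card (inv.edges_inside xs) + (k + 2) \<le>
        (k + 2) * card (inv.vertices_inside xs) + length xs"
      by (rule inv.inside_count[OF _ girth xs(1-3)])
    ultimately show False using cE fails by (simp add: algebra_simps)
  qed
qed

section \<open>Choosing colors\<close>

lemma choose_outside: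
  assumes "finite F" "card F < card A"
  obtains c where "c \<in> A" "c \<notin> F"
  using assms card_mono[of F A] by (meson not_le subsetI)

lemma card_ge_Suc_remove: "Suc n \<le> card A \<Longrightarrow> n \<le> card (A - {c})"
  by (cases "c \<in> A") (auto simp: card_Diff_singleton_if)

lemma card_ge2E:
  assumes "2 \<le> card A"
  obtains a b where "a \<in> A" "b \<in> A" "a \<noteq> b"
proof -
  have "A \<noteq> {}" using assms by auto
  then obtain a where a: "a \<in> A" by blast
  have "A - {a} \<noteq> {}" using card_ge_Suc_remove[of 1 A a] assms by force
  then show thesis using that a by blast
qed

text \<open>
  The square of a path on four vertices is a complete graph minus the edge joining the two ends. Either the
  ends can get the same color, or their lists are disjoint. Then they do not both fit in a list of three colors
  for \<open>y\<close>, so one end has a color that leaves at least three colors for \<open>y\<close>, which is colored last.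
\<close>

lemma color_path4_square:
  assumes "2 \<le> card X" "3 \<le> card Y" "3 \<le> card Z" "2 \<le> card T"
  shows "\<exists>x\<in>X. \<exists>y\<in>Y. \<exists>z\<in>Z. \<exists>t\<in>T. x \<noteq> y \<and> x \<noteq> z \<and> y \<noteq> z \<and> y \<noteq> t \<and> z \<noteq> t"
proof (cases "X \<inter> T = {}")
  case False
  then obtain c where c: "c \<in> X" "c \<in> T" by blast
  obtain y where y: "y \<in> Y" "y \<notin> {c}" by (rule choose_outside[of "{c}" Y]) (use assms in auto)
  obtain z where z: "z \<in> Z" "z \<notin> {c, y}"
    by (rule choose_outside[of "{c, y}" Z]) (use assms in \<open>auto simp: card_insert_if\<close>)
  show ?thesis using c y z by (intro bexI[of _ c] bexI[of _ y] bexI[of _ z]) auto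
next
  case True
  show ?thesis
  proof (cases "X \<subseteq> Y \<and> T \<subseteq> Y \<and> card Y = 3")
    case True
    then have "finite Y" using assms(2) by (metis card.infinite not_numeral_le_zero)
    then have "card (X \<union> T) \<le> card Y" "finite X" "finite T"
      using True by (metis Un_least card_mono, metis finite_subset, metis finite_subset)
    then show ?thesis using \<open>X \<inter> T = {}\<close> True assms by (simp add: card_Un_disjoint)
  next
    case False
    obtain c where c: "c \<in> X \<or> c \<in> T" "c \<notin> Y \<or> 4 \<le> card Y"
    proof (cases "X \<subseteq> Y \<and> T \<subseteq> Y")
      case True
      then have "4 \<le> card Y" using False assms(2) by simp
      moreover obtain c where "c \<in> X" using card_ge2E[OF assms(1)] by blast
      ultimately show thesis using that by blast
    qed (use that in blast)
    then consider (X) "c \<in> X" | (T) "c \<in> T" by blast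
    then show ?thesis
    proof cases
      case X
      have Y: "3 \<le> card (Y - {c})" using c(2) assms(2) card_ge_Suc_remove[of 3 Y c] by auto
      obtain t where t: "t \<in> T" "t \<notin> {}" by (rule choose_outside[of "{}" T]) (use assms in auto)
      obtain z where z: "z \<in> Z" "z \<notin> {c, t}"
        by (rule choose_outside[of "{c, t}" Z]) (use assms in \<open>auto simp: card_insert_if\<close>)
      obtain y where y: "y \<in> Y - {c}" "y \<notin> {z, t}"
        by (rule choose_outside[of "{z, t}" "Y - {c}"]) (use Y in \<open>auto simp: card_insert_if\<close>)
      show ?thesis using X t y z by (intro bexI[of _ c] bexI[of _ y] bexI[of _ z] bexI[of _ t]) auto
    next
      case T
      have Y: "3 \<le> card (Y - {c})" using c(2) assms(2) card_ge_Suc_remove[of 3 Y c] by auto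
      obtain x where x: "x \<in> X" "x \<notin> {}" by (rule choose_outside[of "{}" X]) (use assms in auto)
      obtain z where z: "z \<in> Z" "z \<notin> {c, x}"
        by (rule choose_outside[of "{c, x}" Z]) (use assms in \<open>auto simp: card_insert_if\<close>)
      obtain y where y: "y \<in> Y - {c}" "y \<notin> {z, x}"
        by (rule choose_outside[of "{z, x}" "Y - {c}"]) (use Y in \<open>auto simp: card_insert_if\<close>)
      show ?thesis using T x y z by (intro bexI[of _ x] bexI[of _ y] bexI[of _ z] bexI[of _ c]) auto
    qed
  qed
qed

section \<open>Options along a thread\<close>

definition multiple :: "'a set \<Rightarrow> bool" where
  "multiple A \<longleftrightarrow> (\<exists>p\<in>A. \<exists>q\<in>A. p \<noteq> q)"

lemma multipleI: "2 \<le> card A \<Longrightarrow> multiple A"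
  by (erule card_ge2E) (auto simp: multiple_def)

lemma multiple_mono: "multiple A \<Longrightarrow> A \<subseteq> B \<Longrightarrow> multiple B"
  unfolding multiple_def by blast

lemma multiple_avoid: "multiple A \<Longrightarrow> \<exists>k\<in>A. k \<noteq> c"
  unfolding multiple_def by metis

lemma card_Diff_le: "finite g \<Longrightarrow> card g \<le> m \<Longrightarrow> n + m \<le> card A \<Longrightarrow> n \<le> card (A - g)"
  using diff_card_le_card_Diff[of g A] by linarith

text \<open>
  Here \<open>Opt a\<close> is the set of the colors left for the first vertex of a thread when the vertex where the thread starts
  has the color \<open>a\<close>. The colors in \<open>E\<close> are those that may leave it a single color.
\<close>

definition flexible :: "nat \<Rightarrow> ('b \<Rightarrow> 'c set) \<Rightarrow> bool" where
  "flexible n Opt \<longleftrightarrow> (\<exists>E. finite E \<and> card E \<le> n \<and> (\<forall>a. Opt a \<noteq> {} \<and> (a \<notin> E \<longrightarrow> multiple (Opt a))))"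

lemma flexible_0: "(\<And>a. multiple (Opt a)) \<Longrightarrow> flexible n Opt"
  unfolding flexible_def by (intro exI[of _ "{}"]) (auto simp: multiple_def)

lemma flexible_remove:
  assumes "2 \<le> card A"
  shows "flexible 2 (\<lambda>a. A - {a})"
proof (cases "card A = 2")
  case True
  have "finite A" using True by (intro card_ge_0_finite) simp
  moreover have "A - {a} \<noteq> {}" for a
    using card_ge_Suc_remove[of 1 A a] assms by force
  moreover have "multiple (A - {a})" if "a \<notin> A" for a
    using that multipleI[OF assms] by simp
  ultimately show ?thesis unfolding flexible_def using True by (intro exI[of _ A]) simp
next
  case False
  show ?thesis
  proof (rule flexible_0)
    fix a
    show "multiple (A - {a})"
      by (intro multipleI card_ge_Suc_remove) (use assms False in simp)
  qed
qed

text \<open>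
  Two colors of \<open>x\<close> differ from \<open>a\<close> and \<open>b\<close>. If \<open>a\<close> leaves two colors for \<open>y\<close>, both of them can be completed.
\<close>

lemma flexible_two_thread:
  assumes g: "finite g" "card g \<le> 2" and L: "card Lx = 4" "card Ly = 4"
  shows "flexible 2 (\<lambda>a. {k \<in> Lx - {a, b}. \<exists>y\<in>Ly - g - {a}. k \<noteq> y})"
proof -
  have "2 \<le> card (Ly - g)" by (rule card_Diff_le) (use g L in auto)
  from flexible_remove[OF this] obtain E where E: "finite E" "card E \<le> 2"
    and ne: "\<And>a. Ly - g - {a} \<noteq> {}" and mult: "\<And>a. a \<notin> E \<Longrightarrow> multiple (Ly - g - {a})"
    unfolding flexible_def by auto
  have X: "multiple (Lx - {a, b})" for a
    by (intro multipleI card_Diff_le[of _ 2]) (use L in \<open>auto simp: card_insert_if\<close>)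
  have "{k \<in> Lx - {a, b}. \<exists>y\<in>Ly - g - {a}. k \<noteq> y} \<noteq> {}" for a
  proof -
    obtain y where "y \<in> Ly - g - {a}" using ne[of a] by blast
    with multiple_avoid[OF X[of a], of y] show ?thesis by blast
  qed
  moreover have "multiple {k \<in> Lx - {a, b}. \<exists>y\<in>Ly - g - {a}. k \<noteq> y}" if "a \<notin> E" for a
  proof -
    have "\<exists>y\<in>Ly - g - {a}. k \<noteq> y" for k
      using multiple_avoid[OF mult[OF that], of k] by metis
    then have "Lx - {a, b} \<subseteq> {k \<in> Lx - {a, b}. \<exists>y\<in>Ly - g - {a}. k \<noteq> y}" by blast
    with X show ?thesis by (rule multiple_mono)
  qed
  ultimately show ?thesis unfolding flexible_def using E by (intro exI[of _ E]) simp
qed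

text \<open>
  Each pair of colors for the other two vertices leaves a color for \<open>x\<close>. Only if all pairs consist of the
  same two colors can this color be unique, and then the list of \<open>y\<close> consists of them, \<open>b\<close> and \<open>a\<close>,
  which determines \<open>a\<close>.
\<close>

lemma flexible_three_thread:
  fixes b :: 'a
  assumes g: "finite g" "card g \<le> 2" and L: "card Lx = 4" "card Ly = 4" "card Lz = 4"
  shows "flexible 1
    (\<lambda>a. {k \<in> Lx - {a}. \<exists>y\<in>Ly - {a, b}. \<exists>z\<in>Lz - g. k \<noteq> y \<and> k \<noteq> z \<and> y \<noteq> z})"
proof -
  define Opt where "Opt = (\<lambda>a. {k \<in> Lx - {a}. \<exists>y\<in>Ly - {a, b}. \<exists>z\<in>Lz - g. k \<noteq> y \<and> k \<noteq> z \<and> y \<noteq> z})"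
  define Z where "Z = Lz - g"
  define E where "E = (if is_singleton (Ly - Z - {b}) then Ly - Z - {b} else {})"
  have finL: "finite Lx" "finite Ly" "finite Lz" using L by (auto intro: card_ge_0_finite)
  have Z2: "2 \<le> card Z" unfolding Z_def by (rule card_Diff_le) (use g L in auto)
  have Y2: "2 \<le> card (Ly - {a, b})" for a
    by (rule card_Diff_le[of _ 2]) (use L in \<open>auto simp: card_insert_if\<close>)
  have X3: "3 \<le> card (Lx - {a})" for a
    by (rule card_ge_Suc_remove) (use L in auto)
  have pair: "\<exists>k. k \<in> Opt a \<and> k \<notin> {y, z}" if "y \<in> Ly - {a, b}" "z \<in> Z" "y \<noteq> z" for a y z
  proof -
    obtain k where "k \<in> Lx - {a}" "k \<notin> {y, z}"
      by (rule choose_outside[of "{y, z}" "Lx - {a}"]) (use X3[of a] in \<open>auto simp: card_insert_if\<close>)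
    then show ?thesis using that unfolding Opt_def Z_def by blast
  qed
  have card3: "card {p, q, r} \<le> 3" for p q r :: 'a by (simp add: card_insert_if)
  \<comment> \<open>two different pairs cannot leave the same single color of the at least three in \<open>Lx - {a}\<close>\<close>
  have two: "multiple (Opt a)"
    if yz: "y \<in> Ly - {a, b}" "z \<in> Z" "y \<noteq> z" and yz': "y' \<in> Ly - {a, b}" "z' \<in> Z" "y' \<noteq> z'"
      and ne: "{y, z} \<noteq> {y', z'}" for a y z y' z'
  proof (rule ccontr)
    assume no: "\<not> multiple (Opt a)"
    have sub: "Lx - {a} - {y, z} \<subseteq> Opt a" "Lx - {a} - {y', z'} \<subseteq> Opt a"
      using yz yz' unfolding Opt_def Z_def by blast+
    obtain k where k: "k \<in> Opt a" using pair[OF yz] by blast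
    then have "Opt a = {k}" using no unfolding multiple_def by blast
    with sub have cov: "Lx - {a} \<subseteq> {k, y, z}" "Lx - {a} \<subseteq> {k, y', z'}" by blast+
    have eq: "Lx - {a} = {k, y, z}" "Lx - {a} = {k, y', z'}"
      using card_seteq[OF _ cov(1)] card_seteq[OF _ cov(2)] X3[of a] card3
      by (meson finite.intros order_trans)+
    have k: "k \<notin> {y, z}" "k \<notin> {y', z'}"
      using pair[OF yz] pair[OF yz'] \<open>Opt a = {k}\<close> by auto
    have "Lx - {a} - {k} = {y, z}" unfolding eq(1) using k(1) by simp
    moreover have "Lx - {a} - {k} = {y', z'}" unfolding eq(2) using k(2) by simp
    ultimately show False using ne by simp
  qed
  have E: "multiple (Opt a)" if a: "a \<notin> E" for a
  proof -
    let ?Y = "Ly - {a, b}"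
    consider (z) z where "z \<in> Z" "z \<notin> ?Y" | (y) y where "y \<in> ?Y" "y \<notin> Z" | (eq) "Z = ?Y" by blast
    then show ?thesis
    proof cases
      case z
      obtain y y' where "y \<in> ?Y" "y' \<in> ?Y" "y \<noteq> y'" using Y2 by (rule card_ge2E)
      then show ?thesis using two[of y a z y' z] z by (auto simp: doubleton_eq_iff)
    next
      case y
      obtain z z' where "z \<in> Z" "z' \<in> Z" "z \<noteq> z'" using Z2 by (rule card_ge2E)
      then show ?thesis using two[of y a z y z'] y by (auto simp: doubleton_eq_iff)
    next
      case eq
      show ?thesis
      proof (cases "3 \<le> card Z")
        case True
        obtain p q where pq: "p \<in> Z" "q \<in> Z" "p \<noteq> q" using Z2 by (rule card_ge2E)
        obtain t where "t \<in> Z" "t \<notin> {p, q}"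
          by (rule choose_outside[of "{p, q}" Z]) (use True in \<open>auto simp: card_insert_if\<close>)
        then show ?thesis using two[of p a q p t] pq eq by (auto simp: doubleton_eq_iff)
      next
        case False
        then have "card Z = 2" using Z2 by simp
        then have "card (Ly - Z) = 2"
          using L finL eq by (subst card_Diff_subset) (auto intro: finite_subset)
        moreover have "Ly - Z \<subseteq> {a, b}" using eq by blast
        ultimately have Lyab: "Ly - Z = {a, b}" "a \<noteq> b"
          using card_mono[of "{a, b}" "Ly - Z"] card_subset_eq[of "{a, b}" "Ly - Z"]
          by (auto simp: card_insert_if split: if_splits)
        then have "Ly - Z - {b} = {a}" by blast
        then show ?thesis using a by (simp add: E_def is_singleton_def)
      qed
    qed
  qed
  have "Opt a \<noteq> {}" for a
  proof -
    obtain y y' where y: "y \<in> Ly - {a, b}" "y' \<in> Ly - {a, b}" "y \<noteq> y'" using Y2 by (rule card_ge2E)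
    obtain z z' where z: "z \<in> Z" "z' \<in> Z" "z \<noteq> z'" using Z2 by (rule card_ge2E)
    show ?thesis using pair[OF y(1) z(1)] pair[OF y(1) z(2)] z(3) by blast
  qed
  moreover have "finite E" "card E \<le> 1"
    using finL by (auto simp: E_def is_singleton_altdef)
  ultimately have "flexible 1 Opt" unfolding flexible_def using E by (intro exI[of _ E]) simp
  then show ?thesis by (simp only: Opt_def)
qed

text \<open>
  If the colors fixed on \<open>F\<close> include a color used once there, all other vertices avoid it. Otherwise at most
  three fixed vertices show at most one color, and some other vertex takes a color of its own.
\<close>

lemma conflict_free_choice:
  assumes F: "F \<subset> M" "finite F" "card F \<le> 3" and opt: "\<And>x. x \<in> M - F \<Longrightarrow> multiple (Opt x)"
  shows "\<exists>\<kappa>. (\<forall>x\<in>F. \<kappa> x = col x) \<and> (\<forall>x\<in>M - F. \<kappa> x \<in> Opt x) \<and> (\<exists>c. \<exists>!u. u \<in> M \<and> \<kappa> u = c)"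
proof -
  have "\<forall>c. \<exists>h. \<forall>x\<in>M - F. h x \<in> Opt x \<and> h x \<noteq> c"
    using multiple_avoid[OF opt] by (intro allI bchoice) blast
  then obtain h where h: "\<And>c x. x \<in> M - F \<Longrightarrow> h c x \<in> Opt x \<and> h c x \<noteq> c" by metis
  show ?thesis
  proof (cases "\<exists>u\<in>F. \<forall>u'\<in>F. col u' = col u \<longrightarrow> u' = u")
    case True
    then obtain u where u: "u \<in> F" "\<And>u'. u' \<in> F \<Longrightarrow> col u' = col u \<Longrightarrow> u' = u" by blast
    let ?\<kappa> = "\<lambda>x. if x \<in> F then col x else h (col u) x"
    have "\<exists>!u'. u' \<in> M \<and> ?\<kappa> u' = col u"
    proof (rule ex1I[of _ u])
      show "u \<in> M \<and> ?\<kappa> u = col u" using u(1) F by auto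
      show "u' = u" if "u' \<in> M \<and> ?\<kappa> u' = col u" for u'
        using that u(2)[of u'] h[of u' "col u"] by (auto split: if_splits)
    qed
    moreover have "\<forall>x\<in>M - F. ?\<kappa> x \<in> Opt x" using h by simp
    ultimately show ?thesis by (intro exI[of _ ?\<kappa>] conjI exI[of _ "col u"]) simp_all
  next
    case False
    have same: "col u = col u'" if uu: "u \<in> F" "u' \<in> F" for u u'
    proof (rule ccontr)
      assume ne: "col u \<noteq> col u'"
      obtain p where p: "p \<in> F" "col p = col u" "p \<noteq> u" using False uu(1) by blast
      obtain q where q: "q \<in> F" "col q = col u'" "q \<noteq> u'" using False uu(2) by blast
      have "card {u, u', p, q} = 4" using p q ne by (auto simp: card_insert_if)
      moreover have "card {u, u', p, q} \<le> card F" using p q uu F(2) by (intro card_mono) auto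
      ultimately show False using F(3) by simp
    qed
    obtain x where x: "x \<in> M - F" using F(1) by blast
    obtain c where c: "c \<in> Opt x" "c \<notin> col ` F"
    proof (cases "F = {}")
      case True
      then show thesis using that opt[OF x] unfolding multiple_def by blast
    next
      case False
      then obtain u where "u \<in> F" by blast
      then have "col ` F \<subseteq> {col u}" using same by blast
      then show thesis using that multiple_avoid[OF opt[OF x], of "col u"] by blast
    qed
    let ?\<kappa> = "\<lambda>y. if y \<in> F then col y else if y = x then c else h c y"
    have "\<exists>!u'. u' \<in> M \<and> ?\<kappa> u' = c"
    proof (rule ex1I[of _ x])
      show "x \<in> M \<and> ?\<kappa> x = c" using x by auto
      show "u' = x" if "u' \<in> M \<and> ?\<kappa> u' = c" for u'
        using that c(2) h[of u' c] by (auto split: if_splits)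
    qed
    moreover have "\<forall>x\<in>M - F. ?\<kappa> x \<in> Opt x" using h c(1) by simp
    ultimately show ?thesis by (intro exI[of _ ?\<kappa>] conjI exI[of _ c]) simp_all
  qed
qed

text \<open>
  Double counting of the pairs of a color \<open>a\<close> and a thread \<open>x\<close> with \<open>a \<in> E x\<close>.
\<close>

lemma few_exceptions:
  fixes E :: "'a \<Rightarrow> 'b set"
  assumes fin: "finite A" "finite M" "\<And>x. x \<in> M \<Longrightarrow> finite (E x)"
    and less: "(\<Sum>x\<in>M. card (E x)) < k * card A"
  shows "\<exists>a\<in>A. card {x \<in> M. a \<in> E x} < k"
proof (rule ccontr)
  assume no: "\<not> ?thesis"
  have "k \<le> card {x \<in> M. a \<in> E x}" if "a \<in> A" for a using no that by (simp add: not_less)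
  then have "k * card A \<le> (\<Sum>a\<in>A. card {x \<in> M. a \<in> E x})"
    using sum_mono[of A "\<lambda>_. k"] by (simp add: mult.commute)
  also have "\<dots> = (\<Sum>a\<in>A. \<Sum>x\<in>M. if a \<in> E x then 1 else 0)"
    using fin by (simp add: sum.If_cases Int_def)
  also have "\<dots> = (\<Sum>x\<in>M. \<Sum>a\<in>A. if a \<in> E x then 1 else 0)"
    by (rule sum.swap)
  also have "\<dots> = (\<Sum>x\<in>M. card (A \<inter> E x))"
    using fin by (simp add: sum.If_cases)
  also have "\<dots> \<le> (\<Sum>x\<in>M. card (E x))"
    using fin by (intro sum_mono card_mono) auto
  finally show False using less by simp
qed

section \<open>Deleting vertices from a critical graph\<close>

definition delete_vertices :: "'a pair_pre_digraph \<Rightarrow> 'a set \<Rightarrow> 'a pair_pre_digraph" where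
  "delete_vertices G S =
     \<lparr>pverts = pverts G - S, parcs = {(u, v) \<in> parcs G. u \<notin> S \<and> v \<notin> S}\<rparr>"

lemma pverts_delete_vertices [simp]: "pverts (delete_vertices G S) = pverts G - S"
  by (simp add: delete_vertices_def)

lemma neighbors_delete_vertices: "v \<notin> S \<Longrightarrow> neighbors (delete_vertices G S) v = neighbors G v - S"
  by (auto simp: delete_vertices_def neighbors_def)

text \<open>
  A minimal counterexample. The lists have the least size that is admitted.
\<close>

locale critical_graph = pair_graph G for G :: "'a pair_pre_digraph" +
  fixes L :: "'a \<Rightarrow> 'c set"
  assumes girth8: "girth_ge 8 (\<lambda>u v. v \<in> neighbors G u)"
    and list_size: "v \<in> pverts G \<Longrightarrow> card (L v) = degree G v + 2"
    and not_colorable: "\<not> (list_coloring G L \<phi> \<and> pcf_coloring G \<phi>)"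
    and smaller_colorable: "S \<noteq> {} \<Longrightarrow> S \<subseteq> pverts G \<Longrightarrow>
      \<exists>\<phi>. list_coloring (delete_vertices G S) L \<phi> \<and> pcf_coloring (delete_vertices G S) \<phi>"
begin

abbreviation N :: "'a \<Rightarrow> 'a set" where "N \<equiv> neighbors G"
abbreviation d :: "'a \<Rightarrow> nat" where "d \<equiv> degree G"

definition cf_at :: "('a \<Rightarrow> 'c) \<Rightarrow> 'a \<Rightarrow> bool" where
  "cf_at \<phi> v \<longleftrightarrow> (\<exists>c. \<exists>!u. u \<in> N v \<and> \<phi> u = c)"

lemma N_sym: "u \<in> N v \<Longrightarrow> v \<in> N u"
  using arcs_symmetric by (auto simp: neighbors_def)

lemma N_irrefl: "v \<notin> N v"
  using no_loops' by (auto simp: neighbors_def)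

lemma N_verts: "u \<in> N v \<Longrightarrow> u \<in> pverts G"
  by (auto simp: neighbors_def dest: in_arcsD2)

lemma N_verts': "u \<in> N v \<Longrightarrow> v \<in> pverts G"
  by (auto simp: neighbors_def dest: in_arcsD1)

lemma finite_N [simp]: "finite (N v)"
  by (rule finite_subset[OF _ pair_finite_verts]) (auto dest: N_verts)

lemma finite_L: "v \<in> pverts G \<Longrightarrow> finite (L v)"
  using list_size[of v] by (intro card_ge_0_finite) simp

lemma walk_distinct:
  "nb_walk (\<lambda>u v. v \<in> N u) xs \<Longrightarrow> length xs \<le> 8 \<Longrightarrow> distinct xs"
  by (rule nb_walk_distinct[OF girth8 N_irrefl])

lemma walk_unique:
  "nb_walk (\<lambda>u v. v \<in> N u) (m # p) \<Longrightarrow> nb_walk (\<lambda>u v. v \<in> N u) (m # q) \<Longrightarrow>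
    last (m # p) = last (m # q) \<Longrightarrow> length p + length q < 8 \<Longrightarrow> p = q"
  by (rule nb_walk_unique[OF girth8 N_irrefl N_sym])

lemma two_neighbors:
  assumes "d v = 2" "u \<in> N v"
  obtains w where "N v = {u, w}" "w \<noteq> u"
proof -
  obtain a b where "N v = {a, b}" "a \<noteq> b" using assms(1) by (auto simp: degree_def card_2_iff)
  then show thesis using that assms(2) by (auto simp: insert_commute)
qed

lemma cf_at_two: "N v = {p, q} \<Longrightarrow> p \<noteq> q \<Longrightarrow> cf_at \<phi> v \<longleftrightarrow> \<phi> p \<noteq> \<phi> q"
proof
  assume pq: "N v = {p, q}" "p \<noteq> q"
  assume "cf_at \<phi> v"
  then obtain c where "\<exists>!u. u \<in> {p, q} \<and> \<phi> u = c" unfolding cf_at_def pq(1) by (elim exE)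
  then obtain u where "u \<in> {p, q} \<and> \<phi> u = c" "\<forall>u'. u' \<in> {p, q} \<and> \<phi> u' = c \<longrightarrow> u' = u" by (rule ex1E)
  then show "\<phi> p \<noteq> \<phi> q" using pq(2) by (metis insertE insertI1 insertI2 singletonD)
next
  assume pq: "N v = {p, q}" "\<phi> p \<noteq> \<phi> q"
  show "cf_at \<phi> v" unfolding cf_at_def pq(1) using pq(2) by (intro exI[of _ "\<phi> p"] ex1I[of _ p]) auto
qed

lemma cf_at_three:
  assumes "N v = {p, q, r}" "p \<noteq> q" "p \<noteq> r" "q \<noteq> r" "\<phi> p \<noteq> \<phi> q"
  shows "cf_at \<phi> v"
proof (cases "\<phi> r = \<phi> p")
  case True
  then show ?thesis unfolding cf_at_def using assms by (intro exI[of _ "\<phi> q"] ex1I[of _ q]) auto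
next
  case False
  then show ?thesis unfolding cf_at_def using assms by (intro exI[of _ "\<phi> p"] ex1I[of _ p]) auto
qed

text \<open>
  The conditions on the color of a deleted vertex \<open>s\<close>, where \<open>g w\<close> is the set of the colors that the kept vertex \<open>w\<close>
  forbids at its deleted neighbor.
\<close>

definition colored_at :: "('a \<Rightarrow> 'c set) \<Rightarrow> 'a set \<Rightarrow> ('a \<Rightarrow> 'c) \<Rightarrow> 'a \<Rightarrow> bool" where
  "colored_at g S \<psi> s \<longleftrightarrow> \<psi> s \<in> L s \<and> (N s \<noteq> {} \<longrightarrow> cf_at \<psi> s) \<and>
     (\<forall>w\<in>N s. if w \<in> S then \<psi> s \<noteq> \<psi> w else \<psi> s \<notin> g w)"

text \<open>
  The coloring \<open>\<phi>\<close> of the kept vertices cannot be extended to \<open>S\<close> along the conditions \<open>colored_at\<close>, because the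
  extension would color the whole graph. The other clauses say how little the sets \<open>g w\<close> exclude.
\<close>

definition guarded :: "'a set \<Rightarrow> ('a \<Rightarrow> 'c) \<Rightarrow> ('a \<Rightarrow> 'c set) \<Rightarrow> bool" where
  "guarded S \<phi> g \<longleftrightarrow> (\<forall>w. finite (g w) \<and> card (g w) \<le> 2 \<and> \<phi> w \<in> g w) \<and>
     (\<forall>w. d w = 3 \<longrightarrow> w \<notin> S \<longrightarrow> N w \<inter> S \<noteq> {} \<longrightarrow> g w = {\<phi> w}) \<and>
     (\<forall>\<psi>. (\<forall>v. v \<notin> S \<longrightarrow> \<psi> v = \<phi> v) \<longrightarrow> \<not> (\<forall>s\<in>S. colored_at g S \<psi> s))"

lemma guardedD:
  assumes "guarded S \<phi> g"
  shows "finite (g w)" "card (g w) \<le> 2" "\<phi> w \<in> g w"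
    "d w = 3 \<Longrightarrow> w \<notin> S \<Longrightarrow> N w \<inter> S \<noteq> {} \<Longrightarrow> g w = {\<phi> w}"
    "(\<And>v. v \<notin> S \<Longrightarrow> \<psi> v = \<phi> v) \<Longrightarrow> (\<And>s. s \<in> S \<Longrightarrow> colored_at g S \<psi> s) \<Longrightarrow> False"
proof -
  have "(\<forall>v. v \<notin> S \<longrightarrow> \<psi> v = \<phi> v) \<longrightarrow> \<not> (\<forall>s\<in>S. colored_at g S \<psi> s)"
    using assms unfolding guarded_def by (elim conjE) (erule spec)
  then show "(\<And>v. v \<notin> S \<Longrightarrow> \<psi> v = \<phi> v) \<Longrightarrow> (\<And>s. s \<in> S \<Longrightarrow> colored_at g S \<psi> s) \<Longrightarrow> False"
    by simp
qed (use assms in \<open>simp_all add: guarded_def\<close>)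

text \<open>
  Color the graph without \<open>S\<close>. A kept vertex \<open>w\<close> with one neighbor in \<open>S\<close> forbids at most two colors there:
  its own, and the color that is unique around \<open>w\<close> so far. If \<open>w\<close> has degree 3, then its two kept neighbors
  have different colors, a third neighbor spoils at most one of them, and only the color of \<open>w\<close> is forbidden.
\<close>

lemma guarded_coloring:
  assumes S: "S \<noteq> {}" "S \<subseteq> pverts G"
    and one: "\<And>s s' w. s \<in> S \<Longrightarrow> s' \<in> S \<Longrightarrow> w \<in> N s \<Longrightarrow> w \<in> N s' \<Longrightarrow> w \<notin> S \<Longrightarrow> s = s'"
  obtains \<phi> g where "guarded S \<phi> g"
proof -
  obtain \<phi> where lc: "list_coloring (delete_vertices G S) L \<phi>"
    and pcf: "pcf_coloring (delete_vertices G S) \<phi>"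
    using smaller_colorable[OF S] by blast
  have proper: "\<phi> u \<noteq> \<phi> v" if "v \<in> N u" "u \<notin> S" "v \<notin> S" for u v
    using pcf that by (auto simp: pcf_coloring_def proper_coloring_def delete_vertices_def neighbors_def)
  have cf: "\<exists>c. \<exists>!u. u \<in> N w - S \<and> \<phi> u = c" if "w \<in> pverts G" "w \<notin> S" "N w - S \<noteq> {}" for w
    using pcf that by (simp add: pcf_coloring_def neighbors_delete_vertices)
  define wit where "wit w = (SOME c. \<exists>!u. u \<in> N w - S \<and> \<phi> u = c)" for w
  have wit: "\<exists>!u. u \<in> N w - S \<and> \<phi> u = wit w" if "w \<in> pverts G" "w \<notin> S" "N w - S \<noteq> {}" for w
    unfolding wit_def by (rule someI_ex[OF cf[OF that]])
  define g where "g w = insert (\<phi> w) (if N w - S = {} \<or> card (N w - S) = 2 then {} else {wit w})" for w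
  have three: "g w = {\<phi> w}" if w: "d w = 3" "w \<notin> S" "N w \<inter> S \<noteq> {}" for w
  proof -
    from w obtain s where s: "s \<in> N w" "s \<in> S" by blast
    have "N w \<inter> S = {s}" using one s w(2) N_sym by blast
    then have "card (N w - S) = 2"
      using w(1) card_Diff_subset_Int[of "N w" S] by (simp add: degree_def)
    then show "g w = {\<phi> w}" by (simp add: g_def)
  qed
  have complete: False
    if agree: "\<And>v. v \<notin> S \<Longrightarrow> \<psi> v = \<phi> v" and colored: "\<And>s. s \<in> S \<Longrightarrow> colored_at g S \<psi> s" for \<psi>
  proof -
    have inL: "\<psi> s \<in> L s" and cfS: "N s \<noteq> {} \<Longrightarrow> cf_at \<psi> s" if "s \<in> S" for s
      using colored[OF that] by (auto simp: colored_at_def)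
    have out: "\<psi> s \<notin> g w" if "s \<in> S" "w \<in> N s" "w \<notin> S" for s w
      using colored[OF that(1)] that(2,3) by (auto simp: colored_at_def)
    have ins: "\<psi> s \<noteq> \<psi> w" if "s \<in> S" "w \<in> N s" "w \<in> S" for s w
      using colored[OF that(1)] that(2,3) by (auto simp: colored_at_def)
    have "list_coloring G L \<psi>"
      using lc agree inL unfolding list_coloring_def pverts_delete_vertices by (metis DiffI)
    moreover have "\<psi> u \<noteq> \<psi> v" if uv: "v \<in> N u" for u v
    proof -
      have gw: "\<phi> w \<in> g w" for w by (simp add: g_def)
      show ?thesis
        using proper[OF uv] ins[OF _ uv] out[OF _ uv] out[OF _ N_sym[OF uv]] agree gw
        by (cases "u \<in> S"; cases "v \<in> S") metis+
    qed
    then have "proper_coloring G \<psi>" by (auto simp: proper_coloring_def neighbors_def)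
    moreover have "cf_at \<psi> w" if w: "w \<in> pverts G" "N w \<noteq> {}" for w
    proof (cases "w \<in> S")
      case False
      show ?thesis
      proof (cases "N w \<inter> S = {}")
        case True
        then have NwS: "N w - S = N w" by blast
        have "\<exists>!u. u \<in> N w \<and> \<phi> u = wit w" using wit[OF w(1) False] w(2) unfolding NwS by simp
        moreover have "\<psi> u = \<phi> u" if "u \<in> N w" for u using agree that True by blast
        ultimately have "\<exists>!u. u \<in> N w \<and> \<psi> u = wit w" by metis
        then show ?thesis unfolding cf_at_def by blast
      next
        case ne: False
        then obtain s where s: "s \<in> N w" "s \<in> S" by blast
        have NwS: "N w \<inter> S = {s}" using one s False N_sym by blast
        then have Nw: "N w = insert s (N w - S)" by blast
        have sg: "\<psi> s \<notin> g w" using out[OF s(2) N_sym[OF s(1)] False] .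
        consider "N w - S = {}" | "card (N w - S) = 2" | "N w - S \<noteq> {}" "card (N w - S) \<noteq> 2" by blast
        then show ?thesis
        proof cases
          case 1
          then have "N w = {s}" using NwS by blast
          then show ?thesis by (auto simp: cf_at_def)
        next
          case 2
          then obtain p q where pq: "N w - S = {p, q}" "p \<noteq> q" by (auto simp: card_2_iff)
          have "N w - S \<noteq> {}" using pq by blast
          from wit[OF w(1) False this, unfolded pq(1)] obtain u where
            u: "u \<in> {p, q} \<and> \<phi> u = wit w" "\<forall>u'. u' \<in> {p, q} \<and> \<phi> u' = wit w \<longrightarrow> u' = u"
            by (rule ex1E)
          then have "\<phi> p \<noteq> \<phi> q" using pq(2) by (metis insertE insertI1 insertI2 singletonD)
          moreover have "\<psi> p = \<phi> p" "\<psi> q = \<phi> q" using agree pq by blast+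
          moreover have "N w = {p, q, s}" using Nw[unfolded pq(1)] by blast
          moreover have "p \<noteq> s" "q \<noteq> s" using pq(1) s by blast+
          ultimately show ?thesis using cf_at_three[of w p q s \<psi>] pq(2) by simp
        next
          case 3
          then have "\<psi> s \<noteq> wit w" using sg by (simp add: g_def)
          moreover have agree': "\<psi> u = \<phi> u" if "u \<in> N w - S" for u using agree that by blast
          moreover obtain u where
            u: "u \<in> N w - S \<and> \<phi> u = wit w" "\<forall>u'. u' \<in> N w - S \<and> \<phi> u' = wit w \<longrightarrow> u' = u"
            using wit[OF w(1) False 3(1)] by (rule ex1E)
          ultimately have "\<exists>!u. u \<in> N w \<and> \<psi> u = wit w"
          proof (intro ex1I[of _ u])
            fix u' assume u': "u' \<in> N w \<and> \<psi> u' = wit w"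
            then have "u' \<noteq> s" using \<open>\<psi> s \<noteq> wit w\<close> by blast
            then have "u' \<in> N w - S" using u' Nw by blast
            then show "u' = u" using u(2) u' agree' by metis
          qed (use u agree' in auto)
          then show ?thesis unfolding cf_at_def by blast
        qed
      qed
    qed (use cfS w in auto)
    ultimately show False
      using not_colorable[of \<psi>] unfolding pcf_coloring_def cf_at_def by blast
  qed
  have "finite (g w)" "card (g w) \<le> 2" "\<phi> w \<in> g w" for w
    by (auto simp: g_def card_insert_if)
  then have "guarded S \<phi> g"
    using three complete unfolding guarded_def by blast
  then show thesis by (rule that)
qed

section \<open>Small reducible configurations\<close>

lemma min_degree_2:
  assumes v: "v \<in> pverts G"
  shows "2 \<le> d v"
proof (rule ccontr)
  assume "\<not> 2 \<le> d v"
  then consider "N v = {}" | w where "N v = {w}"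
    unfolding degree_def by (metis One_nat_def card_0_eq card_1_singletonE finite_N less_2_cases not_le)
  note cases = this
  obtain \<phi> g where g: "guarded {v} \<phi> g"
    by (rule guarded_coloring[of "{v}"]) (use v in auto)
  have "\<exists>c. colored_at g {v} (\<phi>(v := c)) v"
  proof (cases rule: cases)
    case 1
    then have "card (L v) \<noteq> 0" using list_size[OF v] by simp
    then obtain c where "c \<in> L v" by (metis card.empty ex_in_conv)
    then show ?thesis using 1 by (auto simp: colored_at_def)
  next
    case (2 w)
    then have "card (g w) < card (L v)"
      using list_size[OF v] guardedD(2)[OF g, of w] by (simp add: degree_def)
    then obtain c where "c \<in> L v" "c \<notin> g w"
      by (rule choose_outside[OF guardedD(1)[OF g]])
    moreover have "w \<noteq> v" using 2 N_irrefl by blast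
    ultimately show ?thesis using 2 by (auto simp: colored_at_def cf_at_def)
  qed
  then obtain c where "colored_at g {v} (\<phi>(v := c)) v" ..
  then show False by (intro guardedD(5)[OF g, of "\<phi>(v := c)"]) auto
qed

text \<open>
  The four vertices are deleted. Two of them at distance 1 on the thread must differ because the coloring is proper, and
  two at distance 2 because it is conflict-free at the vertex between them: this is the square of a path. The
  guards of \<open>u\<close> and \<open>w\<close> leave two colors for the ends, and conflict-freeness at the ends leaves three for the inner vertices.
\<close>

lemma no_four_thread:
  assumes nb: "N x = {u, y}" "N y = {x, z}" "N z = {y, s}" "N s = {z, w}"
    and ne: "u \<noteq> y" "x \<noteq> z" "y \<noteq> s" "z \<noteq> w"
  shows False
proof -
  have "nb_walk (\<lambda>u v. v \<in> N u) [u, x, y, z, s, w]"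
    using nb ne N_sym[of u x] by simp
  from walk_distinct[OF this] have dist: "distinct [u, x, y, z, s, w]" "distinct [w, s, z, y, x, u]"
    by auto
  let ?S = "{x, y, z, s}"
  have V: "x \<in> pverts G" "y \<in> pverts G" "z \<in> pverts G" "s \<in> pverts G"
    using nb N_verts' by blast+
  obtain \<phi> g where g: "guarded ?S \<phi> g"
    by (rule guarded_coloring[of ?S]) (use V nb dist in auto)
  have four: "card (L v) = 4" if "v \<in> ?S" for v
    using list_size[of v] V nb ne that by (auto simp: degree_def)
  have "2 \<le> card (L x - g u)" "2 \<le> card (L s - g w)" "3 \<le> card (L y - {\<phi> u})" "3 \<le> card (L z - {\<phi> w})"
    using diff_card_le_card_Diff[OF guardedD(1)[OF g], of "L x" u] guardedD(2)[OF g, of u]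
      diff_card_le_card_Diff[OF guardedD(1)[OF g], of "L s" w] guardedD(2)[OF g, of w]
      card_ge_Suc_remove[of 3 "L y" "\<phi> u"] card_ge_Suc_remove[of 3 "L z" "\<phi> w"] four by auto
  from color_path4_square[OF this(1,3,4,2)] obtain cx cy cz cs where c:
    "cx \<in> L x - g u" "cy \<in> L y - {\<phi> u}" "cz \<in> L z - {\<phi> w}" "cs \<in> L s - g w"
    "cx \<noteq> cy" "cx \<noteq> cz" "cy \<noteq> cz" "cy \<noteq> cs" "cz \<noteq> cs" by blast
  define \<psi> where "\<psi> = \<phi>(x := cx, y := cy, z := cz, s := cs)"
  have \<psi>: "\<psi> x = cx" "\<psi> y = cy" "\<psi> z = cz" "\<psi> s = cs" "\<psi> u = \<phi> u" "\<psi> w = \<phi> w"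
    using dist by (simp_all add: \<psi>_def)
  have "cf_at \<psi> x" "cf_at \<psi> y" "cf_at \<psi> z" "cf_at \<psi> s"
    unfolding cf_at_two[OF nb(1) ne(1)] cf_at_two[OF nb(2) ne(2)] cf_at_two[OF nb(3) ne(3)]
      cf_at_two[OF nb(4) ne(4)] \<psi> using c by blast+
  then have all: "\<forall>s'\<in>?S. colored_at g ?S \<psi> s'"
    using c c(5-9)[symmetric] dist by (simp add: colored_at_def nb \<psi>)
  show False
  proof (rule guardedD(5)[OF g, of \<psi>])
    show "\<psi> v = \<phi> v" if "v \<notin> ?S" for v using that by (simp add: \<psi>_def)
  qed (use all in blast)
qed

text \<open>
  The vertex \<open>u\<close> of degree 3 forbids a single color at \<open>x\<close>, so \<open>x\<close> can be colored after \<open>y\<close>.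
\<close>

lemma no_two_thread_at_3_vertex:
  assumes "d u = 3" and nb: "N x = {u, y}" "N y = {x, w}" and ne: "u \<noteq> y" "x \<noteq> w"
  shows False
proof -
  have "nb_walk (\<lambda>u v. v \<in> N u) [u, x, y, w]"
    using nb ne N_sym[of u x] by simp
  from walk_distinct[OF this] have dist: "distinct [u, x, y, w]" "distinct [w, y, x, u]" by auto
  let ?S = "{x, y}"
  have V: "x \<in> pverts G" "y \<in> pverts G"
    using nb N_verts' by blast+
  obtain \<phi> g where g: "guarded ?S \<phi> g"
    by (rule guarded_coloring[of ?S]) (use V nb dist in auto)
  have four: "card (L x) = 4" "card (L y) = 4"
    using list_size V nb ne by (auto simp: degree_def)
  have "x \<in> N u" using N_sym nb by simp
  then have gu: "g u = {\<phi> u}" using guardedD(4)[OF g, of u] assms(1) dist by auto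
  have "card (insert (\<phi> u) (g w)) \<le> 3"
    using guardedD(1,2)[OF g, of w] by (simp add: card_insert_if)
  then obtain cy where cy: "cy \<in> L y" "cy \<notin> insert (\<phi> u) (g w)"
    using guardedD(1)[OF g] four by (elim choose_outside[rotated -1]) auto
  obtain cx where cx: "cx \<in> L x" "cx \<notin> {\<phi> u, \<phi> w, cy}"
    by (rule choose_outside[of "{\<phi> u, \<phi> w, cy}" "L x"])
      (use four in \<open>auto simp: card_insert_if\<close>)
  define \<psi> where "\<psi> = \<phi>(x := cx, y := cy)"
  have \<psi>: "\<psi> x = cx" "\<psi> y = cy" "\<psi> u = \<phi> u" "\<psi> w = \<phi> w"
    using dist by (simp_all add: \<psi>_def)
  have "cf_at \<psi> x" "cf_at \<psi> y"
    unfolding cf_at_two[OF nb(1) ne(1)] cf_at_two[OF nb(2) ne(2)] \<psi> using cx cy by blast+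
  then have all: "\<forall>s\<in>?S. colored_at g ?S \<psi> s"
    using cx cy dist by (simp add: colored_at_def nb \<psi> gu) blast
  show False
  proof (rule guardedD(5)[OF g, of \<psi>])
    show "\<psi> v = \<phi> v" if "v \<notin> ?S" for v using that by (simp add: \<psi>_def)
  qed (use all in blast)
qed

text \<open>
  The vertex \<open>v\<close> of degree 3 forbids a single color at \<open>x\<close>. So \<open>x\<close>, colored last, can also avoid the color of
  \<open>t\<close>, and then the three neighbors of \<open>u\<close> do not all have the same color.
\<close>

lemma no_two_2_neighbors_near_3_vertex:
  assumes nb: "N u = {t, x, x'}" "N x = {u, v}" "N x' = {u, v'}" and "d v = 3"
    and ne: "t \<noteq> x" "t \<noteq> x'" "x \<noteq> x'" "u \<noteq> v" "u \<noteq> v'"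
  shows False
proof -
  have "x \<in> N v" "u \<in> N t" using N_sym nb by simp_all
  then have "nb_walk (\<lambda>u v. v \<in> N u) [v, x, u, x', v']" "nb_walk (\<lambda>u v. v \<in> N u) [t, u, x, v]"
      "nb_walk (\<lambda>u v. v \<in> N u) [t, u, x', v']"
    using nb ne ne[symmetric] by simp_all
  from this[THEN walk_distinct]
  have d: "distinct [v, x, u, x', v']" "distinct [t, u, x, v]" "distinct [t, u, x', v']"
    by simp_all
  note dist = d d[THEN distinct_rev[THEN iffD2]]
  let ?S = "{u, x, x'}"
  have V: "u \<in> pverts G" "x \<in> pverts G" "x' \<in> pverts G"
    using nb N_verts' by blast+
  obtain \<phi> g where g: "guarded ?S \<phi> g"
    by (rule guarded_coloring[of ?S]) (use V nb dist in auto)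
  have L: "card (L u) = 5" "card (L x) = 4" "card (L x') = 4"
    using list_size V nb ne by (auto simp: degree_def)
  have "x \<in> N v" using N_sym nb by simp
  then have gv: "g v = {\<phi> v}" using guardedD(4)[OF g, of v] assms(4) dist by auto
  have le: "card (insert a (g w)) \<le> 3" "card (insert a (insert b (g w))) \<le> 4" for a b w
    using guardedD(1,2)[OF g, of w] by (simp_all add: card_insert_if)
  obtain cu where cu: "cu \<in> L u" "cu \<notin> insert (\<phi> v) (insert (\<phi> v') (g t))"
    by (rule choose_outside[of "insert (\<phi> v) (insert (\<phi> v') (g t))" "L u"])
      (use guardedD(1)[OF g] le(2)[of "\<phi> v" "\<phi> v'" t] L in simp_all)
  obtain cx' where cx': "cx' \<in> L x'" "cx' \<notin> insert cu (g v')"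
    by (rule choose_outside[of "insert cu (g v')" "L x'"])
      (use guardedD(1)[OF g] le(1)[of cu v'] L in simp_all)
  obtain cx where cx: "cx \<in> L x" "cx \<notin> {\<phi> v, cu, \<phi> t}"
    by (rule choose_outside[of "{\<phi> v, cu, \<phi> t}" "L x"]) (use L in \<open>auto simp: card_insert_if\<close>)
  define \<psi> where "\<psi> = \<phi>(u := cu, x := cx, x' := cx')"
  have \<psi>: "\<psi> u = cu" "\<psi> x = cx" "\<psi> x' = cx'" "\<psi> t = \<phi> t" "\<psi> v = \<phi> v" "\<psi> v' = \<phi> v'"
    using dist by (simp_all add: \<psi>_def)
  have "cf_at \<psi> x" "cf_at \<psi> x'" "cf_at \<psi> u"
    unfolding cf_at_two[OF nb(2) ne(4)] cf_at_two[OF nb(3) ne(5)] \<psi>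
    using cu cx \<psi> by (blast, blast, intro cf_at_three[OF nb(1) ne(1-3)]) auto
  then have all: "\<forall>s\<in>?S. colored_at g ?S \<psi> s"
    using cu cx cx' dist by (simp add: colored_at_def nb \<psi> gv) blast
  show False
  proof (rule guardedD(5)[OF g, of \<psi>])
    show "\<psi> v = \<phi> v" if "v \<notin> ?S" for v using that by (simp add: \<psi>_def)
  qed (use all in blast)
qed

section \<open>Stars of threads\<close>

definition other_end :: "'a \<Rightarrow> 'a \<Rightarrow> 'a" where
  "other_end u x = (THE w. w \<in> N x \<and> w \<noteq> u)"

text \<open>
  The neighbors of \<open>v\<close> are sorted by their degree and, if this is 2, by the degree of their other neighbor. The
  vertices in \<open>to_22 v\<close> begin paths of three vertices of degree 2.
\<close>

definition thick :: "'a \<Rightarrow> 'a set" where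
  "thick v = {x \<in> N v. d x \<noteq> 2}"

definition to_big :: "'a \<Rightarrow> 'a set" where
  "to_big v = {x \<in> N v. d x = 2 \<and> 4 \<le> d (other_end v x)}"

definition to_3 :: "'a \<Rightarrow> 'a set" where
  "to_3 v = {x \<in> N v. d x = 2 \<and> d (other_end v x) = 3}"

definition to_2 :: "'a \<Rightarrow> 'a set" where
  "to_2 v = {x \<in> N v. d x = 2 \<and> d (other_end v x) = 2}"

definition to_22 :: "'a \<Rightarrow> 'a set" where
  "to_22 v = {x \<in> to_2 v. d (other_end x (other_end v x)) = 2}"

lemma other_end:
  assumes "d x = 2" "u \<in> N x"
  shows "N x = {u, other_end u x}" "other_end u x \<noteq> u"
proof -
  obtain w where w: "N x = {u, w}" "w \<noteq> u" using two_neighbors[OF assms] .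
  have "other_end u x = w"
    unfolding other_end_def by (rule the_equality) (use w in auto)
  with w show "N x = {u, other_end u x}" "other_end u x \<noteq> u" by simp_all
qed

lemma other_end_eq: "N x = {u, w} \<Longrightarrow> w \<noteq> u \<Longrightarrow> other_end u x = w"
  unfolding other_end_def by (rule the_equality) auto

lemma neighbor_cases:
  "N v = thick v \<union> (to_big v \<union> to_3 v \<union> to_2 v)"
  "d v = card (thick v) + card (to_big v) + card (to_3 v) + card (to_2 v)"
proof -
  have "2 \<le> d (other_end v x)" if "x \<in> N v" "d x = 2" for x
  proof -
    have "other_end v x \<in> N x" using other_end(1)[OF that(2) N_sym[OF that(1)]] by blast
    then show ?thesis using min_degree_2 N_verts by blast
  qed
  then have "x \<in> thick v \<union> (to_big v \<union> to_3 v \<union> to_2 v)" if "x \<in> N v" for x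
    using that unfolding thick_def to_big_def to_3_def to_2_def by fastforce
  then show eq: "N v = thick v \<union> (to_big v \<union> to_3 v \<union> to_2 v)"
    unfolding thick_def to_big_def to_3_def to_2_def by blast
  have fin: "finite (thick v)" "finite (to_big v)" "finite (to_3 v)" "finite (to_2 v)"
    by (auto simp: thick_def to_big_def to_3_def to_2_def)
  have "to_big v \<inter> to_3 v = {}" "(to_big v \<union> to_3 v) \<inter> to_2 v = {}"
    "thick v \<inter> (to_big v \<union> to_3 v \<union> to_2 v) = {}"
    by (auto simp: thick_def to_big_def to_3_def to_2_def)
  then show "d v = card (thick v) + card (to_big v) + card (to_3 v) + card (to_2 v)"
    unfolding degree_def eq using fin by (simp add: card_Un_disjoint)
qed

end

text \<open>
  The deleted set of the main configuration at \<open>v\<close>: the vertex \<open>v\<close>, its neighbors \<open>x\<close> of degree 2, the next vertices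
  \<open>y x\<close> if they have degree 2, and a third vertex \<open>z x\<close> of degree 2 on at most one thread. Two threads with three
  deleted vertices might end at the same kept vertex, in a cycle of length 8; the girth excludes all shorter
  coincidences.
\<close>

locale critical_star = critical_graph G L for G :: "'a pair_pre_digraph" and L :: "'a \<Rightarrow> 'c set" +
  fixes v :: 'a and Cs :: "'a set"
  assumes deg_v: "4 \<le> d v"
    and Cs: "Cs \<subseteq> to_22 v"
    and Cs_unique: "x \<in> Cs \<Longrightarrow> x' \<in> Cs \<Longrightarrow> x = x'"
begin

abbreviation "y x \<equiv> other_end v x"
abbreviation "z x \<equiv> other_end x (y x)"
abbreviation "w x \<equiv> other_end (y x) (z x)"

definition X :: "'a set" where "X = to_big v \<union> to_3 v \<union> to_2 v"

definition S :: "'a set" where "S = {v} \<union> X \<union> y ` to_2 v \<union> z ` Cs"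

lemma X_iff: "x \<in> X \<longleftrightarrow> x \<in> N v \<and> d x = 2"
proof -
  have "x \<in> X \<Longrightarrow> x \<in> N v \<and> d x = 2" for x
    by (auto simp: X_def to_big_def to_3_def to_2_def)
  moreover have "x \<in> X" if "x \<in> N v" "d x = 2" for x
  proof -
    have "x \<in> thick v \<union> X" using that(1) neighbor_cases(1)[of v] unfolding X_def by blast
    then show ?thesis using that(2) by (simp add: thick_def)
  qed
  ultimately show ?thesis by metis
qed

lemma N_x: "x \<in> X \<Longrightarrow> N x = {v, y x}" "x \<in> X \<Longrightarrow> y x \<noteq> v"
  using other_end[of x v] N_sym by (auto simp: X_iff)

lemma to_2_X: "x \<in> to_2 v \<Longrightarrow> x \<in> X"
  by (simp add: X_def)

lemma Cs_to_2: "x \<in> Cs \<Longrightarrow> x \<in> to_2 v"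
  using Cs by (auto simp: to_22_def)

lemma N_y:
  assumes "x \<in> to_2 v"
  shows "d (y x) = 2" "N (y x) = {x, z x}" "z x \<noteq> x"
proof -
  show d2: "d (y x) = 2" using assms by (simp add: to_2_def)
  have "x \<in> N (y x)" using N_sym N_x(1)[OF to_2_X[OF assms]] by blast
  from other_end[OF d2 this] show "N (y x) = {x, z x}" "z x \<noteq> x" by auto
qed

lemma N_z:
  assumes "x \<in> Cs"
  shows "d (z x) = 2" "N (z x) = {y x, w x}" "w x \<noteq> y x"
proof -
  show d2: "d (z x) = 2" using assms Cs by (auto simp: to_22_def)
  have "y x \<in> N (z x)" using N_sym N_y(2)[OF Cs_to_2[OF assms]] by blast
  from other_end[OF d2 this] show "N (z x) = {y x, w x}" "w x \<noteq> y x" by auto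
qed

text \<open>
  The way from \<open>v\<close> to a deleted vertex along its thread. By the girth it is determined by its end.
\<close>

definition route :: "'a \<Rightarrow> 'a list \<Rightarrow> bool" where
  "route s p \<longleftrightarrow> p = [] \<and> s = v \<or> p = [s] \<and> s \<in> X \<or>
     (\<exists>x\<in>to_2 v. p = [x, y x] \<and> s = y x) \<or> (\<exists>x\<in>Cs. p = [x, y x, z x] \<and> s = z x)"

lemma route_exists: "s \<in> S \<Longrightarrow> \<exists>p. route s p"
  unfolding S_def route_def by blast

lemma in_S: "v \<in> S" "x \<in> X \<Longrightarrow> x \<in> S" "x \<in> to_2 v \<Longrightarrow> y x \<in> S" "x \<in> Cs \<Longrightarrow> z x \<in> S"
  unfolding S_def by blast+

lemma thread_walks:
  "x \<in> X \<Longrightarrow> nb_walk (\<lambda>u v. v \<in> N u) [v, x]"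
  "x \<in> X \<Longrightarrow> nb_walk (\<lambda>u v. v \<in> N u) [v, x, y x]"
  "x \<in> to_2 v \<Longrightarrow> nb_walk (\<lambda>u v. v \<in> N u) [v, x, y x, z x]"
  "x \<in> Cs \<Longrightarrow> nb_walk (\<lambda>u v. v \<in> N u) [v, x, y x, z x, w x]"
proof -
  have 1: "x \<in> N v" "y x \<in> N x" "v \<noteq> y x" if "x \<in> X" for x
    using that N_x[OF that] by (auto simp: X_iff)
  have 2: "z x \<in> N (y x)" "x \<noteq> z x" if "x \<in> to_2 v" for x
    using N_y[OF that] by auto
  have 3: "w x \<in> N (z x)" "y x \<noteq> w x" if "x \<in> Cs" for x
    using N_z[OF that] by auto
  show "x \<in> X \<Longrightarrow> nb_walk (\<lambda>u v. v \<in> N u) [v, x]"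
    "x \<in> X \<Longrightarrow> nb_walk (\<lambda>u v. v \<in> N u) [v, x, y x]" using 1 by simp_all
  show "x \<in> to_2 v \<Longrightarrow> nb_walk (\<lambda>u v. v \<in> N u) [v, x, y x, z x]"
    using 1[of x] 2[of x] to_2_X by simp
  show "x \<in> Cs \<Longrightarrow> nb_walk (\<lambda>u v. v \<in> N u) [v, x, y x, z x, w x]"
    using 1[of x] 2[of x] 3[of x] to_2_X Cs_to_2 by simp
qed

lemma route_walk:
  assumes "route s p"
  shows "nb_walk (\<lambda>u v. v \<in> N u) (v # p)" "last (v # p) = s" "length p \<le> 3"
  using assms thread_walks unfolding route_def by fastforce+

lemma route_unique: "route s p \<Longrightarrow> route s p' \<Longrightarrow> p = p'"
  by (rule walk_unique[of v]) (use route_walk[of s p] route_walk[of s p'] in auto)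

lemma route_step:
  assumes "route s p" "u \<in> N s" "u \<notin> S"
  shows "nb_walk (\<lambda>u v. v \<in> N u) (v # p @ [u])"
proof -
  consider "p = []" "s = v" | "p = [s]" "s \<in> X" | x where "x \<in> to_2 v" "p = [x, y x]" "s = y x"
    | x where "x \<in> Cs" "p = [x, y x, z x]" "s = z x"
    using assms(1) unfolding route_def by blast
  then show ?thesis
  proof cases
    case 1
    then show ?thesis using assms by simp
  next
    case 2
    then have "u \<noteq> v" using assms in_S by blast
    then show ?thesis using 2 assms thread_walks(1)[of s] by simp
  next
    case (3 x)
    then have "u \<noteq> x" using assms in_S to_2_X by blast
    then show ?thesis using 3 assms thread_walks(2)[of x] to_2_X by simp
  next
    case (4 x)
    then have "u \<noteq> y x" using assms in_S Cs_to_2 by blast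
    then show ?thesis using 4 assms thread_walks(3)[of x] Cs_to_2 by simp
  qed
qed

text \<open>
  Two deleted neighbors of \<open>u\<close> would give two walks from \<open>v\<close> to \<open>u\<close>. Their total length is at most 7, as only
  one route has length 3.
\<close>

lemma one_deleted_neighbor:
  assumes "s \<in> S" "s' \<in> S" "u \<in> N s" "u \<in> N s'" "u \<notin> S"
  shows "s = s'"
proof -
  obtain p p' where p: "route s p" and p': "route s' p'" using route_exists assms by blast
  show ?thesis
  proof (cases "length p = 3 \<and> length p' = 3")
    case True
    then obtain x x' where "x \<in> Cs" "s = z x" "x' \<in> Cs" "s' = z x'"
      using p p' unfolding route_def by auto
    then show ?thesis using Cs_unique by metis
  next
    case False
    have "p @ [u] = p' @ [u]"
      by (rule walk_unique[of v])
        (use route_step[OF p assms(3,5)] route_step[OF p' assms(4,5)] route_walk(3)[OF p]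
          route_walk(3)[OF p'] False in auto)
    then have "p = p'" by simp
    then show ?thesis using route_walk(2)[OF p] route_walk(2)[OF p'] by simp
  qed
qed

lemma z_kept:
  assumes "x \<in> to_2 v" "x \<notin> Cs" shows "z x \<notin> S"
proof
  assume "z x \<in> S"
  then obtain p where p: "route (z x) p" using route_exists by blast
  have "p = [x, y x, z x]"
    by (rule walk_unique[of v]) (use route_walk[OF p] thread_walks(3)[OF assms(1)] in auto)
  then show False using p assms(2) unfolding route_def by auto
qed

lemma w_kept:
  assumes "x \<in> Cs" shows "w x \<notin> S"
proof
  assume "w x \<in> S"
  then obtain p where p: "route (w x) p" using route_exists by blast
  have "p = [x, y x, z x, w x]"
    by (rule walk_unique[of v]) (use route_walk[OF p] thread_walks(4)[OF assms] in auto)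
  then show False using route_walk(3)[OF p] by simp
qed

lemma deg_S: "s \<in> S \<Longrightarrow> s \<noteq> v \<Longrightarrow> d s = 2"
  unfolding S_def using X_iff N_y(1) N_z(1) by blast

lemma thick_kept: "t \<in> thick v \<Longrightarrow> t \<notin> S"
  using deg_S N_irrefl by (auto simp: thick_def)

lemma y_kept: "x \<in> X \<Longrightarrow> x \<notin> to_2 v \<Longrightarrow> y x \<notin> S"
  using deg_S[of "y x"] N_x(2)[of x] by (auto simp: X_def to_big_def to_3_def)

lemma y_not_X: "x \<in> to_2 v \<Longrightarrow> y x \<notin> X"
  using route_unique[of "y x" "[x, y x]" "[y x]"] by (auto simp: route_def)

lemma z_not_X: "x \<in> Cs \<Longrightarrow> z x \<notin> X"
  using route_unique[of "z x" "[x, y x, z x]" "[z x]"] by (auto simp: route_def)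

lemma z_not_y: "x \<in> Cs \<Longrightarrow> z x \<notin> y ` to_2 v"
proof
  assume "x \<in> Cs" "z x \<in> y ` to_2 v"
  then obtain x' where "x' \<in> to_2 v" "z x = y x'" by blast
  then show False
    using route_unique[of "z x" "[x, y x, z x]" "[x', y x']"] \<open>x \<in> Cs\<close> unfolding route_def by auto
qed

lemma z_not_v: "x \<in> Cs \<Longrightarrow> z x \<noteq> v"
  using route_unique[of v "[x, y x, z x]" "[]"] unfolding route_def by force

lemma y_inj: "inj_on y (to_2 v)"
proof (rule inj_onI)
  fix x x' assume "x \<in> to_2 v" "x' \<in> to_2 v" "y x = y x'"
  then show "x = x'"
    using route_unique[of "y x" "[x, y x]" "[x', y x']"] unfolding route_def by auto
qed

lemma finite_stars: "finite (thick v)" "finite X" "finite (to_2 v)" "finite (to_3 v)" "finite (to_big v)"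
  by (auto simp: thick_def X_def to_big_def to_3_def to_2_def)

lemma S_verts: "S \<subseteq> pverts G"
proof -
  have "N v \<noteq> {}" using deg_v unfolding degree_def by force
  then have "v \<in> pverts G" using N_verts' by blast
  moreover have "s \<in> pverts G" if "s \<in> S" "s \<noteq> v" for s
    using deg_S[OF that] N_verts'[of _ s] unfolding degree_def by (metis card_2_iff insertI1)
  ultimately show ?thesis by blast
qed

lemma card_L: "s \<in> S \<Longrightarrow> s \<noteq> v \<Longrightarrow> card (L s) = 4"
  using list_size[of s] deg_S[of s] S_verts by auto

text \<open>The colors left for \<open>x\<close> when \<open>v\<close> gets the color \<open>a\<close> and the rest of the thread is colored suitably.\<close>

definition options :: "('a \<Rightarrow> 'c) \<Rightarrow> ('a \<Rightarrow> 'c set) \<Rightarrow> 'a \<Rightarrow> 'c \<Rightarrow> 'c set" where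
  "options \<phi> g x a =
    (if x \<in> Cs then {k \<in> L x - {a}. \<exists>b\<in>L (y x) - {a, \<phi> (w x)}. \<exists>c\<in>L (z x) - g (w x).
        k \<noteq> b \<and> k \<noteq> c \<and> b \<noteq> c}
     else if x \<in> to_2 v then {k \<in> L x - {a, \<phi> (z x)}. \<exists>b\<in>L (y x) - g (z x) - {a}. k \<noteq> b}
     else L x - g (y x) - {a})"

lemma flexible_choices:
  assumes g: "guarded S \<phi> g" and x: "x \<in> X"
  shows "flexible (if x \<in> Cs then 1 else if x \<in> to_3 v then 0 else 2) (options \<phi> g x)"
proof -
  have xv: "x \<noteq> v" using x N_irrefl by (auto simp: X_iff)
  have Lx: "card (L x) = 4" using card_L[of x] in_S(2)[OF x] xv by simp
  consider "x \<in> Cs" | "x \<in> to_2 v" "x \<notin> Cs" | "x \<in> to_3 v" | "x \<in> to_big v"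
    using x unfolding X_def by blast
  then show ?thesis
  proof cases
    case 1
    then have L: "card (L (y x)) = 4" "card (L (z x)) = 4"
      using card_L[OF in_S(3)] card_L[OF in_S(4)] N_x(2)[OF x] z_not_v Cs_to_2 by auto
    have "options \<phi> g x = (\<lambda>a. {k \<in> L x - {a}. \<exists>b\<in>L (y x) - {a, \<phi> (w x)}. \<exists>c\<in>L (z x) - g (w x).
        k \<noteq> b \<and> k \<noteq> c \<and> b \<noteq> c})"
      using 1 by (intro ext) (simp add: options_def)
    then show ?thesis
      using flexible_three_thread[OF guardedD(1,2)[OF g] Lx L] 1 by simp
  next
    case 2
    then have L: "card (L (y x)) = 4"
      using card_L[OF in_S(3)] N_x(2)[OF x] by auto
    have "x \<notin> to_3 v" using 2 by (auto simp: to_2_def to_3_def)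
    moreover have "options \<phi> g x =
        (\<lambda>a. {k \<in> L x - {a, \<phi> (z x)}. \<exists>b\<in>L (y x) - g (z x) - {a}. k \<noteq> b})"
      using 2 by (intro ext) (simp add: options_def)
    ultimately show ?thesis
      using flexible_two_thread[OF guardedD(1,2)[OF g] Lx L] 2 by simp
  next
    case 3
    then have n: "x \<notin> to_2 v" "x \<notin> Cs" using Cs_to_2 by (auto simp: to_2_def to_3_def)
    have "y x \<notin> S" by (rule y_kept[OF x n(1)])
    moreover have "x \<in> N (y x)" using N_x(1)[OF x] N_sym by blast
    moreover have "d (y x) = 3" using 3 by (simp add: to_3_def)
    ultimately have gy: "g (y x) = {\<phi> (y x)}" using guardedD(4)[OF g] in_S(2)[OF x] by blast
    have "multiple (options \<phi> g x a)" for a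
      unfolding options_def using n gy
      by (auto intro!: multipleI card_ge_Suc_remove simp: Lx)
    then show ?thesis using n 3 by (simp add: flexible_0)
  next
    case 4
    then have n: "x \<notin> to_2 v" "x \<notin> Cs" "x \<notin> to_3 v"
      using Cs_to_2 by (auto simp: to_2_def to_3_def to_big_def)
    have "2 \<le> card (L x - g (y x))"
      by (rule card_Diff_le[OF guardedD(1,2)[OF g]]) (simp add: Lx)
    moreover have "options \<phi> g x = (\<lambda>a. L x - g (y x) - {a})"
      using n by (intro ext) (simp add: options_def)
    ultimately show ?thesis using flexible_remove[of "L x - g (y x)"] n by simp
  qed
qed

text \<open>
  The membership of \<open>\<kappa> x\<close> in \<open>options \<phi> g x a\<close> provides colors for the other vertices of the thread of \<open>x\<close>. As the
  threads are disjoint and not adjacent, they can be colored independently.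
\<close>

lemma coloring_extends:
  assumes g: "guarded S \<phi> g"
    and a: "a \<in> L v" "\<And>t. t \<in> thick v \<Longrightarrow> a \<notin> g t" "\<And>x. x \<in> to_big v \<union> to_3 v \<Longrightarrow> a \<noteq> \<phi> (y x)"
    and \<kappa>: "\<And>t. t \<in> thick v \<Longrightarrow> \<kappa> t = \<phi> t" "\<And>x. x \<in> X \<Longrightarrow> \<kappa> x \<in> options \<phi> g x a"
    and cf: "\<exists>c. \<exists>!u. u \<in> N v \<and> \<kappa> u = c"
  shows False
proof -
  \<comment> \<open>\<open>bc\<close> consists of the colors of \<open>y x\<close> and \<open>z x\<close>; the second is arbitrary if \<open>z x\<close> is kept\<close>
  have "\<forall>x\<in>to_2 v. \<exists>bc. fst bc \<in> L (y x) \<and> fst bc \<noteq> a \<and> fst bc \<noteq> \<kappa> x \<and>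
      (if x \<in> Cs then fst bc \<noteq> \<phi> (w x) \<and> snd bc \<in> L (z x) - g (w x) \<and> \<kappa> x \<noteq> snd bc \<and> fst bc \<noteq> snd bc
       else fst bc \<notin> g (z x) \<and> \<kappa> x \<noteq> \<phi> (z x))"
  proof
    fix x assume x: "x \<in> to_2 v"
    show "\<exists>bc. fst bc \<in> L (y x) \<and> fst bc \<noteq> a \<and> fst bc \<noteq> \<kappa> x \<and>
      (if x \<in> Cs then fst bc \<noteq> \<phi> (w x) \<and> snd bc \<in> L (z x) - g (w x) \<and> \<kappa> x \<noteq> snd bc \<and> fst bc \<noteq> snd bc
       else fst bc \<notin> g (z x) \<and> \<kappa> x \<noteq> \<phi> (z x))"
    proof (cases "x \<in> Cs")
      case True
      then obtain b c where "b \<in> L (y x) - {a, \<phi> (w x)}" "c \<in> L (z x) - g (w x)"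
        "\<kappa> x \<noteq> b" "\<kappa> x \<noteq> c" "b \<noteq> c"
        using \<kappa>(2)[OF to_2_X[OF x]] by (auto simp: options_def)
      then show ?thesis using True by (intro exI[of _ "(b, c)"]) auto
    next
      case False
      then obtain b where "b \<in> L (y x) - g (z x) - {a}" "\<kappa> x \<noteq> b" "\<kappa> x \<noteq> \<phi> (z x)"
        using \<kappa>(2)[OF to_2_X[OF x]] x by (auto simp: options_def)
      then show ?thesis using False by (intro exI[of _ "(b, b)"]) auto
    qed
  qed
  then obtain bc where bc0: "\<forall>x\<in>to_2 v. fst (bc x) \<in> L (y x) \<and> fst (bc x) \<noteq> a \<and> fst (bc x) \<noteq> \<kappa> x \<and>
      (if x \<in> Cs then fst (bc x) \<noteq> \<phi> (w x) \<and> snd (bc x) \<in> L (z x) - g (w x) \<and> \<kappa> x \<noteq> snd (bc x) \<and>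
         fst (bc x) \<noteq> snd (bc x)
       else fst (bc x) \<notin> g (z x) \<and> \<kappa> x \<noteq> \<phi> (z x))"
    by (rule bchoice[THEN exE])
  have bc: "fst (bc x) \<in> L (y x) \<and> fst (bc x) \<noteq> a \<and> fst (bc x) \<noteq> \<kappa> x" if "x \<in> to_2 v" for x
    using bspec[OF bc0 that] by blast
  have bcC: "fst (bc x) \<noteq> \<phi> (w x) \<and> snd (bc x) \<in> L (z x) \<and> snd (bc x) \<notin> g (w x) \<and>
      \<kappa> x \<noteq> snd (bc x) \<and> fst (bc x) \<noteq> snd (bc x)" if "x \<in> Cs" for x
    using bspec[OF bc0 Cs_to_2[OF that]] that by simp
  have bcB: "fst (bc x) \<notin> g (z x) \<and> \<kappa> x \<noteq> \<phi> (z x)" if "x \<in> to_2 v" "x \<notin> Cs" for x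
    using bspec[OF bc0 that(1)] that(2) by simp
  define \<psi> where "\<psi> u =
    (if u = v then a else if u \<in> X then \<kappa> u
     else if u \<in> y ` to_2 v then fst (bc (inv_into (to_2 v) y u))
     else if u \<in> z ` Cs then snd (bc (inv_into Cs z u)) else \<phi> u)" for u
  have vX: "v \<notin> X" using N_irrefl by (simp add: X_iff)
  have \<psi>v: "\<psi> v = a" by (simp add: \<psi>_def)
  have \<psi>x: "\<psi> x = \<kappa> x" if "x \<in> X" for x using that vX by (auto simp: \<psi>_def)
  have \<psi>y: "\<psi> (y x) = fst (bc x)" if "x \<in> to_2 v" for x
    using that N_x(2)[OF to_2_X[OF that]] y_not_X[OF that] inv_into_f_f[OF y_inj that]
    by (simp add: \<psi>_def)
  have \<psi>z: "\<psi> (z x) = snd (bc x)" if "x \<in> Cs" for x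
  proof -
    have "inj_on z Cs" using Cs_unique by (auto intro: inj_onI)
    then show ?thesis
      using that z_not_v[OF that] z_not_X[OF that] z_not_y[OF that] inv_into_f_f[of z Cs x]
      by (simp add: \<psi>_def)
  qed
  have \<psi>out: "\<psi> u = \<phi> u" if "u \<notin> S" for u
    using that unfolding S_def \<psi>_def by simp
  have \<kappa>L: "\<kappa> x \<in> L x" "\<kappa> x \<noteq> a" if "x \<in> X" for x
    using \<kappa>(2)[OF that] by (auto simp: options_def split: if_splits)
  have "colored_at g S \<psi> s" if sS: "s \<in> S" for s
  proof -
    have Nv: "N v = thick v \<union> X" using neighbor_cases(1)[of v] unfolding X_def .
    consider "s = v" | "s \<in> X" "s \<notin> to_2 v" | "s \<in> to_2 v"
      | x where "x \<in> to_2 v" "x \<notin> Cs" "s = y x" | x where "x \<in> Cs" "s = y x" | x where "x \<in> Cs" "s = z x"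
      using sS unfolding S_def by blast
    then show ?thesis
    proof cases
      case 1
      have "\<psi> u = \<kappa> u" if "u \<in> N v" for u
      proof (cases "u \<in> X")
        case False
        then have "u \<in> thick v" using that Nv by blast
        then show ?thesis using \<psi>out[OF thick_kept] \<kappa>(1) by simp
      qed (rule \<psi>x)
      then have "u \<in> N v \<and> \<psi> u = c \<longleftrightarrow> u \<in> N v \<and> \<kappa> u = c" for u c by auto
      then have "cf_at \<psi> v" unfolding cf_at_def using cf by simp
      moreover have "if u \<in> S then a \<noteq> \<psi> u else a \<notin> g u" if "u \<in> N v" for u
      proof (cases "u \<in> X")
        case True
        then show ?thesis using in_S(2)[OF True] \<psi>x[OF True] \<kappa>L(2)[OF True] by simp
      next
        case False
        then have "u \<in> thick v" using that Nv by blast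
        then show ?thesis using thick_kept a(2) by simp
      qed
      ultimately show ?thesis using 1 a(1) by (simp add: colored_at_def \<psi>v)
    next
      case 2
      note n = N_x(1)[OF 2(1)] N_x(2)[OF 2(1), symmetric]
      have k: "y s \<notin> S" by (rule y_kept[OF 2])
      have sb: "s \<in> to_big v \<union> to_3 v" using 2 unfolding X_def by blast
      have "s \<notin> Cs" using 2 Cs_to_2 by blast
      then have gk: "\<kappa> s \<notin> g (y s)" using \<kappa>(2)[OF 2(1)] 2(2) by (simp add: options_def)
      have "cf_at \<psi> s" using cf_at_two[OF n] \<psi>v \<psi>out[OF k] a(3)[OF sb] by simp
      moreover have "if u \<in> S then \<psi> s \<noteq> \<psi> u else \<psi> s \<notin> g u" if "u \<in> N s" for u
        using that k gk \<kappa>L(2)[OF 2(1)] in_S(1) unfolding n(1) \<psi>x[OF 2(1)] by (auto simp: \<psi>v)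
      moreover have "\<psi> s \<in> L s" using \<kappa>L(1)[OF 2(1)] \<psi>x[OF 2(1)] by simp
      ultimately show ?thesis by (simp add: colored_at_def)
    next
      case 3
      have sX: "s \<in> X" using to_2_X[OF 3] .
      note n = N_x(1)[OF sX] N_x(2)[OF sX, symmetric]
      have "cf_at \<psi> s" using cf_at_two[OF n] \<psi>v \<psi>y[OF 3] bc[OF 3] by auto
      moreover have "if u \<in> S then \<psi> s \<noteq> \<psi> u else \<psi> s \<notin> g u" if "u \<in> N s" for u
        using that \<kappa>L(2)[OF sX] in_S(1) in_S(3)[OF 3] bc[OF 3] \<psi>y[OF 3]
        unfolding n(1) \<psi>x[OF sX] by (auto simp: \<psi>v)
      moreover have "\<psi> s \<in> L s" using \<kappa>L(1)[OF sX] \<psi>x[OF sX] by simp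
      ultimately show ?thesis by (simp add: colored_at_def)
    next
      case (4 x)
      have xX: "x \<in> X" using to_2_X[OF 4(1)] .
      note n = N_y(2)[OF 4(1)] N_y(3)[OF 4(1), symmetric]
      have k: "z x \<notin> S" by (rule z_kept[OF 4(1,2)])
      have "cf_at \<psi> (y x)" using cf_at_two[OF n] \<psi>x[OF xX] \<psi>out[OF k] bcB[OF 4(1,2)] by simp
      moreover have "if u \<in> S then \<psi> (y x) \<noteq> \<psi> u else \<psi> (y x) \<notin> g u" if "u \<in> N (y x)" for u
        using that k in_S(2)[OF xX] bc[OF 4(1)] bcB[OF 4(1,2)]
        unfolding n(1) \<psi>y[OF 4(1)] by (auto simp: \<psi>x[OF xX])
      moreover have "\<psi> (y x) \<in> L (y x)" using bc[OF 4(1)] \<psi>y[OF 4(1)] by simp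
      ultimately show ?thesis using 4(3) by (simp add: colored_at_def)
    next
      case (5 x)
      have x2: "x \<in> to_2 v" using Cs_to_2[OF 5(1)] .
      have xX: "x \<in> X" using to_2_X[OF x2] .
      note n = N_y(2)[OF x2] N_y(3)[OF x2, symmetric]
      have "cf_at \<psi> (y x)" using cf_at_two[OF n] \<psi>x[OF xX] \<psi>z[OF 5(1)] bcC[OF 5(1)] by simp
      moreover have "if u \<in> S then \<psi> (y x) \<noteq> \<psi> u else \<psi> (y x) \<notin> g u" if "u \<in> N (y x)" for u
        using that in_S(2)[OF xX] in_S(4)[OF 5(1)] bc[OF x2] bcC[OF 5(1)] \<psi>z[OF 5(1)]
        unfolding n(1) \<psi>y[OF x2] by (auto simp: \<psi>x[OF xX])
      moreover have "\<psi> (y x) \<in> L (y x)" using bc[OF x2] \<psi>y[OF x2] by simp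
      ultimately show ?thesis using 5(2) by (simp add: colored_at_def)
    next
      case (6 x)
      have x2: "x \<in> to_2 v" using Cs_to_2[OF 6(1)] .
      note n = N_z(2)[OF 6(1)] N_z(3)[OF 6(1), symmetric]
      have k: "w x \<notin> S" by (rule w_kept[OF 6(1)])
      have "cf_at \<psi> (z x)" using cf_at_two[OF n] \<psi>y[OF x2] \<psi>out[OF k] bcC[OF 6(1)] by simp
      moreover have "if u \<in> S then \<psi> (z x) \<noteq> \<psi> u else \<psi> (z x) \<notin> g u" if "u \<in> N (z x)" for u
        using that k in_S(3)[OF x2] bcC[OF 6(1)] \<psi>y[OF x2]
        unfolding n(1) \<psi>z[OF 6(1)] by auto
      moreover have "\<psi> (z x) \<in> L (z x)" using bcC[OF 6(1)] \<psi>z[OF 6(1)] by simp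
      ultimately show ?thesis using 6(2) by (simp add: colored_at_def)
    qed
  qed
  then show False using guardedD(5)[OF g, of \<psi>] \<psi>out by metis
qed

text \<open>
  Let \<open>r = card (thick v)\<close>. The guards of the thick neighbors and the kept ends of the threads of length 1 leave at
  least \<open>card (to_2 v) + 2 - r\<close> colors for \<open>v\<close>. Averaged over these, fewer than \<open>4 - r\<close> threads have \<open>v\<close>'s color as
  an exceptional one, so that at most three neighbors of \<open>v\<close> are fixed. For \<open>r = 1\<close> and \<open>r = 2\<close> the count is so tight
  that it needs the thread in \<open>Cs\<close>, with its single exceptional color.
\<close>

lemma too_few_thick_neighbors:
  assumes few: "3 * card (thick v) + 2 * card (to_big v) + card (to_3 v) + card (to_2 v - to_22 v) < 8"
    and Cs_empty: "Cs = {} \<Longrightarrow> to_22 v = {}"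
  shows False
proof -
  define r s t3 t2 where "r = card (thick v)" and "s = card (to_big v)"
    and "t3 = card (to_3 v)" and "t2 = card (to_2 v)"
  obtain \<phi> g where g: "guarded S \<phi> g"
    by (rule guarded_coloring[OF _ S_verts one_deleted_neighbor]) (use in_S in auto)
  have "\<forall>x\<in>X. \<exists>E. finite E \<and> card E \<le> (if x \<in> Cs then 1 else if x \<in> to_3 v then 0 else 2) \<and>
      (\<forall>a. options \<phi> g x a \<noteq> {} \<and> (a \<notin> E \<longrightarrow> multiple (options \<phi> g x a)))"
    using flexible_choices[OF g] unfolding flexible_def by blast
  then obtain E where "\<forall>x\<in>X. finite (E x) \<and> card (E x) \<le> (if x \<in> Cs then 1 else if x \<in> to_3 v then 0 else 2) \<and>
      (\<forall>a. options \<phi> g x a \<noteq> {} \<and> (a \<notin> E x \<longrightarrow> multiple (options \<phi> g x a)))"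
    by (rule bchoice[THEN exE])
  then have E: "finite (E x)" "card (E x) \<le> (if x \<in> Cs then 1 else if x \<in> to_3 v then 0 else 2)"
    "options \<phi> g x a \<noteq> {}" "a \<notin> E x \<Longrightarrow> multiple (options \<phi> g x a)" if "x \<in> X" for x a
    using that by auto
  have dv: "d v = r + s + t3 + t2" using neighbor_cases(2)[of v] by (simp add: r_def s_def t3_def t2_def)
  have finCs: "finite Cs" using Cs_to_2 finite_stars(3) by (auto intro: finite_subset)
  have cC: "card Cs \<le> 1" "Cs = {} \<longleftrightarrow> card Cs = 0"
    using Cs_unique finCs by (auto simp: card_le_Suc0_iff_eq)
  have disj: "to_big v \<inter> to_3 v = {}" "(to_big v \<union> to_3 v) \<inter> to_2 v = {}"
    by (auto simp: to_big_def to_3_def to_2_def)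
  have sumE: "(\<Sum>x\<in>X. card (E x)) + card Cs \<le> 2 * (s + t2)"
  proof -
    define e where "e x = (if x \<in> Cs then 1 else if x \<in> to_3 v then 0 else 2::nat)" for x
    have "(\<Sum>x\<in>X. card (E x)) \<le> (\<Sum>x\<in>X. e x)" using E(2) by (intro sum_mono) (simp add: e_def)
    also have "\<dots> = (\<Sum>x\<in>to_big v. e x) + (\<Sum>x\<in>to_3 v. e x) + (\<Sum>x\<in>to_2 v. e x)"
      unfolding X_def using disj finite_stars by (simp add: sum.union_disjoint)
    finally have "(\<Sum>x\<in>X. card (E x)) \<le>
        (\<Sum>x\<in>to_big v. e x) + (\<Sum>x\<in>to_3 v. e x) + (\<Sum>x\<in>to_2 v. e x)" .
    moreover have "(\<Sum>x\<in>to_big v. e x) = 2 * s"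
      using disj Cs_to_2 unfolding s_def by (subst sum.cong[of _ _ _ "\<lambda>_. 2"]) (auto simp: e_def)
    moreover have "(\<Sum>x\<in>to_3 v. e x) = 0"
      using disj Cs_to_2 by (intro sum.neutral) (auto simp: e_def)
    moreover have "(\<Sum>x\<in>to_2 v. e x) + card Cs = 2 * t2"
    proof -
      have "(\<Sum>x\<in>to_2 v. e x) = (\<Sum>x\<in>Cs. e x) + (\<Sum>x\<in>to_2 v - Cs. e x)"
        using sum.subset_diff[of Cs "to_2 v" e] Cs_to_2 finite_stars(3) by (auto simp: add.commute)
      also have "(\<Sum>x\<in>Cs. e x) = card Cs" by (simp add: e_def)
      also have "(\<Sum>x\<in>to_2 v - Cs. e x) = 2 * card (to_2 v - Cs)"
        using disj by (subst sum.cong[of _ _ _ "\<lambda>_. 2"]) (auto simp: e_def)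
      also have "card (to_2 v - Cs) = t2 - card Cs"
        unfolding t2_def using Cs_to_2 finCs by (intro card_Diff_subset) auto
      moreover have "card Cs \<le> t2"
        unfolding t2_def using Cs_to_2 finite_stars(3) by (intro card_mono) auto
      ultimately show ?thesis by simp
    qed
    ultimately show ?thesis by simp
  qed
  \<comment> \<open>a color of \<open>v\<close> must respect the guards and differ from the color of a kept vertex at distance 2,
    as the vertex between them sees only these two\<close>
  define A where "A = L v - ((\<Union>t\<in>thick v. g t) \<union> (\<lambda>x. \<phi> (y x)) ` (to_big v \<union> to_3 v))"
  have vV: "v \<in> pverts G" using in_S(1) S_verts by blast
  have cA: "t2 + 2 \<le> card A + r"
  proof -
    have "card (\<Union>t\<in>thick v. g t) \<le> (\<Sum>t\<in>thick v. card (g t))"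
      using finite_stars(1) by (rule card_UN_le)
    also have "\<dots> \<le> (\<Sum>t\<in>thick v. 2)" using guardedD(2)[OF g] by (intro sum_mono) simp
    finally have "card (\<Union>t\<in>thick v. g t) \<le> 2 * r" by (simp add: r_def)
    moreover have "card ((\<lambda>x. \<phi> (y x)) ` (to_big v \<union> to_3 v)) \<le> s + t3"
      using card_image_le[of "to_big v \<union> to_3 v" "\<lambda>x. \<phi> (y x)"] card_Un_le[of "to_big v" "to_3 v"]
        finite_stars unfolding s_def t3_def by (meson finite_UnI order_trans)
    ultimately have "card ((\<Union>t\<in>thick v. g t) \<union> (\<lambda>x. \<phi> (y x)) ` (to_big v \<union> to_3 v)) \<le> 2 * r + (s + t3)"
      by (meson add_mono card_Un_le order_trans)
    moreover have "finite ((\<Union>t\<in>thick v. g t) \<union> (\<lambda>x. \<phi> (y x)) ` (to_big v \<union> to_3 v))"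
      using finite_stars guardedD(1)[OF g] by blast
    from diff_card_le_card_Diff[OF this, of "L v"]
    have "card (L v) - card ((\<Union>t\<in>thick v. g t) \<union> (\<lambda>x. \<phi> (y x)) ` (to_big v \<union> to_3 v)) \<le> card A"
      unfolding A_def .
    ultimately show ?thesis using list_size[OF vV] dv by linarith
  qed
  have few': "3 * r + 2 * s + t3 + card (to_2 v - to_22 v) < 8"
    using few by (simp add: r_def s_def t3_def)
  have "r \<le> 2" using few' by linarith
  have none: "card Cs = 0 \<Longrightarrow> card (to_2 v - to_22 v) = t2"
    using Cs_empty cC by (simp add: t2_def)
  have "2 * (s + t2) < (4 - r) * card A + card Cs"
  proof -
    consider "r = 0" | "r = 1" | "r = 2" using \<open>r \<le> 2\<close> by linarith
    then show ?thesis
    proof cases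
      case 1
      then show ?thesis using cA few' by simp
    next
      case 2
      show ?thesis
      proof (cases "card Cs = 0")
        case True
        then show ?thesis using 2 cA few' none dv deg_v by simp
      next
        case False
        then show ?thesis using 2 cA few' dv deg_v cC by simp
      qed
    next
      case 3
      show ?thesis
      proof (cases "card Cs = 0")
        case True
        then show ?thesis using 3 cA few' none dv deg_v by simp
      next
        case False
        have "s = 0" using 3 few' by simp
        moreover have "t2 \<le> card A" using cA 3 by simp
        moreover have "0 < card Cs" using False by simp
        moreover have "4 - r = 2" using 3 by simp
        ultimately show ?thesis by simp
      qed
    qed
  qed
  then have "(\<Sum>x\<in>X. card (E x)) < (4 - r) * card A" using sumE by linarith
  moreover have "finite A" unfolding A_def using finite_L[OF vV] by blast
  ultimately obtain a where a: "a \<in> A" "card {x \<in> X. a \<in> E x} < 4 - r"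
    using few_exceptions[of A X E "4 - r"] finite_stars(2) E(1) by blast
  define F where "F = thick v \<union> {x \<in> X. a \<in> E x}"
  have Nv: "N v = thick v \<union> X" using neighbor_cases(1)[of v] unfolding X_def .
  have tX: "thick v \<inter> X = {}" by (auto simp: thick_def X_iff)
  have cF: "card F \<le> 3"
    using a(2) \<open>r \<le> 2\<close> card_Un_le[of "thick v" "{x \<in> X. a \<in> E x}"] unfolding F_def r_def by linarith
  have "card (N v) \<ge> 4" using deg_v by (simp add: degree_def)
  then have "F \<noteq> N v" using cF by auto
  then have "F \<subset> N v" unfolding F_def using Nv by blast
  moreover have "finite F" unfolding F_def using finite_stars by simp
  moreover have "multiple (options \<phi> g x a)" if "x \<in> N v - F" for x
    using that Nv E(4)[of x a] unfolding F_def by blast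
  ultimately obtain \<kappa> where
    k: "\<forall>x\<in>F. \<kappa> x = (if x \<in> thick v then \<phi> x else (SOME k. k \<in> options \<phi> g x a))"
      "\<forall>x\<in>N v - F. \<kappa> x \<in> options \<phi> g x a" "\<exists>c. \<exists>!u. u \<in> N v \<and> \<kappa> u = c"
    using conflict_free_choice[of F "N v" "\<lambda>x. options \<phi> g x a"
        "\<lambda>x. if x \<in> thick v then \<phi> x else (SOME k. k \<in> options \<phi> g x a)"] cF
    by blast
  show False
  proof (rule coloring_extends[OF g, of a \<kappa>])
    show "a \<in> L v" "\<And>t. t \<in> thick v \<Longrightarrow> a \<notin> g t" "\<And>x. x \<in> to_big v \<union> to_3 v \<Longrightarrow> a \<noteq> \<phi> (y x)"
      using a(1) unfolding A_def by blast+
    show "\<kappa> t = \<phi> t" if "t \<in> thick v" for t using that k(1) by (simp add: F_def)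
    show "\<kappa> x \<in> options \<phi> g x a" if x: "x \<in> X" for x
    proof (cases "x \<in> F")
      case True
      have "(SOME k. k \<in> options \<phi> g x a) \<in> options \<phi> g x a"
        using E(3)[OF x] by (simp add: some_in_eq)
      moreover have "x \<notin> thick v" using x tX by blast
      ultimately show ?thesis using k(1) True by simp
    qed (use k(2) x Nv in blast)
    show "\<exists>c. \<exists>!u. u \<in> N v \<and> \<kappa> u = c" by (rule k(3))
  qed
qed

end

text \<open>
  The coefficients are what \<open>v\<close> keeps, in the discharging argument, of a charge of 3 for a neighbor of each kind.
\<close>

lemma (in critical_graph) star_bound:
  assumes "4 \<le> d v"
  shows "8 \<le> 3 * card (thick v) + 2 * card (to_big v) + card (to_3 v) + card (to_2 v - to_22 v)"
proof (rule ccontr)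
  assume few: "\<not> ?thesis"
  obtain Cs where thread: "Cs \<subseteq> to_22 v" "Cs = {} \<longrightarrow> to_22 v = {}" "\<forall>x\<in>Cs. \<forall>x'\<in>Cs. x = x'"
  proof (cases "to_22 v = {}")
    case True
    then show thesis using that[of "{}"] by simp
  next
    case False
    then obtain c where "c \<in> to_22 v" by blast
    then show thesis using that[of "{c}"] by simp
  qed
  interpret critical_star G L v Cs
    by unfold_locales (use assms thread in auto)
  show False using too_few_thick_neighbors few thread(2) by simp
qed

section \<open>Discharging\<close>

context critical_graph begin

text \<open>
  The charge of a vertex is three times its degree; it must become at least 8. So a vertex of degree 2 needs 2 more, a
  vertex of degree 3 can spare 1, and \<open>star_bound\<close> says what the others can spare. Two ends of degree
  at least 4, or two of degree 3, pay 1 each for a vertex of degree 2 between them. An end of degree at least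
  4 pays all if the other end has degree 3, and for its neighbor on a path of two vertices of degree 2. On a path of
  three such vertices each end pays 3, of which 1 is passed on to the middle vertex.
\<close>

definition give :: "'a \<Rightarrow> 'a \<Rightarrow> nat" where
  "give u x =
    (if d x \<noteq> 2 then 0
     else if d u = 2 then (if d (other_end u x) = 2 then 1 else 0)
     else if d u = 3 then (if d (other_end u x) = 3 then 1 else 0)
     else if d (other_end u x) = 2 then (if d (other_end x (other_end u x)) = 2 then 3 else 2)
     else if d (other_end u x) = 3 then 2 else 1)"

lemma N_degree_ge_2: "x \<in> N v \<Longrightarrow> 2 \<le> d x"
  using min_degree_2 N_verts by blast

lemma charge_2_one_thread_end:
  assumes pq: "N v = {p, q}" "p \<noteq> q" and d: "d p = 2" "d q \<noteq> 2"
  shows "2 + give v p + give v q \<le> give p v + give q v"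
proof -
  have dv: "d v = 2" using pq by (simp add: degree_def)
  have oe: "other_end p v = q" "other_end q v = p"
    using other_end_eq[of v p q] other_end_eq[of v q p] pq by (auto simp: insert_commute)
  have "v \<in> N p" using N_sym pq by simp
  note op = other_end[OF d(1) this]
  have "2 \<le> d q" using N_degree_ge_2[of q v] pq by simp
  moreover have "d q \<noteq> 3"
  proof
    assume "d q = 3"
    then show False
      using no_two_thread_at_3_vertex[of q v p "other_end v p"] pq op by (auto simp: insert_commute)
  qed
  ultimately show ?thesis using d dv oe by (auto simp: give_def)
qed

lemma charge_2:
  assumes v: "v \<in> pverts G" "d v = 2"
  shows "8 + (\<Sum>x\<in>N v. give v x) \<le> 3 * d v + (\<Sum>u\<in>N v. give u v)"
proof -
  obtain p q where pq: "N v = {p, q}" "p \<noteq> q" using v(2) by (auto simp: degree_def card_2_iff)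
  have oe: "other_end p v = q" "other_end q v = p"
    using other_end_eq[of v p q] other_end_eq[of v q p] pq by (auto simp: insert_commute)
  have ge: "2 \<le> d p" "2 \<le> d q" using N_degree_ge_2[of _ v] pq by simp_all
  have "2 + give v p + give v q \<le> give p v + give q v"
  proof -
    consider "d p \<noteq> 2" "d q \<noteq> 2" | "d p = 2" "d q \<noteq> 2" | "d q = 2" "d p \<noteq> 2" | "d p = 2" "d q = 2"
      by blast
    then show ?thesis
    proof cases
      case 1
      then show ?thesis using ge oe v(2) by (auto simp: give_def)
    next
      case 2
      then show ?thesis using charge_2_one_thread_end[OF pq] by simp
    next
      case 3
      then show ?thesis using charge_2_one_thread_end[of v q p] pq by (simp add: insert_commute)
    next
      case 4
      have vN: "v \<in> N p" "v \<in> N q" using N_sym pq by simp_all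
      note op = other_end[OF 4(1) vN(1)] and oq = other_end[OF 4(2) vN(2)]
      have "d (other_end v p) \<noteq> 2"
      proof
        assume d2: "d (other_end v p) = 2"
        have "p \<in> N (other_end v p)" using N_sym op(1) by blast
        note o2 = other_end[OF d2 this]
        show False
          by (rule no_four_thread[of "other_end v p" "other_end p (other_end v p)" p v q "other_end v q"])
            (use o2 op oq pq in \<open>auto simp: insert_commute\<close>)
      qed
      moreover have "d (other_end v q) \<noteq> 2"
      proof
        assume d2: "d (other_end v q) = 2"
        have "q \<in> N (other_end v q)" using N_sym oq(1) by blast
        note o2 = other_end[OF d2 this]
        show False
          by (rule no_four_thread[of "other_end v q" "other_end q (other_end v q)" q v p "other_end v p"])
            (use o2 op oq pq in \<open>auto simp: insert_commute\<close>)
      qed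
      ultimately show ?thesis using 4 oe v(2) by (simp add: give_def)
    qed
  qed
  then show ?thesis using pq v(2) by simp
qed

text \<open>
  If \<open>v\<close> pays for a neighbor, then by \<open>no_two_2_neighbors_near_3_vertex\<close> that is its only neighbor of degree 2.
\<close>

lemma charge_3:
  assumes v: "d v = 3"
  shows "8 + (\<Sum>x\<in>N v. give v x) \<le> 3 * d v"
proof (cases "\<exists>x\<in>N v. give v x \<noteq> 0")
  case True
  then obtain x where x: "x \<in> N v" "give v x \<noteq> 0" by blast
  then have dx: "d x = 2" "d (other_end v x) = 3" "give v x = 1"
    using v by (auto simp: give_def split: if_splits)
  note ox = other_end[OF dx(1) N_sym[OF x(1)]]
  have "give v x' = 0" if x': "x' \<in> N v - {x}" for x'
  proof (rule ccontr)
    assume "give v x' \<noteq> 0"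
    then have dx': "d x' = 2" by (auto simp: give_def split: if_splits)
    have "v \<in> N x'" using N_sym x' by blast
    note ox' = other_end[OF dx' this]
    have "card (N v - {x, x'}) = 1"
      using v x x' by (auto simp: degree_def card_Diff_subset card_insert_if)
    then obtain t where "N v - {x, x'} = {t}" by (auto simp: card_1_singleton_iff)
    then have t: "N v = {t, x, x'}" "t \<noteq> x" "t \<noteq> x'" using x x' by blast+
    show False
      by (rule no_two_2_neighbors_near_3_vertex[OF t(1) ox(1) ox'(1) dx(2)])
        (use t ox(2) ox'(2) x' in auto)
  qed
  then have "(\<Sum>x\<in>N v. give v x) = give v x"
    using x(1) sum.remove[OF finite_N x(1), of "give v"] by simp
  then show ?thesis using dx v by simp
next
  case False
  then show ?thesis using v by simp
qed

lemma charge_4: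
  assumes v: "4 \<le> d v"
  shows "8 + (\<Sum>x\<in>N v. give v x) \<le> 3 * d v"
proof -
  have fin: "finite (thick v)" "finite (to_big v)" "finite (to_3 v)" "finite (to_2 v)"
    by (auto simp: thick_def to_big_def to_3_def to_2_def)
  have disj: "to_big v \<inter> to_3 v = {}" "(to_big v \<union> to_3 v) \<inter> to_2 v = {}"
    "thick v \<inter> (to_big v \<union> to_3 v \<union> to_2 v) = {}"
    by (auto simp: thick_def to_big_def to_3_def to_2_def)
  have sub: "to_22 v \<subseteq> to_2 v" by (auto simp: to_22_def)
  have "(\<Sum>x\<in>N v. give v x) = (\<Sum>x\<in>thick v \<union> (to_big v \<union> to_3 v \<union> to_2 v). give v x)"
    using neighbor_cases(1)[of v] by (rule arg_cong)
  also have "\<dots> = (\<Sum>x\<in>thick v. give v x) + (\<Sum>x\<in>to_big v. give v x) + (\<Sum>x\<in>to_3 v. give v x)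
      + (\<Sum>x\<in>to_2 v. give v x)"
    using fin disj by (simp add: sum.union_disjoint)
  also have "(\<Sum>x\<in>to_2 v. give v x) = (\<Sum>x\<in>to_2 v - to_22 v. give v x) + (\<Sum>x\<in>to_22 v. give v x)"
    by (rule sum.subset_diff[OF sub fin(4)])
  also have "(\<Sum>x\<in>thick v. give v x) = 0" by (simp add: thick_def give_def)
  also have "(\<Sum>x\<in>to_big v. give v x) = card (to_big v)"
    using v by (subst sum.cong[of _ _ _ "\<lambda>_. 1"]) (auto simp: to_big_def give_def)
  also have "(\<Sum>x\<in>to_3 v. give v x) = 2 * card (to_3 v)"
    using v by (subst sum.cong[of _ _ _ "\<lambda>_. 2"]) (auto simp: to_3_def give_def)
  also have "(\<Sum>x\<in>to_2 v - to_22 v. give v x) = 2 * card (to_2 v - to_22 v)"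
    using v by (subst sum.cong[of _ _ _ "\<lambda>_. 2"]) (auto simp: to_2_def to_22_def give_def)
  also have "(\<Sum>x\<in>to_22 v. give v x) = 3 * card (to_22 v)"
    using v by (subst sum.cong[of _ _ _ "\<lambda>_. 3"]) (auto simp: to_2_def to_22_def give_def)
  finally have "(\<Sum>x\<in>N v. give v x) = card (to_big v) + 2 * card (to_3 v)
      + 2 * card (to_2 v - to_22 v) + 3 * card (to_22 v)" by simp
  moreover have "card (to_2 v) = card (to_2 v - to_22 v) + card (to_22 v)"
    using sub fin(4) by (metis card_Diff_subset card_mono finite_subset le_add_diff_inverse2)
  ultimately show ?thesis using star_bound[OF v] neighbor_cases(2)[of v] by linarith
qed

lemma degree_sum_ge: "8 * card (pverts G) \<le> 3 * (\<Sum>v\<in>pverts G. d v)"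
proof -
  have Nv: "{u \<in> pverts G. u \<in> N v} = N v" "{u \<in> pverts G. v \<in> N u} = N v" for v
    using N_verts N_sym by blast+
  have "(\<Sum>v\<in>pverts G. \<Sum>x\<in>N v. give v x) = (\<Sum>v\<in>pverts G. \<Sum>x\<in>{x \<in> pverts G. x \<in> N v}. give v x)"
    by (simp only: Nv(1))
  also have "\<dots> = (\<Sum>x\<in>pverts G. \<Sum>v\<in>{v \<in> pverts G. x \<in> N v}. give v x)"
    by (rule sum.swap_restrict) (use pair_finite_verts in auto)
  also have "\<dots> = (\<Sum>x\<in>pverts G. \<Sum>v\<in>N x. give v x)"
    by (simp only: Nv(2))
  finally have flow: "(\<Sum>v\<in>pverts G. \<Sum>x\<in>N v. give v x) = (\<Sum>x\<in>pverts G. \<Sum>v\<in>N x. give v x)" .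
  have "8 + (\<Sum>x\<in>N v. give v x) \<le> 3 * d v + (\<Sum>u\<in>N v. give u v)" if v: "v \<in> pverts G" for v
  proof -
    consider "d v = 2" | "d v = 3" | "4 \<le> d v" using min_degree_2[OF v] by linarith
    then show ?thesis
      using charge_2[OF v] charge_3[of v] charge_4[of v] by cases auto
  qed
  then have "(\<Sum>v\<in>pverts G. 8 + (\<Sum>x\<in>N v. give v x)) \<le> (\<Sum>v\<in>pverts G. 3 * d v + (\<Sum>u\<in>N v. give u v))"
    by (rule sum_mono)
  then have "8 * card (pverts G) + (\<Sum>v\<in>pverts G. \<Sum>x\<in>N v. give v x) \<le>
      (\<Sum>v\<in>pverts G. 3 * d v) + (\<Sum>v\<in>pverts G. \<Sum>u\<in>N v. give u v)"
    by (simp add: sum.distrib mult.commute)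
  then show ?thesis using flow by (simp add: sum_distrib_left)
qed

end

section \<open>From the drawing to the coloring\<close>

definition edges :: "'a pair_pre_digraph \<Rightarrow> 'a set set" where
  "edges G = (\<lambda>(u, v). {u, v}) ` parcs G"

lemma (in pair_graph) edges_iff: "{u, v} \<in> edges G \<longleftrightarrow> v \<in> neighbors G u"
  unfolding edges_def neighbors_def using arcs_symmetric by (force simp: doubleton_eq_iff)

lemma (in pair_graph) plane_graph_edges:
  assumes "plane_drawing G f \<gamma>"
  shows "plane_graph (pverts G) (edges G) f \<gamma>"
proof
  have arcs: "(u, v) \<in> parcs G \<Longrightarrow> Path_Connected.arc (\<gamma> {u, v}) \<and>
      {pathstart (\<gamma> {u, v}), pathfinish (\<gamma> {u, v})} = {f u, f v} \<and>
      path_image (\<gamma> {u, v}) \<inter> f ` pverts G = {f u, f v}" for u v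
    using assms unfolding plane_drawing_def by blast
  show "finite (pverts G)" by (rule pair_finite_verts)
  show "inj_on f (pverts G)" using assms by (simp add: plane_drawing_def)
  fix e assume "e \<in> edges G"
  then obtain u v where e: "e = {u, v}" "(u, v) \<in> parcs G" by (auto simp: edges_def)
  show "\<exists>u v. e = {u, v} \<and> u \<noteq> v \<and> u \<in> pverts G \<and> v \<in> pverts G"
    using e in_arcsD1 in_arcsD2 no_loops' by blast
  show "Path_Connected.arc (\<gamma> e)" "{pathstart (\<gamma> e), pathfinish (\<gamma> e)} = f ` e"
    "path_image (\<gamma> e) \<inter> f ` pverts G = f ` e"
    using arcs[OF e(2)] e(1) by simp_all
  fix e' assume "e' \<in> edges G" "e \<noteq> e'"
  moreover from this obtain x y where "e' = {x, y}" "(x, y) \<in> parcs G" by (auto simp: edges_def)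
  ultimately show "path_image (\<gamma> e) \<inter> path_image (\<gamma> e') \<subseteq> f ` (e \<inter> e')"
    using e assms unfolding plane_drawing_def by blast
qed

lemma (in pair_graph) degree_sum: "(\<Sum>v\<in>pverts G. degree G v) = 2 * card (edges G)"
proof -
  have fin: "finite (edges G)" using pair_finite_arcs by (simp add: edges_def)
  have two: "card e = 2" "e \<subseteq> pverts G" if "e \<in> edges G" for e
    using that no_loops' in_arcsD1 in_arcsD2 by (auto simp: edges_def card_insert_if)
  have deg: "degree G v = card {e \<in> edges G. v \<in> e}" for v
  proof -
    have "inj_on (\<lambda>u. {v, u}) (neighbors G v)"
      by (auto simp: inj_on_def doubleton_eq_iff)
    moreover have "(\<lambda>u. {v, u}) ` neighbors G v = {e \<in> edges G. v \<in> e}"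
    proof
      show "(\<lambda>u. {v, u}) ` neighbors G v \<subseteq> {e \<in> edges G. v \<in> e}"
        using edges_iff by blast
      show "{e \<in> edges G. v \<in> e} \<subseteq> (\<lambda>u. {v, u}) ` neighbors G v"
      proof
        fix e assume e: "e \<in> {e \<in> edges G. v \<in> e}"
        then obtain a b where "e = {a, b}" by (auto simp: edges_def)
        with e obtain u where "e = {v, u}" by (auto simp: insert_commute)
        with e edges_iff show "e \<in> (\<lambda>u. {v, u}) ` neighbors G v" by blast
      qed
    qed
    ultimately show ?thesis unfolding degree_def by (metis card_image)
  qed
  have "(\<Sum>v\<in>pverts G. degree G v) = (\<Sum>v\<in>pverts G. \<Sum>e\<in>{e \<in> edges G. v \<in> e}. 1)"
    by (simp add: deg)
  also have "\<dots> = (\<Sum>e\<in>edges G. \<Sum>v\<in>{v \<in> pverts G. v \<in> e}. 1)"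
    by (rule sum.swap_restrict) (use fin pair_finite_verts in auto)
  also have "\<dots> = (\<Sum>e\<in>edges G. 2)"
  proof (rule sum.cong)
    fix e assume e: "e \<in> edges G"
    have "{v \<in> pverts G. v \<in> e} = e" using two(2)[OF e] by blast
    then show "(\<Sum>v\<in>{v \<in> pverts G. v \<in> e}. 1) = (2::nat)" using two(1)[OF e] by simp
  qed simp
  finally show ?thesis by simp
qed

lemma planar_degree_sum:
  assumes "pair_graph G" "planar G" "girth_ge 8 (\<lambda>u v. v \<in> neighbors G u)" "pverts G \<noteq> {}"
  shows "3 * (\<Sum>v\<in>pverts G. degree G v) < 8 * card (pverts G)"
proof -
  interpret pair_graph G by fact
  obtain f \<gamma> where "plane_drawing G f \<gamma>" using assms(2) by (auto simp: planar_def)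
  moreover have "girth_ge (6 + 2) (\<lambda>u v. {u, v} \<in> edges G)"
    using assms(3) by (simp add: edges_iff)
  ultimately have "6 * card (edges G) + (6 + 2) \<le> (6 + 2) * card (pverts G)"
    by (intro plane_edge_bound plane_graph_edges assms(4))
  then show ?thesis using degree_sum by simp
qed

lemma pair_graph_delete_vertices:
  assumes "pair_graph G" shows "pair_graph (delete_vertices G S)"
proof -
  interpret pair_graph G by fact
  have arcs: "parcs (delete_vertices G S) = {(u, v) \<in> parcs G. u \<notin> S \<and> v \<notin> S}"
    by (simp add: delete_vertices_def)
  show ?thesis
  proof
    show "finite (pverts (delete_vertices G S))" using pair_finite_verts by simp
    show "finite (parcs (delete_vertices G S))"
      unfolding arcs by (rule finite_subset[OF _ pair_finite_arcs]) auto
    show "symmetric (with_proj (delete_vertices G S))"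
      using arcs_symmetric by (auto simp: symmetric_def arcs intro!: symI)
  next
    fix e assume "e \<in> parcs (delete_vertices G S)"
    then show "fst e \<in> pverts (delete_vertices G S)" "snd e \<in> pverts (delete_vertices G S)"
      "fst e \<noteq> snd e"
      unfolding arcs using in_arcsD1 in_arcsD2 no_loops' by auto
  qed
qed

lemma planar_delete_vertices:
  assumes "pair_graph G" "planar G" shows "planar (delete_vertices G S)"
proof -
  interpret pair_graph G by fact
  obtain f \<gamma> where fg: "plane_drawing G f \<gamma>" using assms(2) by (auto simp: planar_def)
  have arcs: "parcs (delete_vertices G S) = {(u, v) \<in> parcs G. u \<notin> S \<and> v \<notin> S}"
    by (simp add: delete_vertices_def)
  have "plane_drawing (delete_vertices G S) f \<gamma>"
    unfolding plane_drawing_def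
  proof (intro conjI ballI)
    show "inj_on f (pverts (delete_vertices G S))"
      using fg unfolding plane_drawing_def by (auto intro: inj_on_subset)
  next
    fix e assume "e \<in> parcs (delete_vertices G S)"
    then obtain u v where e: "e = (u, v)" "(u, v) \<in> parcs G" "u \<notin> S" "v \<notin> S"
      by (auto simp: arcs)
    have *: "Path_Connected.arc (\<gamma> {u, v})" "{pathstart (\<gamma> {u, v}), pathfinish (\<gamma> {u, v})} = {f u, f v}"
      "path_image (\<gamma> {u, v}) \<inter> f ` pverts G = {f u, f v}"
      using fg e(2) unfolding plane_drawing_def by blast+
    have "u \<in> pverts G - S" "v \<in> pverts G - S" using e in_arcsD1 in_arcsD2 by blast+
    then have "path_image (\<gamma> {u, v}) \<inter> f ` (pverts G - S) = {f u, f v}"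
      using *(3) by blast
    with * show "case e of (u, v) \<Rightarrow> Path_Connected.arc (\<gamma> {u, v}) \<and>
        {pathstart (\<gamma> {u, v}), pathfinish (\<gamma> {u, v})} = {f u, f v} \<and>
        path_image (\<gamma> {u, v}) \<inter> f ` pverts (delete_vertices G S) = {f u, f v}"
      by (simp add: e(1))
  next
    fix e assume "e \<in> parcs (delete_vertices G S)"
    then obtain u v where e: "e = (u, v)" "(u, v) \<in> parcs G" by (auto simp: arcs)
    have "\<forall>(u, v)\<in>parcs G. \<forall>(x, y)\<in>parcs G. {u, v} \<noteq> {x, y} \<longrightarrow>
        path_image (\<gamma> {u, v}) \<inter> path_image (\<gamma> {x, y}) \<subseteq> f ` ({u, v} \<inter> {x, y})"
      using fg unfolding plane_drawing_def by (elim conjE)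
    from bspec[OF this e(2)]
    have all: "\<forall>(x, y)\<in>parcs G. {u, v} \<noteq> {x, y} \<longrightarrow>
        path_image (\<gamma> {u, v}) \<inter> path_image (\<gamma> {x, y}) \<subseteq> f ` ({u, v} \<inter> {x, y})"
      by (simp only: prod.case)
    have sub: "parcs (delete_vertices G S) \<subseteq> parcs G" by (auto simp: arcs)
    show "case e of (u, v) \<Rightarrow> \<forall>(x, y)\<in>parcs (delete_vertices G S). {u, v} \<noteq> {x, y} \<longrightarrow>
        path_image (\<gamma> {u, v}) \<inter> path_image (\<gamma> {x, y}) \<subseteq> f ` ({u, v} \<inter> {x, y})"
      unfolding e(1) prod.case by (intro ballI) (rule bspec[OF all subsetD[OF sub]])
  qed
  then show ?thesis by (auto simp: planar_def)
qed

lemma girth_ge_delete_vertices: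
  assumes "girth_ge g (\<lambda>u v. v \<in> neighbors G u)"
  shows "girth_ge g (\<lambda>u v. v \<in> neighbors (delete_vertices G S) u)"
proof -
  have sub: "v \<in> neighbors (delete_vertices G S) u \<Longrightarrow> v \<in> neighbors G u" for u v
    by (simp add: delete_vertices_def neighbors_def)
  have "cyclic_list (\<lambda>u v. v \<in> neighbors (delete_vertices G S) u) xs \<Longrightarrow>
      cyclic_list (\<lambda>u v. v \<in> neighbors G u) xs" for xs
    unfolding cyclic_list_def using sub by (auto elim: successively_mono)
  then show ?thesis using assms unfolding girth_ge_def by metis
qed

lemma girth_ge_of_girth:
  assumes "pair_graph G" "enat g \<le> girth G"
  shows "girth_ge g (\<lambda>u v. v \<in> neighbors G u)"
  unfolding girth_ge_def
proof (intro allI impI)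
  fix xs assume cyc: "cyclic_list (\<lambda>u v. v \<in> neighbors G u) xs"
  interpret pair_graph G by fact
  have walk: "awalk a (zip (a # zs) zs) (last (a # zs)) \<and> awalk_verts a (zip (a # zs) zs) = a # zs"
    if "successively (\<lambda>u v. v \<in> neighbors G u) (a # zs)" "a \<in> pverts G" for a zs
    using that
  proof (induction zs arbitrary: a)
    case Nil
    then show ?case by (simp add: awalk_Nil_iff)
  next
    case (Cons b zs)
    then have "(a, b) \<in> parcs G" by (simp add: neighbors_def)
    moreover from this have "b \<in> pverts G" by (rule in_arcsD2)
    ultimately show ?case using Cons by (simp add: awalk_Cons_iff)
  qed
  obtain a ys where xs: "xs = a # ys" using cyc by (cases xs) (auto simp: cyclic_list_def)
  let ?p = "zip (a # ys @ [a]) (ys @ [a])"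
  have "successively (\<lambda>u v. v \<in> neighbors G u) (a # ys @ [a])"
    using cyc unfolding cyclic_list_def xs
    by (simp add: successively_append_iff[of _ "a # ys" "[a]", simplified])
  moreover have "a \<in> pverts G"
    using cyc unfolding cyclic_list_def xs by (auto simp: neighbors_def dest: in_arcsD2)
  ultimately have "awalk a ?p a" "awalk_verts a ?p = a # ys @ [a]"
    using walk[of a "ys @ [a]"] by auto
  then have "cycle ?p"
    using cyc unfolding cycle_def cyclic_list_def xs by (intro exI[of _ a]) auto
  moreover have "length ?p = length xs" by (simp add: xs)
  moreover have "3 \<le> length xs" using cyc by (simp add: cyclic_list_def)
  ultimately have "girth G \<le> enat (length xs)"
    unfolding girth_def by (metis (mono_tags, lifting) INF_lower mem_Collect_eq)
  then show "g \<le> length xs" using assms(2) by (metis enat_ord_simps(1) order_trans)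
qed

text \<open>
  Planarity and the girth bound pass to subgraphs, and lists that are large enough for a graph are so for its
  subgraphs. So a smallest counterexample, with lists cut down to the least size, is critical.
\<close>

lemma pcf_degree_choosable_of_girth_ge:
  assumes "pair_graph G" "planar G" "girth_ge 8 (\<lambda>u v. v \<in> neighbors G u)"
  shows "pcf_degree_choosable TYPE('c) 2 G"
  using assms
proof (induction "card (pverts G)" arbitrary: G rule: less_induct)
  case less
  show ?case
    unfolding pcf_degree_choosable_def
  proof (intro allI impI, rule ccontr)
    fix L0 :: "'a \<Rightarrow> 'c set"
    assume L0: "\<forall>v\<in>pverts G. infinite (L0 v) \<or> degree G v + 2 \<le> card (L0 v)"
      and none: "\<not> (\<exists>\<phi>. list_coloring G L0 \<phi> \<and> pcf_coloring G \<phi>)"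
    have "\<exists>A. A \<subseteq> L0 v \<and> card A = degree G v + 2" if "v \<in> pverts G" for v
      using L0 that obtain_subset_with_card_n infinite_arbitrarily_large by metis
    then obtain L where L: "\<And>v. v \<in> pverts G \<Longrightarrow> L v \<subseteq> L0 v"
      "\<And>v. v \<in> pverts G \<Longrightarrow> card (L v) = degree G v + 2"
      by metis
    interpret pair_graph G by (rule less.prems(1))
    note finV = pair_finite_verts
    have smaller: "\<exists>\<phi>. list_coloring (delete_vertices G S) L \<phi> \<and> pcf_coloring (delete_vertices G S) \<phi>"
      if S: "S \<noteq> {}" "S \<subseteq> pverts G" for S
    proof -
      have "card (pverts (delete_vertices G S)) < card (pverts G)"
        using S finV by (intro psubset_card_mono) auto
      then have "pcf_degree_choosable TYPE('c) 2 (delete_vertices G S)"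
        using less.prems by (intro less.hyps pair_graph_delete_vertices planar_delete_vertices
            girth_ge_delete_vertices)
      moreover have "degree (delete_vertices G S) v + 2 \<le> card (L v)"
        if "v \<in> pverts (delete_vertices G S)" for v
      proof -
        have "finite (neighbors G v)"
          by (rule finite_subset[OF _ finV])
            (auto simp: neighbors_def dest: in_arcsD2)
        then have "degree (delete_vertices G S) v \<le> degree G v"
          using that by (simp add: degree_def neighbors_delete_vertices card_mono)
        then show ?thesis using L(2) that by simp
      qed
      ultimately show ?thesis unfolding pcf_degree_choosable_def by blast
    qed
    have "critical_graph G L"
    proof (intro critical_graph.intro critical_graph_axioms.intro)
      show "\<not> (list_coloring G L \<phi> \<and> pcf_coloring G \<phi>)" for \<phi>
        using none L(1) unfolding list_coloring_def by blast
    qed (use less.prems L(2) smaller in auto)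
    then have "8 * card (pverts G) \<le> 3 * (\<Sum>v\<in>pverts G. degree G v)"
      by (rule critical_graph.degree_sum_ge)
    moreover have "pverts G \<noteq> {}"
    proof
      assume "pverts G = {}"
      moreover from this have "parcs G = {}"
        using arc_fst_in_verts by fastforce
      ultimately show False
        using none by (auto simp: list_coloring_def pcf_coloring_def proper_coloring_def)
    qed
    ultimately show False using planar_degree_sum[OF less.prems] by linarith
  qed
qed

theorem corollary1p3:
  fixes G :: "'a pair_pre_digraph"
  assumes "pair_graph G"
    and "planar G"
    and "girth G \<ge> 8"
  shows "pcf_degree_choosable TYPE('c) 2 G"
proof -
  have "enat 8 \<le> girth G" using assms(3) by (simp add: numeral_eq_enat)
  from girth_ge_of_girth[OF assms(1) this] show ?thesis
    by (rule pcf_degree_choosable_of_girth_ge[OF assms(1,2)])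
qed

end
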